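(* Let $f:\mathbb R\to\mathbb R$ and suppose there are $K_1,\dots,K_5\in\mathbb R$ and $q\ge 1$ such that for all $\xi,\eta\in\mathbb R$: $(f(\xi)-f(\eta))(\xi-\eta)\le K_1(\xi-\eta)^2$, $f(\xi)\xi\le K_2|\xi|^2+K_3$, and $|f(\xi)|\le K_4|\xi|^q+K_5$. Let $g:\mathbb R\to\mathbb R$ be continuous, and suppose there is $K_6\ge 0$ with $0\ne|g(\xi)|\le K_6$ for all $\xi\in\mathbb R$. Assume $K_2<\lambda_1=\pi^2$. Then for every $N\in\mathbb N_+$ and every $\tau\in(0,1)$ with $(K_1-\lambda_1)\tau<1$, the Markov chain $\{X^N_n\}_{n\in\mathbb N}$ on $V_N$ generated by the drift-implicit Euler Galerkin scheme $$X^N_{j+1}=X^N_j+\tau\Delta_N X^N_{j+1}+\tau\mathcal P_N F(X^N_{j+1})+\mathcal P_N G(X^N_j)\,\delta_jW,\qquad j\in\mathbb N,$$ is uniquely ergodic.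
   Context: $H=L^2(0,1)$ with norm $\|\cdot\|$ and inner product $\langle\cdot,\cdot\rangle$. $\Delta$ is the Dirichlet Laplacian on $(0,1)$, with $-\Delta e_k=\lambda_k e_k$, $k\in\mathbb N_+$, where $\{e_k\}$ are the orthonormal eigenfunctions vanishing at $0,1$ and the eigenvalues $\lambda_k$ are increasing; $\lambda_1=\pi^2$. $\dot H^1=H^1_0(0,1)$, with dual $\dot H^{-1}$ and duality pairing ${}_1\langle\cdot,\cdot\rangle_{-1}$. $V_N=\mathrm{span}\{e_1,\dots,e_N\}$ is equipped with the norm $\|\cdot\|$ and its Borel $\sigma$-algebra $\mathcal B(V_N)$. $\Delta_N:V_N\to V_N$ is defined by $\langle\Delta_N u,v\rangle=-\langle\nabla u,\nabla v\rangle$ for $u,v\in V_N$; $\mathcal P_N:\dot H^{-1}\to V_N$ is defined by $\langle\mathcal P_N u,v\rangle={}_1\langle v,u\rangle_{-1}$ for $u\in\dot H^{-1}$, $v\in V_N$ (the $L^2$-orthogonal projection on $H$). $F(x)(\xi)=f(x(\xi))$ for $x\in\dot H^1$. $W$ is an $H$-valued cylindrical Wiener process on a complete filtered probability space $(\Omega,\mathscr F,(\mathscr F(t))_{t\ge0},\mathbb P)$: formally $W(t)=\sum_{k\ge1}g_k\beta_k(t)$ with $\{g_k\}$ an orthonormal basis of $H$ and $\{\beta_k\}$ independent Brownian motions (with respect to the filtration). For a step size $\tau$, $t_j=j\tau$ and $\delta_jW=W(t_{j+1})-W(t_j)$. $G(x)$ is multiplication by $g(x(\cdot))$: $(G(x)h)(\xi)=g(x(\xi))h(\xi)$;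 and $\mathcal P_N G(x)\delta_jW=\sum_{k\ge1}\mathcal P_N(G(x)g_k)\,(\beta_k(t_{j+1})-\beta_k(t_j))$ (convergent in $L^2(\Omega;V_N)$). The initial value $X^N_0$ is an $\mathscr F(0)$-measurable $V_N$-valued random variable. The scheme determines $X^N_{j+1}$ implicitly from $X^N_j$ and the noise increment; the resulting Markov chain has transition kernel $P(x,A)=\mathbb P(X^N_{n+1}\in A\mid X^N_n=x)$, $x\in V_N$, $A\in\mathcal B(V_N)$, and semigroup $P_n\phi(x)=\mathbb E[\phi(X^N_n)\mid X^N_0=x]$. A probability measure $\mu$ on $V_N$ is invariant if $\int_{V_N}P(x,A)\,\mu(dx)=\mu(A)$ for all $A\in\mathcal B(V_N)$. An invariant probability measure $\mu$ is ergodic if $\lim_{m\to\infty}\frac1m\sum_{n=0}^mP_n\phi=\int\phi\,d\mu$ in $L^2(V_N;\mu)$ for all $\phi\in L^2(V_N;\mu)$. The chain is uniquely ergodic if it admits exactly one invariant probability measure (which is then ergodic). *)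

theory Defs
  imports "HOL-Probability.Probability"
begin

text \<open>
  \<^bold>\<open>Real \<open>L\<^sup>2\<close> spaces.\<close> Elements are represented by square integrable functions, i.e. by
  representatives of the usual equivalence classes. This is used both for \<open>H = L\<^sup>2(0,1)\<close> and for
  \<open>L\<^sup>2(V\<^sub>N; \<mu>)\<close>.
\<close>

definition L2_space :: "'a measure \<Rightarrow> ('a \<Rightarrow> real) set" where
  "L2_space M = {h \<in> borel_measurable M. integrable M (\<lambda>x. (h x)\<^sup>2)}"

definition L2_tendsto :: "'a measure \<Rightarrow> (nat \<Rightarrow> 'a \<Rightarrow> real) \<Rightarrow> ('a \<Rightarrow> real) \<Rightarrow> bool" where
  "L2_tendsto M u v \<longleftrightarrow> (\<forall>m. u m \<in> L2_space M) \<and> v \<in> L2_space M \<and>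
     (\<lambda>m. LINT x|M. (u m x - v x)\<^sup>2) \<longlonglongrightarrow> 0"

abbreviation unit_interval :: "real measure" where
  "unit_interval \<equiv> lebesgue_on {0<..<1}"

definition ip :: "(real \<Rightarrow> real) \<Rightarrow> (real \<Rightarrow> real) \<Rightarrow> real" where
  "ip u v = (LINT \<xi>|unit_interval. u \<xi> * v \<xi>)"

definition nrm :: "(real \<Rightarrow> real) \<Rightarrow> real" where
  "nrm u = sqrt (ip u u)"

definition orthonormal_basis_H :: "(nat \<Rightarrow> real \<Rightarrow> real) \<Rightarrow> bool" where
  "orthonormal_basis_H b \<longleftrightarrow>
     (\<forall>k. b k \<in> L2_space unit_interval) \<and>
     (\<forall>i k. ip (b i) (b k) = (if i = k then 1 else 0)) \<and>
     (\<forall>h \<in> L2_space unit_interval.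
        L2_tendsto unit_interval (\<lambda>m \<xi>. \<Sum>k<m. ip h (b k) * b k \<xi>) h)"

text \<open>
  \<^bold>\<open>Spectral Galerkin space.\<close> \<open>e k\<close>, \<open>k \<ge> 1\<close>, are the orthonormal eigenfunctions of the Dirichlet
  Laplacian on \<open>(0,1)\<close>, with eigenvalues \<open>(k \<pi>)\<^sup>2\<close>. A member of \<open>V\<^sub>N\<close> is stored as a sine polynomial
  on the whole real line; it is determined by its restriction to \<open>(0,1)\<close>.
\<close>

definition e :: "nat \<Rightarrow> real \<Rightarrow> real" where
  "e k \<xi> = sqrt 2 * sin (real k * pi * \<xi>)"

lemma e_eigenfunction: "deriv (deriv (e k)) \<xi> = - ((real k * pi)\<^sup>2 * e k \<xi>)"
proof -
  have *: "deriv (e k) = (\<lambda>\<xi>. sqrt 2 * (real k * pi) * cos (real k * pi * \<xi>))"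
    unfolding e_def
    by (rule ext, rule DERIV_imp_deriv) (auto intro!: derivative_eq_intros)
  show ?thesis
    unfolding * e_def
    by (rule DERIV_imp_deriv) (auto intro!: derivative_eq_intros simp: power2_eq_square)
qed

lemma e_boundary: "e k 0 = 0" "e k 1 = 0"
  by (simp_all add: e_def)

definition VN :: "nat \<Rightarrow> (real \<Rightarrow> real) set" where
  "VN N = {\<lambda>\<xi>. \<Sum>k = 1..N. c k * e k \<xi> | c. True}"

definition borelVN :: "nat \<Rightarrow> (real \<Rightarrow> real) measure" where
  "borelVN N = sigma (VN N)
     {U. openin (Metric_space.mtopology (VN N) (\<lambda>u v. nrm (\<lambda>\<xi>. u \<xi> - v \<xi>))) U}"

definition DeltaN :: "nat \<Rightarrow> (real \<Rightarrow> real) \<Rightarrow> (real \<Rightarrow> real)" where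
  "DeltaN N u = (THE w. w \<in> VN N \<and> (\<forall>v \<in> VN N. ip w v = - ip (deriv u) (deriv v)))"

text \<open>
  The projection is only ever applied to elements of \<open>H\<close>, on which the duality pairing between
  \<open>H\<^sup>1\<^sub>0\<close> and its dual is the inner product of \<open>H\<close>.
\<close>

definition PN :: "nat \<Rightarrow> (real \<Rightarrow> real) \<Rightarrow> (real \<Rightarrow> real)" where
  "PN N u = (THE w. w \<in> VN N \<and> (\<forall>v \<in> VN N. ip w v = ip u v))"

definition Fop :: "(real \<Rightarrow> real) \<Rightarrow> (real \<Rightarrow> real) \<Rightarrow> (real \<Rightarrow> real)" where
  "Fop f x = (\<lambda>\<xi>. f (x \<xi>))"

definition Gop :: "(real \<Rightarrow> real) \<Rightarrow> (real \<Rightarrow> real) \<Rightarrow> (real \<Rightarrow> real) \<Rightarrow> (real \<Rightarrow> real)" where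
  "Gop g x h = (\<lambda>\<xi>. g (x \<xi>) * h \<xi>)"

definition complete_filtered_prob_space :: "'a measure \<Rightarrow> (real \<Rightarrow> 'a measure) \<Rightarrow> bool" where
  "complete_filtered_prob_space M Fil \<longleftrightarrow>
     prob_space M \<and> complete_measure M \<and>
     (\<forall>t\<ge>0. subalgebra M (Fil t)) \<and>
     (\<forall>s t. 0 \<le> s \<and> s \<le> t \<longrightarrow> sets (Fil s) \<subseteq> sets (Fil t)) \<and>
     null_sets M \<subseteq> sets (Fil 0)"

text \<open>
  The coordinates \<open>\<beta> k\<close> of a cylindrical Wiener process. The last two clauses say that, for
  \<open>s < t\<close>, the increments over \<open>[s,t]\<close> are independent of each other and that the whole sequence of
  them is independent of \<open>Fil s\<close>. Together with adaptedness this makes the \<open>\<beta> k\<close> independent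
  processes, each a Brownian motion with respect to the filtration.
\<close>

definition independent_Brownian_motions ::
  "'a measure \<Rightarrow> (real \<Rightarrow> 'a measure) \<Rightarrow> (nat \<Rightarrow> real \<Rightarrow> 'a \<Rightarrow> real) \<Rightarrow> bool" where
  "independent_Brownian_motions M Fil \<beta> \<longleftrightarrow>
     (\<forall>k. \<forall>t\<ge>0. \<beta> k t \<in> borel_measurable (Fil t)) \<and>
     (\<forall>k. AE \<omega> in M. \<beta> k 0 \<omega> = 0) \<and>
     (\<forall>k. AE \<omega> in M. continuous_on {0..} (\<lambda>t. \<beta> k t \<omega>)) \<and>
     (\<forall>k s t. 0 \<le> s \<and> s < t \<longrightarrow>
        distributed M lborel (\<lambda>\<omega>. \<beta> k t \<omega> - \<beta> k s \<omega>) (normal_density 0 (sqrt (t - s)))) \<and>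
     (\<forall>s t. 0 \<le> s \<and> s < t \<longrightarrow>
        prob_space.indep_vars M (\<lambda>_. borel) (\<lambda>k \<omega>. \<beta> k t \<omega> - \<beta> k s \<omega>) UNIV) \<and>
     (\<forall>s t. 0 \<le> s \<and> s < t \<longrightarrow>
        prob_space.indep_set M (sets (Fil s))
          (sets (vimage_algebra (space M) (\<lambda>\<omega> k. \<beta> k t \<omega> - \<beta> k s \<omega>) (Pi\<^sub>M UNIV (\<lambda>_. borel)))))"

text \<open>
  \<open>Z\<close> is (a version of) \<open>P\<^sub>N G(Y) \<delta>\<^sub>jW\<close>, where \<open>W = \<Sum>\<^sub>k b\<^sub>k \<beta>\<^sub>k\<close>: the series
  \<open>\<Sum>\<^sub>k P\<^sub>N (G(Y) b\<^sub>k) (\<beta>\<^sub>k(t\<^sub>j\<^sub>+\<^sub>1) - \<beta>\<^sub>k(t\<^sub>j))\<close> converges to \<open>Z\<close> in \<open>L\<^sup>2(\<Omega>; V\<^sub>N)\<close>.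
\<close>

definition noise_increment ::
  "'a measure \<Rightarrow> (nat \<Rightarrow> real \<Rightarrow> real) \<Rightarrow> (nat \<Rightarrow> real \<Rightarrow> 'a \<Rightarrow> real) \<Rightarrow> (real \<Rightarrow> real) \<Rightarrow> nat \<Rightarrow> real
    \<Rightarrow> nat \<Rightarrow> ('a \<Rightarrow> real \<Rightarrow> real) \<Rightarrow> ('a \<Rightarrow> real \<Rightarrow> real) \<Rightarrow> bool" where
  "noise_increment M b \<beta> g N \<tau> j Y Z \<longleftrightarrow>
     Z \<in> measurable M (borelVN N) \<and>
     (\<lambda>m. \<integral>\<^sup>+\<omega>. ennreal ((nrm (\<lambda>\<xi>.
            (\<Sum>k<m. PN N (Gop g (Y \<omega>) (b k)) \<xi> * (\<beta> k (real (Suc j) * \<tau>) \<omega> - \<beta> k (real j * \<tau>) \<omega>))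
            - Z \<omega> \<xi>))\<^sup>2) \<partial>M) \<longlonglongrightarrow> 0"

text \<open>
  An adapted \<open>V\<^sub>N\<close>-valued process following the scheme. Adaptedness at time \<open>0\<close> says that the
  initial value is \<open>Fil 0\<close>-measurable.
\<close>

definition euler_chain ::
  "'a measure \<Rightarrow> (real \<Rightarrow> 'a measure) \<Rightarrow> (nat \<Rightarrow> real \<Rightarrow> real) \<Rightarrow> (nat \<Rightarrow> real \<Rightarrow> 'a \<Rightarrow> real)
    \<Rightarrow> (real \<Rightarrow> real) \<Rightarrow> (real \<Rightarrow> real) \<Rightarrow> nat \<Rightarrow> real \<Rightarrow> (nat \<Rightarrow> 'a \<Rightarrow> real \<Rightarrow> real) \<Rightarrow> bool" where
  "euler_chain M Fil b \<beta> f g N \<tau> Y \<longleftrightarrow>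
     (\<forall>j. Y j \<in> measurable (Fil (real j * \<tau>)) (borelVN N)) \<and>
     (\<forall>j. \<exists>Z. noise_increment M b \<beta> g N \<tau> j (Y j) Z \<and>
        (AE \<omega> in M. Y (Suc j) \<omega> =
           (\<lambda>\<xi>. Y j \<omega> \<xi> + \<tau> * DeltaN N (Y (Suc j) \<omega>) \<xi>
                + \<tau> * PN N (Fop f (Y (Suc j) \<omega>)) \<xi> + Z \<omega> \<xi>)))"

text \<open>
  For a family \<open>X\<close> of chains, \<open>X x\<close> being started from the deterministic state \<open>x\<close>, the following
  are the transition kernel and the semigroup.
\<close>

definition transition_kernel ::
  "'a measure \<Rightarrow> ((real \<Rightarrow> real) \<Rightarrow> nat \<Rightarrow> 'a \<Rightarrow> real \<Rightarrow> real)
    \<Rightarrow> (real \<Rightarrow> real) \<Rightarrow> (real \<Rightarrow> real) set \<Rightarrow> real" where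
  "transition_kernel M X x A = measure M {\<omega> \<in> space M. X x 1 \<omega> \<in> A}"

definition semigroup_op ::
  "'a measure \<Rightarrow> ((real \<Rightarrow> real) \<Rightarrow> nat \<Rightarrow> 'a \<Rightarrow> real \<Rightarrow> real)
    \<Rightarrow> nat \<Rightarrow> ((real \<Rightarrow> real) \<Rightarrow> real) \<Rightarrow> (real \<Rightarrow> real) \<Rightarrow> real" where
  "semigroup_op M X n \<phi> x = (LINT \<omega>|M. \<phi> (X x n \<omega>))"

text \<open>The process \<open>Y\<close>, observed at the times \<open>n \<tau>\<close>, is a Markov chain with transition kernel \<open>P\<close>.\<close>

definition markov_chain_with_kernel ::
  "'a measure \<Rightarrow> (real \<Rightarrow> 'a measure) \<Rightarrow> nat \<Rightarrow> real \<Rightarrow> (nat \<Rightarrow> 'a \<Rightarrow> real \<Rightarrow> real)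
    \<Rightarrow> ((real \<Rightarrow> real) \<Rightarrow> (real \<Rightarrow> real) set \<Rightarrow> real) \<Rightarrow> bool" where
  "markov_chain_with_kernel M Fil N \<tau> Y P \<longleftrightarrow>
     (\<forall>A \<in> sets (borelVN N). (\<lambda>x. P x A) \<in> borel_measurable (borelVN N)) \<and>
     (\<forall>n. \<forall>A \<in> sets (borelVN N). AE \<omega> in M.
        real_cond_exp M (Fil (real n * \<tau>)) (indicator {\<omega> \<in> space M. Y (Suc n) \<omega> \<in> A}) \<omega>
          = P (Y n \<omega>) A)"

definition invariant_prob ::
  "nat \<Rightarrow> ((real \<Rightarrow> real) \<Rightarrow> (real \<Rightarrow> real) set \<Rightarrow> real) \<Rightarrow> (real \<Rightarrow> real) measure \<Rightarrow> bool" where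
  "invariant_prob N P \<mu> \<longleftrightarrow>
     prob_space \<mu> \<and> sets \<mu> = sets (borelVN N) \<and>
     (\<forall>A \<in> sets (borelVN N). (\<integral>\<^sup>+x. ennreal (P x A) \<partial>\<mu>) = emeasure \<mu> A)"

definition ergodic_prob ::
  "(nat \<Rightarrow> ((real \<Rightarrow> real) \<Rightarrow> real) \<Rightarrow> (real \<Rightarrow> real) \<Rightarrow> real) \<Rightarrow> (real \<Rightarrow> real) measure \<Rightarrow> bool" where
  "ergodic_prob Pn \<mu> \<longleftrightarrow>
     (\<forall>\<phi> \<in> L2_space \<mu>.
        L2_tendsto \<mu> (\<lambda>m x. (1 / real m) * (\<Sum>n = 0..m. Pn n \<phi> x)) (\<lambda>_. LINT y|\<mu>. \<phi> y))"

text \<open>Exactly one invariant probability measure, which moreover is ergodic.\<close>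

definition uniquely_ergodic ::
  "nat \<Rightarrow> ((real \<Rightarrow> real) \<Rightarrow> (real \<Rightarrow> real) set \<Rightarrow> real)
    \<Rightarrow> (nat \<Rightarrow> ((real \<Rightarrow> real) \<Rightarrow> real) \<Rightarrow> (real \<Rightarrow> real) \<Rightarrow> real) \<Rightarrow> bool" where
  "uniquely_ergodic N P Pn \<longleftrightarrow>
     (\<exists>!\<mu>. invariant_prob N P \<mu>) \<and> (\<forall>\<mu>. invariant_prob N P \<mu> \<longrightarrow> ergodic_prob Pn \<mu>)"

end

theory Submission
  imports Defs
begin

text \<open>
  Expand states of \<open>V\<^sub>N\<close> in the sine basis. One step of the scheme maps a state \<open>x\<close> to the solution \<open>w\<close> of
  \<open>w - \<tau> \<Delta>\<^sub>N w - \<tau> P\<^sub>N F(w) = x + Z\<^sub>x\<close> with \<open>Z\<^sub>x\<close> Gaussian. The left-hand side is strongly monotone in \<open>w\<close> because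
  \<open>(K\<^sub>1 - \<lambda>\<^sub>1) \<tau> < 1\<close>, so its inverse is Lipschitz on its range, whatever that range is (\<open>f\<close> need not be continuous, and
  solvability is part of the hypotheses), and extends to a measurable map of the whole space. Hence the kernel is
  the image under a fixed map of the law \<open>\<kappa> x\<close> of \<open>x + Z\<^sub>x\<close>, and \<open>K\<^sub>2 < \<lambda>\<^sub>1\<close> makes the squared norm a Lyapunov function.

  Harris' theorem, with the contraction argument of Hairer and Mattingly, then only needs that the total variation
  distance of \<open>\<kappa> x\<close> and \<open>\<kappa> y\<close> stays away from 1 for \<open>x\<close>, \<open>y\<close> in a bounded set. As \<open>G(x) (y / g(x)) = y\<close>, a translation of \<open>Z\<^sub>x\<close>
  by \<open>y\<close> is a translation of the white noise by \<open>y / g(x)\<close>, and Cameron-Martin bounds its effect on small sets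
  uniformly. If a set had small mass under \<open>\<kappa> x\<close> and large mass under \<open>\<kappa> y\<close>, the convolution of the two laws would
  therefore give small mass both to that set and to its complement.
\<close>

section \<open>Harris' theorem in weighted total variation\<close>

text \<open>The noise coefficient depends on the state, so the laws \<open>\<kappa> x\<close> and
  \<open>\<kappa> y\<close> differ by more than a translation. This is why a translation estimate
  for each single law is fed into the convolution of the two, which can be sliced so that either
  factor is the one translated. The noise is given only as a mean square limit of the series over
  the Brownian coordinates, so its law is reached through Lipschitz functions of finite truncations.
  Cameron-Martin is therefore used as a quadratic inequality whose constant, exp(energy / \<tau>),
  stays bounded along the truncations and survives the limit. The Lyapunov rate comes from pairing
  the implicit equation with its solution: solving it divides the squared norm by \<theta> = 2 (1 +
  \<tau> (pi^2 - K2)) - 1 > 1, up to a constant, and the noise may use up half of the excess of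
  \<theta> over 1. In Harris' theorem the laws after n steps converge at a geometric rate uniform
  over all measurable sets. This uniformity makes the setwise limit countably additive, so the
  invariant measure is obtained as that limit.\<close>

lemma staircase_pointwise:
  fixes t :: real and k :: nat
  assumes t: "0 \<le> t" "t \<le> 1" and k: "k \<ge> 1"
  shows "\<bar>t - (1 / real k) * (\<Sum>i = 1..k. indicator {real i / real k..} t)\<bar> \<le> 1 / real k"
proof -
  define m where "m = nat \<lfloor>real k * t\<rfloor>"
  have kt: "0 \<le> real k * t" "real k * t \<le> real k"
    using t k by (auto simp: mult_left_le)
  have m: "real m \<le> real k * t" "real k * t < real m + 1"
    unfolding m_def using kt by linarith+
  have mk: "m \<le> k" using m kt by linarith
  have ind: "indicator {real i / real k..} t = (if i \<le> m then 1 else 0 :: real)" for i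
  proof -
    have "real i / real k \<le> t \<longleftrightarrow> real i \<le> real k * t"
      using k by (simp add: field_simps)
    also have "\<dots> \<longleftrightarrow> i \<le> m" using m by linarith
    finally show ?thesis by (simp add: indicator_def)
  qed
  have "(\<Sum>i = 1..k. indicator {real i / real k..} t) = (\<Sum>i \<in> {1..k}. if i \<in> {1..m} then 1 else 0 :: real)"
    unfolding ind by (intro sum.cong) auto
  also have "\<dots> = real m"
    using mk by (subst sum.inter_restrict[symmetric]) (auto simp: Int_absorb1)
  finally have *: "(\<Sum>i = 1..k. indicator {real i / real k..} t) = real m" .
  have "t - (1 / real k) * real m = (real k * t - real m) / real k"
    using k by (simp add: field_simps)
  also have "\<bar>\<dots>\<bar> \<le> 1 / real k"
    using m k by (simp add: divide_right_mono)
  finally show ?thesis unfolding * .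
qed

text \<open>A discretised layer-cake formula: \<open>k\<close> superlevel sets approximate the
  integral with an error \<open>1/k\<close> that does not depend on the measure. This is the bridge
  from bounds and limits for sets to bounds and limits for functions.\<close>

lemma staircase_integral:
  fixes \<phi> :: "'a \<Rightarrow> real"
  assumes p: "prob_space p" and \<phi>[measurable]: "\<phi> \<in> borel_measurable p"
    and b: "\<And>x. x \<in> space p \<Longrightarrow> 0 \<le> \<phi> x \<and> \<phi> x \<le> 1" and k: "k \<ge> 1"
  shows "\<bar>(LINT x|p. \<phi> x) - (1 / real k) * (\<Sum>i = 1..k. measure p {x \<in> space p. real i / real k \<le> \<phi> x})\<bar>
    \<le> 1 / real k"
proof -
  interpret prob_space p by fact
  let ?s = "\<lambda>x. (1 / real k) * (\<Sum>i = 1..k. indicator {x \<in> space p. real i / real k \<le> \<phi> x} x)"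
  have int\<phi>: "integrable p \<phi>"
    by (rule integrable_const_bound[where B = 1]) (use b in auto)
  have ints: "integrable p ?s" by (intro integrable_mult_right Bochner_Integration.integrable_sum) (auto simp: less_top[symmetric])
  have pw: "\<bar>\<phi> x - ?s x\<bar> \<le> 1 / real k" if "x \<in> space p" for x
  proof -
    have "?s x = (1 / real k) * (\<Sum>i = 1..k. indicator {real i / real k..} (\<phi> x))"
      using that by (simp add: indicator_def)
    then show ?thesis using staircase_pointwise[of "\<phi> x" k] b[OF that] k by simp
  qed
  have "(LINT x|p. ?s x) = (1 / real k) * (\<Sum>i = 1..k. measure p {x \<in> space p. real i / real k \<le> \<phi> x})"
  proof -
    have "(LINT x|p. (\<Sum>i = 1..k. indicator {x \<in> space p. real i / real k \<le> \<phi> x} x :: real))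
      = (\<Sum>i = 1..k. LINT x|p. indicator {x \<in> space p. real i / real k \<le> \<phi> x} x)"
      by (rule Bochner_Integration.integral_sum) (auto simp: less_top[symmetric])
    also have "\<dots> = (\<Sum>i = 1..k. measure p {x \<in> space p. real i / real k \<le> \<phi> x})"
      by (intro sum.cong refl) (simp add: Int_absorb2 subset_eq)
    finally show ?thesis by (simp only: integral_mult_right_zero)
  qed
  from this[symmetric] have "\<bar>(LINT x|p. \<phi> x) - (1 / real k) * (\<Sum>i = 1..k. measure p {x \<in> space p. real i / real k \<le> \<phi> x})\<bar>
    = \<bar>LINT x|p. \<phi> x - ?s x\<bar>"
    by (subst Bochner_Integration.integral_diff[OF int\<phi> ints]) (simp only:)
  also have "\<dots> \<le> (LINT x|p. \<bar>\<phi> x - ?s x\<bar>)" by (rule integral_abs_bound)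
  also have "\<dots> \<le> (LINT x|p. 1 / real k)"
    using pw by (intro integral_mono integrable_abs Bochner_Integration.integrable_diff int\<phi> ints) auto
  also have "\<dots> = 1 / real k" by (simp add: prob_space)
  finally show ?thesis .
qed

text \<open>Subtracting the layer-cake sums compares the same level sets under \<open>p\<close> and
  \<open>q\<close>, and the average of \<open>k\<close> copies of \<open>\<delta>\<close> is again
  \<open>\<delta>\<close>. Only the discretisation error \<open>2/k\<close> is added, and it
  vanishes as \<open>k\<close> grows.\<close>

lemma integral_diff_le_of_measure_diff_le:
  fixes \<phi> :: "'a \<Rightarrow> real"
  assumes p: "prob_space p" "sets p = sets S" and q: "prob_space q" "sets q = sets S"
    and d: "\<And>A. A \<in> sets S \<Longrightarrow> measure p A - measure q A \<le> \<delta>"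
    and \<phi>: "\<phi> \<in> borel_measurable S" and b: "\<And>x. x \<in> space S \<Longrightarrow> 0 \<le> \<phi> x \<and> \<phi> x \<le> 1"
  shows "(LINT x|p. \<phi> x) - (LINT x|q. \<phi> x) \<le> \<delta>"
proof -
  have sp: "space p = space S" "space q = space S" using p q by (auto dest: sets_eq_imp_space_eq)
  have [measurable]: "\<phi> \<in> borel_measurable p" "\<phi> \<in> borel_measurable q"
    using \<phi> p q by (simp_all cong: measurable_cong_sets)
  have "(LINT x|p. \<phi> x) - (LINT x|q. \<phi> x) \<le> \<delta> + 2 / real k" if k: "k \<ge> 1" for k :: nat
  proof -
    let ?A = "\<lambda>i. {x \<in> space S. real i / real k \<le> \<phi> x}"
    have A: "?A i \<in> sets S" for i using \<phi> by measurable
    have 1: "(LINT x|p. \<phi> x) \<le> (1 / real k) * (\<Sum>i = 1..k. measure p (?A i)) + 1 / real k"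
      using staircase_integral[OF p(1), of \<phi> k] b k unfolding sp by fastforce
    have 2: "(LINT x|q. \<phi> x) \<ge> (1 / real k) * (\<Sum>i = 1..k. measure q (?A i)) - 1 / real k"
      using staircase_integral[OF q(1), of \<phi> k] b k unfolding sp by fastforce
    have "(\<Sum>i = 1..k. measure p (?A i)) - (\<Sum>i = 1..k. measure q (?A i)) \<le> (\<Sum>i = 1..k. \<delta>)"
      unfolding sum_subtractf[symmetric] using A d by (intro sum_mono) auto
    then have "(1 / real k) * ((\<Sum>i = 1..k. measure p (?A i)) - (\<Sum>i = 1..k. measure q (?A i))) \<le> (1 / real k) * (real k * \<delta>)"
      by (intro mult_left_mono) auto
    then show ?thesis using 1 2 k by (simp add: right_diff_distrib)
  qed
  then have "(LINT x|p. \<phi> x) - (LINT x|q. \<phi> x) - \<delta> \<le> 2 / real k" if "k \<ge> 1" for k :: nat using that by force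
  moreover have "(\<lambda>k. 2 / real k) \<longlonglongrightarrow> 0" by real_asymp
  ultimately have "(LINT x|p. \<phi> x) - (LINT x|q. \<phi> x) - \<delta> \<le> 0"
    by (intro tendsto_lowerbound[where f = "\<lambda>k. 2 / real k" and F = sequentially]) (auto simp: eventually_at_top_linorder)
  then show ?thesis by simp
qed

text \<open>Finitely many level sets converge simultaneously, and the staircase error is uniform
  over the measures. The gain over weak convergence is that \<open>\<phi>\<close> is merely
  measurable; below it is applied to \<open>y \<mapsto> measure (P y) A\<close>.\<close>

lemma tendsto_integral_of_setwise:
  fixes \<phi> :: "'a \<Rightarrow> real"
  assumes p: "\<And>n. prob_space (p n)" "\<And>n. sets (p n) = sets S" and q: "prob_space q" "sets q = sets S"
    and d: "\<And>A. A \<in> sets S \<Longrightarrow> (\<lambda>n. measure (p n) A) \<longlonglongrightarrow> measure q A"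
    and \<phi>: "\<phi> \<in> borel_measurable S" and b: "\<And>x. x \<in> space S \<Longrightarrow> \<bar>\<phi> x\<bar> \<le> B"
  shows "(\<lambda>n. LINT x|p n. \<phi> x) \<longlonglongrightarrow> (LINT x|q. \<phi> x)"
proof -
  have sp: "space (p n) = space S" "space q = space S" for n using p q by (auto dest: sets_eq_imp_space_eq)
  have unit: "(\<lambda>n. LINT x|p n. \<phi> x) \<longlonglongrightarrow> (LINT x|q. \<phi> x)"
    if \<phi>: "\<phi> \<in> borel_measurable S" and b: "\<And>x. x \<in> space S \<Longrightarrow> 0 \<le> \<phi> x \<and> \<phi> x \<le> 1" for \<phi> :: "'a \<Rightarrow> real"
  proof (rule LIMSEQ_I)
    fix r :: real assume r: "0 < r"
    obtain k :: nat where k: "k \<ge> 1" "3 / real k < r"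
    proof -
      \<comment> \<open>Three errors of size 1/k: the staircase under \<open>p n\<close>, the
        staircase under \<open>q\<close>, and the distance of the two finite sums.\<close>
      obtain k :: nat where k: "3 / r < real k" using reals_Archimedean2 by blast
      have "0 < real k" using k r by (smt (verit) divide_pos_pos)
      then show thesis using k r that[of k] by (simp add: field_simps)
    qed
    let ?A = "\<lambda>i. {x \<in> space S. real i / real k \<le> \<phi> x}"
    let ?s = "\<lambda>m. (1 / real k) * (\<Sum>i = 1..k. measure m (?A i))"
    have A: "?A i \<in> sets S" for i using \<phi> by measurable
    have [measurable]: "\<phi> \<in> borel_measurable (p n)" "\<phi> \<in> borel_measurable q" for n
      using \<phi> p q by (simp_all cong: measurable_cong_sets)
    have 1: "\<bar>(LINT x|p n. \<phi> x) - ?s (p n)\<bar> \<le> 1 / real k" for n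
      using staircase_integral[OF p(1), of \<phi> n k] b k unfolding sp by fastforce
    have 2: "\<bar>(LINT x|q. \<phi> x) - ?s q\<bar> \<le> 1 / real k"
      using staircase_integral[OF q(1), of \<phi> k] b k unfolding sp by fastforce
    have "(\<lambda>n. ?s (p n)) \<longlonglongrightarrow> ?s q"
      using A d by (intro tendsto_mult tendsto_sum tendsto_const) auto
    from LIMSEQ_D[OF this, of "1 / real k"] k obtain n0 where "\<And>n. n \<ge> n0 \<Longrightarrow> \<bar>?s (p n) - ?s q\<bar> < 1 / real k"
      by auto
    moreover have "\<bar>a - b\<bar> < 3 / real k" if "\<bar>a - c\<bar> \<le> 1 / real k" "\<bar>b - d\<bar> \<le> 1 / real k" "\<bar>c - d\<bar> < 1 / real k"
      for a b c d :: real
    proof -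
      have "3 / real k = 1 / real k + 1 / real k + 1 / real k" by simp
      then show ?thesis using that by linarith
    qed
    ultimately have "\<And>n. n \<ge> n0 \<Longrightarrow> \<bar>(LINT x|p n. \<phi> x) - (LINT x|q. \<phi> x)\<bar> < 3 / real k"
      using 1 2 by blast
    then show "\<exists>n0. \<forall>n\<ge>n0. norm ((LINT x|p n. \<phi> x) - (LINT x|q. \<phi> x)) < r"
      using k by (metis order_less_trans real_norm_def)
  qed
  \<comment> \<open>An affine change of scale brings a bounded function into [0,1]; the added 1
    keeps the divisor positive.\<close>
  define C where "C = \<bar>B\<bar> + 1"
  have C: "C > 0" "\<And>x. x \<in> space S \<Longrightarrow> \<bar>\<phi> x\<bar> \<le> C" using b unfolding C_def by fastforce+
  let ?\<psi> = "\<lambda>x. (\<phi> x + C) / (2 * C)"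
  have eq: "(LINT x|m. \<phi> x) = 2 * C * (LINT x|m. ?\<psi> x) - C" if m: "prob_space m" "sets m = sets S" for m
  proof -
    interpret m: prob_space m by fact
    have [measurable]: "\<phi> \<in> borel_measurable m" using \<phi> m by (simp cong: measurable_cong_sets)
    have "integrable m \<phi>"
      by (rule m.integrable_const_bound[where B = C]) (use C m sets_eq_imp_space_eq[OF m(2)] in auto)
    then have "(LINT x|m. ?\<psi> x) = ((LINT x|m. \<phi> x) + C) / (2 * C)"
      by (simp only: Bochner_Integration.integral_add[of m \<phi> "\<lambda>_. C"] m.integrable_const integral_divide_zero lebesgue_integral_const m.prob_space) simp
    then show ?thesis using C by (simp add: field_simps)
  qed
  have "(\<lambda>n. LINT x|p n. ?\<psi> x) \<longlonglongrightarrow> (LINT x|q. ?\<psi> x)"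
  proof (rule unit)
    show "?\<psi> \<in> borel_measurable S" using \<phi> by measurable
    show "0 \<le> ?\<psi> x \<and> ?\<psi> x \<le> 1" if "x \<in> space S" for x
      using C(1) C(2)[OF that] by (auto simp: field_simps)
  qed
  then have "(\<lambda>n. 2 * C * (LINT x|p n. ?\<psi> x) - C) \<longlonglongrightarrow> 2 * C * (LINT x|q. ?\<psi> x) - C"
    by (intro tendsto_intros)
  then show ?thesis using eq p q by simp
qed

section \<open>Markov kernels, their iterates and bounded integrands\<close>

locale markov_kernel =
  fixes S :: "'a measure" and P :: "'a \<Rightarrow> 'a measure"
  assumes P[measurable]: "P \<in> S \<rightarrow>\<^sub>M prob_algebra S"
    and S_ne: "space S \<noteq> {}"
begin

primrec Pn :: "nat \<Rightarrow> 'a \<Rightarrow> 'a measure" where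
  "Pn 0 = return S"
| "Pn (Suc n) = (\<lambda>x. bind (Pn n x) P)"

lemma Pn[measurable]: "Pn n \<in> S \<rightarrow>\<^sub>M prob_algebra S"
proof (induction n)
  case (Suc n)
  then show ?case using measurable_bind_prob_space[OF Suc P] by simp
qed simp

lemma prob_Pn: "x \<in> space S \<Longrightarrow> prob_space (Pn n x)"
  and sets_Pn: "x \<in> space S \<Longrightarrow> sets (Pn n x) = sets S"
  and prob_P: "x \<in> space S \<Longrightarrow> prob_space (P x)"
  and sets_P: "x \<in> space S \<Longrightarrow> sets (P x) = sets S"
  using measurable_space[OF Pn, of x n] measurable_space[OF P, of x] by (simp_all add: space_prob_algebra)

lemma space_Pn: "x \<in> space S \<Longrightarrow> space (Pn n x) = space S"
  and space_P: "x \<in> space S \<Longrightarrow> space (P x) = space S"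
  by (rule sets_eq_imp_space_eq, erule sets_Pn, rule sets_eq_imp_space_eq, erule sets_P)

lemma P_sub[measurable]: "P \<in> S \<rightarrow>\<^sub>M subprob_algebra S"
  and Pn_sub[measurable]: "Pn n \<in> S \<rightarrow>\<^sub>M subprob_algebra S"
  using P Pn by (auto intro: measurable_prob_algebraD)

lemma measurable_integral_Pn[measurable]:
  fixes \<phi> :: "'a \<Rightarrow> real"
  assumes [measurable]: "\<phi> \<in> borel_measurable S"
  shows "(\<lambda>x. LINT y|Pn n x. \<phi> y) \<in> borel_measurable S"
  by (rule measurable_compose[OF Pn_sub integral_measurable_subprob_algebra[OF assms]])

lemma measurable_nn_integral_Pn[measurable]:
  assumes [measurable]: "\<phi> \<in> borel_measurable S"
  shows "(\<lambda>x. \<integral>\<^sup>+ y. \<phi> y \<partial>Pn n x) \<in> borel_measurable S"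
  by (rule measurable_compose[OF Pn_sub nn_integral_measurable_subprob_algebra[OF assms]])

lemma integrable_bounded:
  fixes \<phi> :: "'a \<Rightarrow> real"
  assumes "prob_space m" "sets m = sets S" "\<phi> \<in> borel_measurable S" "\<And>x. x \<in> space S \<Longrightarrow> \<bar>\<phi> x\<bar> \<le> B"
  shows "integrable m \<phi>"
proof -
  interpret prob_space m by fact
  show ?thesis
  proof (rule integrable_const_bound)
    show "\<phi> \<in> borel_measurable m" using assms(3) unfolding measurable_cong_sets[OF assms(2) refl] .
    show "AE x in m. norm (\<phi> x) \<le> B" using assms(4) sets_eq_imp_space_eq[OF assms(2)] by (intro AE_I2) auto
  qed
qed

lemma integral_bounded:
  fixes \<phi> :: "'a \<Rightarrow> real"
  assumes m: "prob_space m" "sets m = sets S" "\<phi> \<in> borel_measurable S"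
    and b: "\<And>x. x \<in> space S \<Longrightarrow> a \<le> \<phi> x \<and> \<phi> x \<le> B"
  shows "a \<le> (LINT x|m. \<phi> x)" "(LINT x|m. \<phi> x) \<le> B"
proof -
  interpret prob_space m by fact
  have "\<bar>\<phi> x\<bar> \<le> \<bar>a\<bar> + \<bar>B\<bar>" if "x \<in> space S" for x using b[OF that] by linarith
  then have i: "integrable m \<phi>" by (rule integrable_bounded[OF m])
  show "a \<le> (LINT x|m. \<phi> x)" using i b sets_eq_imp_space_eq[OF m(2)] by (intro integral_ge_const) auto
  show "(LINT x|m. \<phi> x) \<le> B" using i b sets_eq_imp_space_eq[OF m(2)] by (intro integral_le_const) auto
qed

text \<open>\<open>Pn\<close> appends the new step at the end, while the contraction estimate
  integrates n-step probabilities against the first step \<open>P x\<close>; associativity of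
  \<open>bind\<close> exchanges the two.\<close>

lemma P_bind_Pn: "x \<in> space S \<Longrightarrow> bind (P x) (Pn n) = Pn (Suc n) x"
proof (induction n)
  case 0
  then show ?case using bind_return[OF P_sub, of x] by (simp add: bind_return'' sets_P)
next
  case (Suc n)
  have "bind (P x) (Pn (Suc n)) = bind (P x) (\<lambda>y. bind (Pn n y) P)" by simp
  also have "\<dots> = bind (bind (P x) (Pn n)) P"
  proof (rule bind_assoc[symmetric])
    show "Pn n \<in> P x \<rightarrow>\<^sub>M subprob_algebra S"
      using Pn_sub unfolding measurable_cong_sets[OF sets_P[OF Suc.prems] refl] .
  qed (rule P_sub)
  finally show ?case using Suc by simp
qed

end

text \<open>In place of a minorising measure on a small set, \<open>minor\<close> asks for a total
  variation gap between \<open>P x\<close> and \<open>P y\<close> whenever \<open>V x + V y\<close>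
  stays below a level. It is asked at every level, because the level is fixed later in terms of
  \<open>g\<close> and \<open>K\<close>.\<close>

locale harris_kernel = markov_kernel +
  fixes V :: "'a \<Rightarrow> real" and g K :: real
  assumes V[measurable]: "V \<in> borel_measurable S"
    and V_nonneg: "\<And>x. x \<in> space S \<Longrightarrow> 0 \<le> V x"
    and gK: "0 \<le> g" "g < 1" "0 \<le> K"
    and drift: "\<And>x. x \<in> space S \<Longrightarrow> (\<integral>\<^sup>+ y. ennreal (V y) \<partial>P x) \<le> ennreal (g * V x + K)"
    and minor: "\<And>R. \<exists>\<alpha>>0. \<forall>x \<in> space S. \<forall>y \<in> space S. V x + V y \<le> R \<longrightarrow>
        (\<forall>A \<in> sets S. measure (P x) A - measure (P y) A \<le> 1 - \<alpha>)"
begin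

lemma integrable_V: "x \<in> space S \<Longrightarrow> integrable (P x) V"
  and integral_V: "x \<in> space S \<Longrightarrow> (LINT y|P x. V y) \<le> g * V x + K"
proof -
  assume x: "x \<in> space S"
  have [measurable]: "V \<in> borel_measurable (P x)" using V sets_P[OF x] by (simp cong: measurable_cong_sets)
  have nn: "AE y in P x. 0 \<le> V y" using V_nonneg space_P[OF x] by auto
  have "(\<integral>\<^sup>+ y. ennreal (V y) \<partial>P x) < \<infinity>" using drift[OF x] by (rule le_less_trans) simp
  then show i: "integrable (P x) V" by (intro integrableI_nonneg nn) auto
  have *: "ennreal (LINT y|P x. V y) \<le> ennreal (g * V x + K)"
    using nn_integral_eq_integral[OF i nn] drift[OF x] by simp
  show "(LINT y|P x. V y) \<le> g * V x + K"
  proof -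
    have nn: "0 \<le> g * V x + K" using V_nonneg[OF x] gK by simp
    from * show ?thesis unfolding ennreal_le_iff[OF nn] .
  qed
qed

text \<open>The oscillation bound is a Lipschitz bound for the distance 2 + \<beta> V x + \<beta> V
  y between distinct points. After adding a constant it becomes a bound at single points by
  \<open>L * (1 + \<beta> * V z)\<close>. The part of the function between -L and L is then compared
  through total variation; the part beyond is at most \<open>L * \<beta> * V z\<close> and is
  controlled by the drift.\<close>

lemma weighted_oscillation_step:
  fixes \<phi> :: "'a \<Rightarrow> real"
  assumes \<phi>: "\<phi> \<in> borel_measurable S" "\<And>x. x \<in> space S \<Longrightarrow> \<bar>\<phi> x\<bar> \<le> B" and L: "L > 0" and \<beta>: "\<beta> > 0"
    and osc: "\<And>x y. x \<in> space S \<Longrightarrow> y \<in> space S \<Longrightarrow> \<phi> x - \<phi> y \<le> L * (2 + \<beta> * V x + \<beta> * V y)"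
    and x: "x \<in> space S" and y: "y \<in> space S"
    and tv: "\<And>A. A \<in> sets S \<Longrightarrow> measure (P x) A - measure (P y) A \<le> 1 - \<alpha>"
  shows "(LINT z|P x. \<phi> z) - (LINT z|P y. \<phi> z) \<le> L * (2 * (1 - \<alpha>) + \<beta> * (g * (V x + V y) + 2 * K))"
proof -
  \<comment> \<open>The largest constant for which \<open>\<phi> + c\<close> lies below the weight.
    Then \<open>osc\<close> supplies the matching lower bound, and boundedness of
    \<open>\<phi>\<close> keeps the infimum finite.\<close>
  define c where "c = (INF z \<in> space S. L * (1 + \<beta> * V z) - \<phi> z)"
  have bdd: "bdd_below ((\<lambda>z. L * (1 + \<beta> * V z) - \<phi> z) ` space S)"
  proof (rule bdd_belowI2)
    fix z assume z: "z \<in> space S"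
    have "0 \<le> L * (1 + \<beta> * V z)" using L \<beta> V_nonneg[OF z] by simp
    then show "- B \<le> L * (1 + \<beta> * V z) - \<phi> z" using \<phi>(2)[OF z] by linarith
  qed
  define \<psi> where "\<psi> = (\<lambda>z. \<phi> z + c)"
  have up: "\<psi> z \<le> L * (1 + \<beta> * V z)" if "z \<in> space S" for z
    using cINF_lower[OF bdd that] unfolding \<psi>_def c_def by simp
  have lo: "- (L * (1 + \<beta> * V z)) \<le> \<psi> z" if z: "z \<in> space S" for z
  proof -
    have "- (L * (1 + \<beta> * V z)) - \<phi> z \<le> c"
      unfolding c_def
    proof (rule cINF_greatest[OF S_ne])
      fix w assume w: "w \<in> space S"
      show "- (L * (1 + \<beta> * V z)) - \<phi> z \<le> L * (1 + \<beta> * V w) - \<phi> w"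
        using osc[OF w z] by (simp add: algebra_simps)
    qed
    then show ?thesis unfolding \<psi>_def by simp
  qed
  define \<psi>1 where "\<psi>1 = (\<lambda>z. max (- L) (min L (\<psi> z)))"
  have [measurable]: "\<phi> \<in> borel_measurable S" by fact
  have \<psi>m[measurable]: "\<psi> \<in> borel_measurable S" unfolding \<psi>_def by measurable
  have \<psi>1m[measurable]: "\<psi>1 \<in> borel_measurable S" unfolding \<psi>1_def by measurable
  have \<psi>b: "\<bar>\<psi> z\<bar> \<le> B + \<bar>c\<bar>" if "z \<in> space S" for z
    using \<phi>(2)[OF that] unfolding \<psi>_def by linarith
  have \<psi>1b: "- L \<le> \<psi>1 z" "\<psi>1 z \<le> L" for z using L unfolding \<psi>1_def by auto
  have \<psi>1b': "\<bar>\<psi>1 z\<bar> \<le> L" for z using \<psi>1b[of z] by linarith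
  have rest: "\<bar>\<psi> z - \<psi>1 z\<bar> \<le> L * \<beta> * V z" if z: "z \<in> space S" for z
  proof -
    have "0 \<le> L * \<beta> * V z" using L \<beta> V_nonneg[OF z] by simp
    moreover have "L * (1 + \<beta> * V z) = L + L * \<beta> * V z" by (simp add: algebra_simps)
    ultimately show ?thesis using up[OF z] lo[OF z] L unfolding \<psi>1_def by linarith
  qed
  have int: "integrable (P w) \<phi>" "integrable (P w) \<psi>" "integrable (P w) \<psi>1" if w: "w \<in> space S" for w
    using integrable_bounded[OF prob_P[OF w] sets_P[OF w] \<phi>] integrable_bounded[OF prob_P[OF w] sets_P[OF w] \<psi>m \<psi>b]
      integrable_bounded[OF prob_P[OF w] sets_P[OF w] \<psi>1m \<psi>1b'] by auto
  have tail: "\<bar>(LINT z|P w. \<psi> z) - (LINT z|P w. \<psi>1 z)\<bar> \<le> L * \<beta> * (g * V w + K)" if w: "w \<in> space S" for w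
  proof -
    have "\<bar>(LINT z|P w. \<psi> z) - (LINT z|P w. \<psi>1 z)\<bar> = \<bar>LINT z|P w. \<psi> z - \<psi>1 z\<bar>"
      using int[OF w] by (simp add: Bochner_Integration.integral_diff)
    also have "\<dots> \<le> (LINT z|P w. \<bar>\<psi> z - \<psi>1 z\<bar>)" by (rule integral_abs_bound)
    also have "\<dots> \<le> (LINT z|P w. L * \<beta> * V z)"
      using int[OF w] integrable_V[OF w] rest space_P[OF w]
      by (intro integral_mono) auto
    also have "\<dots> = L * \<beta> * (LINT z|P w. V z)" by simp
    also have "\<dots> \<le> L * \<beta> * (g * V w + K)"
      using integral_V[OF w] L \<beta> by (intro mult_left_mono) auto
    finally show ?thesis .
  qed
  have main: "(LINT z|P x. \<psi>1 z) - (LINT z|P y. \<psi>1 z) \<le> 2 * L * (1 - \<alpha>)"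
  proof -
    \<comment> \<open>The truncated function takes values in an interval of length
      \<open>2 * L\<close>; this is the factor 2 in front of 1 - \<alpha>.\<close>
    let ?h = "\<lambda>z. (\<psi>1 z + L) / (2 * L)"
    have "(LINT z|P x. ?h z) - (LINT z|P y. ?h z) \<le> 1 - \<alpha>"
    proof (rule integral_diff_le_of_measure_diff_le[OF prob_P sets_P prob_P sets_P, OF x x y y tv])
      show "0 \<le> ?h z \<and> ?h z \<le> 1" for z using \<psi>1b[of z] L by (auto simp: field_simps)
    qed auto
    moreover have "(LINT z|P w. ?h z) = ((LINT z|P w. \<psi>1 z) + L) / (2 * L)" if w: "w \<in> space S" for w
    proof -
      interpret w: prob_space "P w" using prob_P[OF w] .
      show ?thesis using int(3)[OF w]
        by (simp only: Bochner_Integration.integral_add[of _ \<psi>1 "\<lambda>_. L"] w.integrable_const integral_divide_zero lebesgue_integral_const w.prob_space) simp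
    qed
    ultimately have "((LINT z|P x. \<psi>1 z) + L) / (2 * L) - ((LINT z|P y. \<psi>1 z) + L) / (2 * L) \<le> 1 - \<alpha>"
      using x y by (simp only:)
    then have "((LINT z|P x. \<psi>1 z) - (LINT z|P y. \<psi>1 z)) / (2 * L) \<le> 1 - \<alpha>"
      by (simp add: diff_divide_distrib[symmetric])
    then show ?thesis using L by (simp add: pos_divide_le_eq mult.commute)
  qed
  have shift: "(LINT z|P w. \<psi> z) = (LINT z|P w. \<phi> z) + c" if w: "w \<in> space S" for w
  proof -
    interpret w: prob_space "P w" using prob_P[OF w] .
    show ?thesis unfolding \<psi>_def using int(1)[OF w] by (simp add: w.prob_space)
  qed
  have "(LINT z|P x. \<phi> z) - (LINT z|P y. \<phi> z) \<le> 2 * L * (1 - \<alpha>) + L * \<beta> * (g * V x + K) + L * \<beta> * (g * V y + K)"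
    using tail[OF x] tail[OF y] main shift[OF x] shift[OF y] by linarith
  then show ?thesis by (simp add: algebra_simps)
qed

text \<open>Two regimes. When V x + V y is at least R, the drift alone shrinks the weight and the
  trivial total variation bound suffices. Below R the gap \<alpha> contracts the constant 2, and
  \<beta> is so small that the drift constant K does not consume this gain.\<close>

lemma weighted_contraction:
  obtains \<beta> \<rho> where "\<beta> > 0" "0 < \<rho>" "\<rho> < 1"
    "\<And>\<phi> B L x y. \<phi> \<in> borel_measurable S \<Longrightarrow> (\<And>x. x \<in> space S \<Longrightarrow> \<bar>\<phi> x\<bar> \<le> B) \<Longrightarrow> L > 0 \<Longrightarrow>
      (\<And>x y. x \<in> space S \<Longrightarrow> y \<in> space S \<Longrightarrow> \<phi> x - \<phi> y \<le> L * (2 + \<beta> * V x + \<beta> * V y)) \<Longrightarrow>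
      x \<in> space S \<Longrightarrow> y \<in> space S \<Longrightarrow>
      (LINT z|P x. \<phi> z) - (LINT z|P y. \<phi> z) \<le> (\<rho> * L) * (2 + \<beta> * V x + \<beta> * V y)"
proof -
  \<comment> \<open>For s \<ge> 4 K / (1 - g) the quantity g s + 2 K is at most (1 + g) / 2 times s;
    the added 1 makes R positive.\<close>
  define R where "R = 4 * K / (1 - g) + 1"
  have R: "R > 0" using gK unfolding R_def by (simp add: add_nonneg_pos)
  from minor[of R] obtain \<alpha>0 where \<alpha>0: "\<alpha>0 > 0"
    "\<And>x y A. x \<in> space S \<Longrightarrow> y \<in> space S \<Longrightarrow> V x + V y \<le> R \<Longrightarrow> A \<in> sets S \<Longrightarrow>
       measure (P x) A - measure (P y) A \<le> 1 - \<alpha>0" by blast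
  define \<alpha> where "\<alpha> = min \<alpha>0 1"
  have \<alpha>: "0 < \<alpha>" "\<alpha> \<le> 1"
    "\<And>x y A. x \<in> space S \<Longrightarrow> y \<in> space S \<Longrightarrow> V x + V y \<le> R \<Longrightarrow> A \<in> sets S \<Longrightarrow>
       measure (P x) A - measure (P y) A \<le> 1 - \<alpha>"
  proof -
    show "0 < \<alpha>" "\<alpha> \<le> 1" using \<alpha>0(1) unfolding \<alpha>_def by auto
    show "measure (P x) A - measure (P y) A \<le> 1 - \<alpha>"
      if "x \<in> space S" "y \<in> space S" "V x + V y \<le> R" "A \<in> sets S" for x y A
      using \<alpha>0(2)[OF that] unfolding \<alpha>_def by linarith
  qed
  \<comment> \<open>This gives 2 \<beta> K \<le> \<alpha>, half of the gain 2 \<alpha> from total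
    variation.\<close>
  define \<beta> where "\<beta> = \<alpha> / (2 * K + 1)"
  have \<beta>: "\<beta> > 0" using \<alpha>(1) gK(3) unfolding \<beta>_def by simp
  have \<beta>K: "2 * \<beta> * K \<le> \<alpha>"
  proof -
    have "\<alpha> * (2 * K) \<le> \<alpha> * (2 * K + 1)" using \<alpha>(1) by (intro mult_left_mono) auto
    then show ?thesis using gK(3) unfolding \<beta>_def by (simp add: pos_divide_le_eq mult_ac)
  qed
  define g0 where "g0 = (1 + g) / 2"
  have g0: "0 < g0" "g0 < 1" using gK unfolding g0_def by auto
  \<comment> \<open>The first entry is the worst ratio (2 + \<beta> g0 s) / (2 + \<beta> s) over s
    \<ge> R, attained at s = R since the ratio decreases. The other two serve the regime below R,
    one for the constant 2 and one for the term in V.\<close>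
  define \<rho> where "\<rho> = max ((2 + \<beta> * R * g0) / (2 + \<beta> * R)) (max (1 - \<alpha> / 2) g)"
  have \<rho>: "0 < \<rho>" "\<rho> < 1" "(2 + \<beta> * R * g0) / (2 + \<beta> * R) \<le> \<rho>" "1 - \<alpha> / 2 \<le> \<rho>" "g \<le> \<rho>"
  proof -
    have "(2 + \<beta> * R * g0) / (2 + \<beta> * R) < 1" 
    proof -
      have "\<beta> * R * g0 < \<beta> * R * 1" using \<beta> R g0 by (intro mult_strict_left_mono) auto
      then show ?thesis using \<beta> R by (simp add: divide_less_eq_1_pos add_pos_pos)
    qed
    then show "\<rho> < 1" using \<alpha> gK unfolding \<rho>_def by simp
    show "0 < \<rho>" using \<alpha> unfolding \<rho>_def by (simp add: less_max_iff_disj)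
  qed (auto simp: \<rho>_def)
  have far: "2 + \<beta> * (g * s + 2 * K) \<le> \<rho> * (2 + \<beta> * s)" if s: "s \<ge> R" for s
  proof -
    have "4 * K / (1 - g) \<le> s" using s unfolding R_def by simp
    then have "4 * K \<le> s * (1 - g)" using gK by (simp add: divide_le_eq)
    then have "g * s + 2 * K \<le> g0 * s" unfolding g0_def by (simp add: field_simps)
    then have "\<beta> * (g * s + 2 * K) \<le> \<beta> * (g0 * s)" using \<beta> by (intro mult_left_mono) auto
    then have "2 + \<beta> * (g * s + 2 * K) \<le> 2 + \<beta> * g0 * s" by simp
    also have "\<dots> \<le> (2 + \<beta> * R * g0) / (2 + \<beta> * R) * (2 + \<beta> * s)"
    proof -
      have "0 \<le> 2 * \<beta> * (1 - g0) * (s - R)" using \<beta> g0 s by simp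
      then have "(2 + \<beta> * g0 * s) * (2 + \<beta> * R) \<le> (2 + \<beta> * R * g0) * (2 + \<beta> * s)"
        by (simp add: algebra_simps)
      moreover have "2 + \<beta> * R > 0" using \<beta> R by (simp add: add_pos_pos)
      ultimately show ?thesis by (simp add: pos_le_divide_eq)
    qed
    also have "\<dots> \<le> \<rho> * (2 + \<beta> * s)" using \<rho>(3) \<beta> R s by (intro mult_right_mono) auto
    finally show ?thesis .
  qed
  have near: "2 * (1 - \<alpha>) + \<beta> * (g * s + 2 * K) \<le> \<rho> * (2 + \<beta> * s)" if s: "s \<ge> 0" for s
  proof -
    have "g * (\<beta> * s) \<le> \<rho> * (\<beta> * s)" using \<rho> \<beta> s by (intro mult_right_mono) auto
    moreover have "2 * (1 - \<alpha>) + 2 * \<beta> * K \<le> 2 * \<rho>"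
    proof -
      have "2 * (1 - \<alpha>) + \<alpha> \<le> 2 * \<rho>" using \<rho>(4) by simp
      then show ?thesis using \<beta>K by linarith
    qed
    ultimately show ?thesis by (simp add: algebra_simps)
  qed
  show thesis
  proof (rule that[OF \<beta> \<rho>(1,2)])
    fix \<phi> B L x y
    assume \<phi>: "\<phi> \<in> borel_measurable S" "\<And>x. x \<in> space S \<Longrightarrow> \<bar>\<phi> x\<bar> \<le> B" and L: "L > 0"
      and osc: "\<And>x y. x \<in> space S \<Longrightarrow> y \<in> space S \<Longrightarrow> \<phi> x - \<phi> y \<le> L * (2 + \<beta> * V x + \<beta> * V y)"
      and x: "x \<in> space S" and y: "y \<in> space S"
    have step: "(LINT z|P x. \<phi> z) - (LINT z|P y. \<phi> z) \<le> L * (2 * (1 - a) + \<beta> * (g * (V x + V y) + 2 * K))"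
      if "\<And>A. A \<in> sets S \<Longrightarrow> measure (P x) A - measure (P y) A \<le> 1 - a" for a
      by (rule weighted_oscillation_step[OF \<phi> L \<beta> osc x y that])
    have "\<exists>D. (LINT z|P x. \<phi> z) - (LINT z|P y. \<phi> z) \<le> L * D \<and> D \<le> \<rho> * (2 + \<beta> * (V x + V y))"
    proof (cases "V x + V y \<le> R")
      case True
      show ?thesis
      proof (intro exI conjI)
        show "(LINT z|P x. \<phi> z) - (LINT z|P y. \<phi> z) \<le> L * (2 * (1 - \<alpha>) + \<beta> * (g * (V x + V y) + 2 * K))"
          by (rule step[OF \<alpha>(3)[OF x y True]])
        show "2 * (1 - \<alpha>) + \<beta> * (g * (V x + V y) + 2 * K) \<le> \<rho> * (2 + \<beta> * (V x + V y))"
          by (rule near) (use V_nonneg[OF x] V_nonneg[OF y] in simp)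
      qed
    next
      case False
      interpret px: prob_space "P x" using prob_P[OF x] .
      \<comment> \<open>The gap 0 is available for any two probability measures; in this regime all
        contraction comes from the drift.\<close>
      have "measure (P x) A - measure (P y) A \<le> 1 - 0" for A
        using px.prob_le_1[of A] measure_nonneg[of "P y" A] by linarith
      note step0 = step[OF this]
      show ?thesis
      proof (intro exI conjI)
        show "(LINT z|P x. \<phi> z) - (LINT z|P y. \<phi> z) \<le> L * (2 * (1 - 0) + \<beta> * (g * (V x + V y) + 2 * K))"
          by (rule step0)
        show "2 * (1 - 0) + \<beta> * (g * (V x + V y) + 2 * K) \<le> \<rho> * (2 + \<beta> * (V x + V y))"
          using far[of "V x + V y"] False by simp
      qed
    qed
    then obtain D where D: "(LINT z|P x. \<phi> z) - (LINT z|P y. \<phi> z) \<le> L * D" "D \<le> \<rho> * (2 + \<beta> * (V x + V y))" by blast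
    have "L * D \<le> L * (\<rho> * (2 + \<beta> * (V x + V y)))" using D(2) L by (intro mult_left_mono) auto
    then show "(LINT z|P x. \<phi> z) - (LINT z|P y. \<phi> z) \<le> (\<rho> * L) * (2 + \<beta> * V x + \<beta> * V y)"
      using D(1) by (simp add: algebra_simps)
  qed
qed

end

text \<open>A geometric series. The explicit distance to the limit is the point: later its constant
  is the same for all measurable sets, which allows two limits to be interchanged.\<close>

lemma geometric_increments_converge:
  fixes a :: "nat \<Rightarrow> real"
  assumes d: "\<And>n. \<bar>a (Suc n) - a n\<bar> \<le> C * \<rho> ^ n" and \<rho>: "0 < \<rho>" "\<rho> < 1"
  shows "a \<longlonglongrightarrow> lim a" "\<bar>lim a - a m\<bar> \<le> C / (1 - \<rho>) * \<rho> ^ m"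
proof -
  have C: "0 \<le> C" using d[of 0] by simp
  have b: "\<bar>a (m + k) - a m\<bar> \<le> C * \<rho> ^ m * (1 - \<rho> ^ k) / (1 - \<rho>)" for m k
  proof (induction k)
    case (Suc k)
    have "\<bar>a (m + Suc k) - a m\<bar> \<le> \<bar>a (Suc (m + k)) - a (m + k)\<bar> + \<bar>a (m + k) - a m\<bar>" by simp
    also have "\<dots> \<le> C * \<rho> ^ (m + k) + C * \<rho> ^ m * (1 - \<rho> ^ k) / (1 - \<rho>)" using d Suc by (intro add_mono) auto
    also have "\<dots> = C * \<rho> ^ m * (1 - \<rho> ^ Suc k) / (1 - \<rho>)" using \<rho> by (simp add: field_simps power_add)
    finally show ?case .
  qed simp
  have b': "\<bar>a (m + k) - a m\<bar> \<le> C / (1 - \<rho>) * \<rho> ^ m" for m k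
  proof -
    have "C * \<rho> ^ m * (1 - \<rho> ^ k) / (1 - \<rho>) \<le> C * \<rho> ^ m * 1 / (1 - \<rho>)"
      using C \<rho> by (intro divide_right_mono mult_left_mono) auto
    then show ?thesis using b[of m k] by simp
  qed
  have lim0: "(\<lambda>m. C / (1 - \<rho>) * \<rho> ^ m) \<longlonglongrightarrow> 0"
    using \<rho> by (intro tendsto_mult_right_zero LIMSEQ_power_zero) auto
  have "Cauchy a"
  proof (rule metric_CauchyI)
    fix r :: real assume "0 < r"
    then obtain m where m: "C / (1 - \<rho>) * \<rho> ^ m < r / 2"
      using order_tendstoD(2)[OF lim0, of "r / 2"] by (auto simp: eventually_at_top_linorder)
    show "\<exists>M. \<forall>i\<ge>M. \<forall>j\<ge>M. dist (a i) (a j) < r"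
    proof (intro exI allI impI)
      fix i j assume "m \<le> i" "m \<le> j"
      then have "m + (i - m) = i" "m + (j - m) = j" by auto
      then show "dist (a i) (a j) < r"
        using b'[of m "i - m", unfolded \<open>m + (i - m) = i\<close>] b'[of m "j - m", unfolded \<open>m + (j - m) = j\<close>] m
        unfolding dist_real_def by linarith
    qed
  qed
  then show L: "a \<longlonglongrightarrow> lim a" by (simp add: Cauchy_convergent_iff convergent_LIMSEQ_iff)
  have "(\<lambda>k. \<bar>a (m + k) - a m\<bar>) \<longlonglongrightarrow> \<bar>lim a - a m\<bar>"
    using LIMSEQ_ignore_initial_segment[OF L, of m] by (intro tendsto_intros) (simp add: add.commute)
  then show "\<bar>lim a - a m\<bar> \<le> C / (1 - \<rho>) * \<rho> ^ m"
    by (rule LIMSEQ_le_const2) (use b' in auto)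
qed

section \<open>Invariant measures: mean square contraction, ergodic averages, uniqueness\<close>

context markov_kernel
begin

definition invariant :: "'a measure \<Rightarrow> bool" where
  "invariant \<mu> \<longleftrightarrow> prob_space \<mu> \<and> sets \<mu> = sets S \<and>
     (\<forall>A \<in> sets S. (\<integral>\<^sup>+ x. emeasure (P x) A \<partial>\<mu>) = emeasure \<mu> A)"

lemma invariantD:
  assumes "invariant \<mu>"
  shows "prob_space \<mu>" "sets \<mu> = sets S" "space \<mu> = space S"
  using assms sets_eq_imp_space_eq[of \<mu> S] by (auto simp: invariant_def)

lemma bind_invariant:
  assumes \<mu>: "invariant \<mu>"
  shows "bind \<mu> (Pn n) = \<mu>"
proof (induction n)
  case 0
  show ?case using bind_return'[of \<mu>] return_sets_cong[OF invariantD(2)[OF \<mu>]] by simp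
next
  case (Suc n)
  have sub: "Q \<in> \<mu> \<rightarrow>\<^sub>M subprob_algebra S" if "Q \<in> S \<rightarrow>\<^sub>M subprob_algebra S" for Q
    using that unfolding measurable_cong_sets[OF invariantD(2)[OF \<mu>] refl] .
  have ne: "space \<mu> \<noteq> {}" using invariantD(3)[OF \<mu>] S_ne by simp
  have "bind \<mu> (Pn (Suc n)) = bind (bind \<mu> (Pn n)) P"
    unfolding Pn.simps by (rule bind_assoc[symmetric, OF sub[OF Pn_sub] P_sub])
  also have "\<dots> = bind \<mu> P" unfolding Suc ..
  also have "\<dots> = \<mu>"
  proof (rule measure_eqI)
    show s: "sets (bind \<mu> P) = sets \<mu>"
      using sets_bind[of \<mu> P S] sets_P invariantD[OF \<mu>] ne by simp
    fix A assume "A \<in> sets (bind \<mu> P)"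
    then have A: "A \<in> sets S" using s invariantD(2)[OF \<mu>] by simp
    show "emeasure (bind \<mu> P) A = emeasure \<mu> A"
      unfolding emeasure_bind[OF ne sub[OF P_sub] A] using \<mu> A unfolding invariant_def by blast
  qed
  finally show ?case .
qed

lemma nn_integral_invariant:
  assumes \<mu>: "invariant \<mu>" and h: "h \<in> borel_measurable S"
  shows "(\<integral>\<^sup>+ x. \<integral>\<^sup>+ y. h y \<partial>Pn n x \<partial>\<mu>) = (\<integral>\<^sup>+ x. h x \<partial>\<mu>)"
proof -
  have "Pn n \<in> \<mu> \<rightarrow>\<^sub>M subprob_algebra S"
    using Pn_sub unfolding measurable_cong_sets[OF invariantD(2)[OF \<mu>] refl] .
  from nn_integral_bind[OF h this] show ?thesis unfolding bind_invariant[OF \<mu>] by simp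
qed

lemma borel_measurable_invariant:
  "invariant \<mu> \<Longrightarrow> borel_measurable \<mu> = borel_measurable S"
  by (rule measurable_cong_sets[OF invariantD(2) refl])

text \<open>Nonnegativity of the variance. In extended form, an infinite right-hand side makes the
  bound trivial and a finite one makes \<open>h\<close> integrable.\<close>

lemma square_integral_le:
  fixes h :: "'a \<Rightarrow> real"
  assumes h: "h \<in> borel_measurable m" and m: "prob_space m"
  shows "ennreal ((LINT y|m. h y)\<^sup>2) \<le> (\<integral>\<^sup>+ y. ennreal ((h y)\<^sup>2) \<partial>m)"
proof (cases "(\<integral>\<^sup>+ y. ennreal ((h y)\<^sup>2) \<partial>m) = \<infinity>")
  case False
  interpret prob_space m by fact
  have sq: "integrable m (\<lambda>y. (h y)\<^sup>2)"
    using False h by (intro integrableI_nonneg) (auto simp: less_top)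
  have i: "integrable m h" by (rule square_integrable_imp_integrable[OF h sq])
  have "(\<integral>\<^sup>+ y. ennreal ((h y)\<^sup>2) \<partial>m) = ennreal (LINT y|m. (h y)\<^sup>2)"
    by (rule nn_integral_eq_integral[OF sq]) simp
  moreover have "(LINT y|m. h y)\<^sup>2 \<le> (LINT y|m. (h y)\<^sup>2)"
    using variance_eq[OF i sq] variance_positive[of h] by simp
  ultimately show ?thesis by (simp add: ennreal_leI)
qed auto

lemma nn_integral_square_Pn_le:
  fixes h :: "'a \<Rightarrow> real"
  assumes \<mu>: "invariant \<mu>" and h: "h \<in> borel_measurable S"
  shows "(\<integral>\<^sup>+ x. ennreal ((LINT y|Pn n x. h y)\<^sup>2) \<partial>\<mu>) \<le> (\<integral>\<^sup>+ x. ennreal ((h x)\<^sup>2) \<partial>\<mu>)"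
proof -
  have "(\<integral>\<^sup>+ x. ennreal ((LINT y|Pn n x. h y)\<^sup>2) \<partial>\<mu>) \<le> (\<integral>\<^sup>+ x. \<integral>\<^sup>+ y. ennreal ((h y)\<^sup>2) \<partial>Pn n x \<partial>\<mu>)"
  proof (rule nn_integral_mono)
    fix x assume "x \<in> space \<mu>"
    then have x: "x \<in> space S" using invariantD(3)[OF \<mu>] by simp
    have "h \<in> borel_measurable (Pn n x)" using h unfolding measurable_cong_sets[OF sets_Pn[OF x] refl] .
    then show "ennreal ((LINT y|Pn n x. h y)\<^sup>2) \<le> (\<integral>\<^sup>+ y. ennreal ((h y)\<^sup>2) \<partial>Pn n x)"
      by (rule square_integral_le[OF _ prob_Pn[OF x]])
  qed
  also have "\<dots> = (\<integral>\<^sup>+ x. ennreal ((h x)\<^sup>2) \<partial>\<mu>)"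
    using h by (intro nn_integral_invariant[OF \<mu>]) measurable
  finally show ?thesis .
qed

text \<open>An element of L2(\<mu>) need not be integrable under the law started from each point,
  and a Bochner integral that does not exist is 0 by convention, so linearity of the integral is at
  stake. Invariance turns the finite second moment under \<open>\<mu>\<close> into finite second
  moments under \<open>Pn n x\<close> for almost every \<open>x\<close>.\<close>

lemma AE_integrable_Pn:
  fixes h :: "'a \<Rightarrow> real"
  assumes \<mu>: "invariant \<mu>" and h: "h \<in> L2_space \<mu>"
  shows "AE x in \<mu>. integrable (Pn n x) h"
proof -
  have hS: "h \<in> borel_measurable S" and sq: "integrable \<mu> (\<lambda>x. (h x)\<^sup>2)"
    using h borel_measurable_invariant[OF \<mu>] by (auto simp: L2_space_def)
  have hS2: "(\<lambda>y. ennreal ((h y)\<^sup>2)) \<in> borel_measurable S" using hS by measurable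
  have "(\<integral>\<^sup>+ x. \<integral>\<^sup>+ y. ennreal ((h y)\<^sup>2) \<partial>Pn n x \<partial>\<mu>) < \<infinity>"
    unfolding nn_integral_invariant[OF \<mu> hS2] using nn_integral_eq_integral[OF sq] by simp
  then have "AE x in \<mu>. (\<integral>\<^sup>+ y. ennreal ((h y)\<^sup>2) \<partial>Pn n x) \<noteq> \<infinity>"
    using measurable_nn_integral_Pn[OF hS2, of n] borel_measurable_invariant[OF \<mu>]
    by (intro nn_integral_PInf_AE) auto
  moreover have "AE x in \<mu>. x \<in> space S" using invariantD(3)[OF \<mu>] by (auto intro!: AE_I2)
  ultimately show ?thesis
  proof eventually_elim
    case (elim x)
    interpret prob_space "Pn n x" using prob_Pn elim by blast
    have m: "h \<in> borel_measurable (Pn n x)" using hS unfolding measurable_cong_sets[OF sets_Pn[OF elim(2)] refl] .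
    show ?case
      using elim m by (intro square_integrable_imp_integrable[OF m] integrableI_nonneg) (auto simp: less_top)
  qed
qed

lemma ennreal_square_sum3: "ennreal ((a + b + c)\<^sup>2) \<le> 3 * (ennreal (a\<^sup>2) + ennreal (b\<^sup>2) + ennreal (c\<^sup>2))"
proof -
  have "0 \<le> (a - b)\<^sup>2 + (b - c)\<^sup>2 + (a - c)\<^sup>2" by simp
  then have "(a + b + c)\<^sup>2 \<le> 3 * (a\<^sup>2 + b\<^sup>2 + c\<^sup>2)" by (simp add: power2_eq_square algebra_simps)
  then have "ennreal ((a + b + c)\<^sup>2) \<le> ennreal (3 * (a\<^sup>2 + b\<^sup>2 + c\<^sup>2))" by (rule ennreal_leI)
  also have "\<dots> = 3 * (ennreal (a\<^sup>2) + ennreal (b\<^sup>2) + ennreal (c\<^sup>2))"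
    by (simp add: ennreal_mult' ennreal_plus)
  finally show ?thesis .
qed

text \<open>Setwise convergence settles bounded functions. A general \<open>\<phi>\<close> is
  truncated at level \<open>k\<close>; as the iterates contract in L2(\<mu>), the truncation error
  is bounded uniformly in \<open>n\<close>, so \<open>k\<close> can be chosen before
  \<open>n\<close>.\<close>

lemma L2_convergence:
  fixes \<phi> :: "'a \<Rightarrow> real"
  assumes \<mu>: "invariant \<mu>"
    and lim: "\<And>A x. A \<in> sets S \<Longrightarrow> x \<in> space S \<Longrightarrow> (\<lambda>n. measure (Pn n x) A) \<longlonglongrightarrow> measure \<mu> A"
    and \<phi>: "\<phi> \<in> L2_space \<mu>"
  shows "(\<lambda>n. \<integral>\<^sup>+ x. ennreal (((LINT y|Pn n x. \<phi> y) - (LINT y|\<mu>. \<phi> y))\<^sup>2) \<partial>\<mu>) \<longlonglongrightarrow> 0"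
proof -
  interpret \<mu>: prob_space \<mu> using invariantD(1)[OF \<mu>] .
  note bm = borel_measurable_invariant[OF \<mu>]
  have \<phi>S[measurable]: "\<phi> \<in> borel_measurable S" and sq: "integrable \<mu> (\<lambda>x. (\<phi> x)\<^sup>2)"
    using \<phi> bm by (auto simp: L2_space_def)
  have \<phi>\<mu>[measurable]: "\<phi> \<in> borel_measurable \<mu>" unfolding bm by (rule \<phi>S)
  have i: "integrable \<mu> \<phi>" by (rule \<mu>.square_integrable_imp_integrable[OF \<phi>\<mu> sq])
  define \<psi> where "\<psi> k x = max (- real k) (min (real k) (\<phi> x))" for k x
  have \<psi>S[measurable]: "\<psi> k \<in> borel_measurable S" for k unfolding \<psi>_def by measurable
  have \<psi>\<mu>[measurable]: "\<psi> k \<in> borel_measurable \<mu>" for k unfolding bm by (rule \<psi>S)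
  have \<psi>b: "\<bar>\<psi> k x\<bar> \<le> real k" for k x unfolding \<psi>_def by auto
  have i\<psi>: "integrable \<mu> (\<psi> k)" for k
    by (rule integrable_bounded[OF invariantD(1,2)[OF \<mu>] \<psi>S \<psi>b])
  let ?c = "LINT y|\<mu>. \<phi> y" and ?ck = "\<lambda>k. LINT y|\<mu>. \<psi> k y"
  let ?E = "\<lambda>k. \<integral>\<^sup>+ x. ennreal ((\<phi> x - \<psi> k x)\<^sup>2) \<partial>\<mu>"
  have E0: "?E \<longlonglongrightarrow> 0"
  proof -
    have "?E \<longlonglongrightarrow> (\<integral>\<^sup>+ x. 0 \<partial>\<mu>)"
    proof (rule nn_integral_dominated_convergence[where w = "\<lambda>x. ennreal ((\<phi> x)\<^sup>2)"])
      show "AE x in \<mu>. ennreal ((\<phi> x - \<psi> k x)\<^sup>2) \<le> ennreal ((\<phi> x)\<^sup>2)" for k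
      proof (intro AE_I2 ennreal_leI)
        fix x
        have "\<bar>\<phi> x - \<psi> k x\<bar> \<le> \<bar>\<phi> x\<bar>" unfolding \<psi>_def by auto
        then show "(\<phi> x - \<psi> k x)\<^sup>2 \<le> (\<phi> x)\<^sup>2" by (metis abs_le_square_iff)
      qed
      show "(\<integral>\<^sup>+ x. ennreal ((\<phi> x)\<^sup>2) \<partial>\<mu>) < \<infinity>" using nn_integral_eq_integral[OF sq] by simp
      show "AE x in \<mu>. (\<lambda>k. ennreal ((\<phi> x - \<psi> k x)\<^sup>2)) \<longlonglongrightarrow> 0"
      proof (intro AE_I2 tendsto_eventually)
        fix x
        obtain k0 :: nat where k0: "\<bar>\<phi> x\<bar> \<le> real k0" using real_arch_simple by blast
        show "\<forall>\<^sub>F k in sequentially. ennreal ((\<phi> x - \<psi> k x)\<^sup>2) = 0"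
          using eventually_ge_at_top[of k0]
        proof eventually_elim
          case (elim k)
          then have "\<bar>\<phi> x\<bar> \<le> real k" using k0 by linarith
          then have "\<psi> k x = \<phi> x" unfolding \<psi>_def by auto
          then show ?case by simp
        qed
      qed
    qed measurable
    then show ?thesis by simp
  qed
  have mid: "(\<lambda>n. \<integral>\<^sup>+ x. ennreal (((LINT y|Pn n x. \<psi> k y) - ?ck k)\<^sup>2) \<partial>\<mu>) \<longlonglongrightarrow> 0" for k
  proof -
    have mm: "(\<lambda>x. LINT y|Pn n x. \<psi> k y) \<in> borel_measurable \<mu>" for n
      unfolding bm by (rule measurable_integral_Pn[OF \<psi>S])
    have "(\<lambda>n. \<integral>\<^sup>+ x. ennreal (((LINT y|Pn n x. \<psi> k y) - ?ck k)\<^sup>2) \<partial>\<mu>) \<longlonglongrightarrow> (\<integral>\<^sup>+ x. 0 \<partial>\<mu>)"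
    proof (rule nn_integral_dominated_convergence[where w = "\<lambda>x. ennreal ((2 * real k)\<^sup>2)"])
      show "AE x in \<mu>. ennreal (((LINT y|Pn n x. \<psi> k y) - ?ck k)\<^sup>2) \<le> ennreal ((2 * real k)\<^sup>2)" for n
      proof (intro AE_I2 ennreal_leI)
        fix x assume "x \<in> space \<mu>"
        then have x: "x \<in> space S" using invariantD(3)[OF \<mu>] by simp
        have pb: "- real k \<le> \<psi> k z \<and> \<psi> k z \<le> real k" for z using \<psi>b[of k z] by linarith
        have "\<bar>LINT y|Pn n x. \<psi> k y\<bar> \<le> real k"
          using integral_bounded[OF prob_Pn[OF x] sets_Pn[OF x] \<psi>S, where a = "- real k" and B = "real k"] pb
          by (simp add: abs_le_iff minus_le_iff)
        moreover have "\<bar>?ck k\<bar> \<le> real k"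
          using integral_bounded[OF invariantD(1,2)[OF \<mu>] \<psi>S, where a = "- real k" and B = "real k"] pb
          by (simp add: abs_le_iff minus_le_iff)
        ultimately have "\<bar>(LINT y|Pn n x. \<psi> k y) - ?ck k\<bar> \<le> \<bar>2 * real k\<bar>" by linarith
        then show "((LINT y|Pn n x. \<psi> k y) - ?ck k)\<^sup>2 \<le> (2 * real k)\<^sup>2" by (metis abs_le_square_iff)
      qed
      show "AE x in \<mu>. (\<lambda>n. ennreal (((LINT y|Pn n x. \<psi> k y) - ?ck k)\<^sup>2)) \<longlonglongrightarrow> 0"
      proof (rule AE_I2)
        fix x assume "x \<in> space \<mu>"
        then have x: "x \<in> space S" using invariantD(3)[OF \<mu>] by simp
        have "(\<lambda>n. LINT y|Pn n x. \<psi> k y) \<longlonglongrightarrow> ?ck k"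
          by (rule tendsto_integral_of_setwise[OF prob_Pn[OF x] sets_Pn[OF x] invariantD(1,2)[OF \<mu>] lim[OF _ x] \<psi>S \<psi>b])
        then have "(\<lambda>n. ennreal (((LINT y|Pn n x. \<psi> k y) - ?ck k)\<^sup>2)) \<longlonglongrightarrow> ennreal ((?ck k - ?ck k)\<^sup>2)"
          by (intro tendsto_intros)
        then show "(\<lambda>n. ennreal (((LINT y|Pn n x. \<psi> k y) - ?ck k)\<^sup>2)) \<longlonglongrightarrow> 0" by simp
      qed
      show "(\<integral>\<^sup>+ x. ennreal ((2 * real k)\<^sup>2) \<partial>\<mu>) < \<infinity>"
        by (simp add: \<mu>.emeasure_space_1)
    qed (use mm in \<open>auto\<close>)
    then show ?thesis by simp
  qed
  have bound: "(\<integral>\<^sup>+ x. ennreal (((LINT y|Pn n x. \<phi> y) - ?c)\<^sup>2) \<partial>\<mu>)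
      \<le> 3 * (?E k + (\<integral>\<^sup>+ x. ennreal (((LINT y|Pn n x. \<psi> k y) - ?ck k)\<^sup>2) \<partial>\<mu>) + ?E k)" for n k
  proof -
    let ?d = "\<lambda>x. \<phi> x - \<psi> k x"
    have dS: "?d \<in> borel_measurable S" by measurable
    have ck: "ennreal ((?ck k - ?c)\<^sup>2) \<le> ?E k"
    proof -
      have "?ck k - ?c = - (LINT y|\<mu>. ?d y)" using i i\<psi> by (simp add: Bochner_Integration.integral_diff)
      then have "(?ck k - ?c)\<^sup>2 = (LINT y|\<mu>. ?d y)\<^sup>2" by simp
      then show ?thesis using square_integral_le[OF _ invariantD(1)[OF \<mu>], of ?d] by simp
    qed
    have mm: "(\<lambda>x. LINT y|Pn n x. h y) \<in> borel_measurable \<mu>" if "h \<in> borel_measurable S" for h :: "'a \<Rightarrow> real"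
      unfolding bm by (rule measurable_integral_Pn[OF that])
    note [measurable] = mm[OF \<psi>S[of k]] mm[OF dS] mm[OF \<phi>S]
    have "(\<integral>\<^sup>+ x. ennreal (((LINT y|Pn n x. \<phi> y) - ?c)\<^sup>2) \<partial>\<mu>)
      \<le> (\<integral>\<^sup>+ x. 3 * (ennreal ((LINT y|Pn n x. ?d y)\<^sup>2) + ennreal (((LINT y|Pn n x. \<psi> k y) - ?ck k)\<^sup>2) + ennreal ((?ck k - ?c)\<^sup>2)) \<partial>\<mu>)"
    proof (rule nn_integral_mono_AE)
      have "AE x in \<mu>. x \<in> space S" using invariantD(3)[OF \<mu>] by (auto intro!: AE_I2)
      with AE_integrable_Pn[OF \<mu> \<phi>, of n]
      show "AE x in \<mu>. ennreal (((LINT y|Pn n x. \<phi> y) - ?c)\<^sup>2)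
        \<le> 3 * (ennreal ((LINT y|Pn n x. ?d y)\<^sup>2) + ennreal (((LINT y|Pn n x. \<psi> k y) - ?ck k)\<^sup>2) + ennreal ((?ck k - ?c)\<^sup>2))"
      proof eventually_elim
        case (elim x)
        have "integrable (Pn n x) (\<psi> k)"
          by (rule integrable_bounded[OF prob_Pn[OF elim(2)] sets_Pn[OF elim(2)] \<psi>S \<psi>b])
        then have "(LINT y|Pn n x. ?d y) = (LINT y|Pn n x. \<phi> y) - (LINT y|Pn n x. \<psi> k y)"
          by (rule Bochner_Integration.integral_diff[OF elim(1)])
        then have "(LINT y|Pn n x. \<phi> y) - ?c = (LINT y|Pn n x. ?d y) + ((LINT y|Pn n x. \<psi> k y) - ?ck k) + (?ck k - ?c)"
          by simp
        then show ?case using ennreal_square_sum3 by metis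
      qed
    qed
    also have "\<dots> = 3 * ((\<integral>\<^sup>+ x. ennreal ((LINT y|Pn n x. ?d y)\<^sup>2) \<partial>\<mu>)
        + (\<integral>\<^sup>+ x. ennreal (((LINT y|Pn n x. \<psi> k y) - ?ck k)\<^sup>2) \<partial>\<mu>) + ennreal ((?ck k - ?c)\<^sup>2))"
      by (simp add: nn_integral_cmult nn_integral_add \<mu>.emeasure_space_1)
    also have "\<dots> \<le> 3 * (?E k + (\<integral>\<^sup>+ x. ennreal (((LINT y|Pn n x. \<psi> k y) - ?ck k)\<^sup>2) \<partial>\<mu>) + ?E k)"
      by (intro mult_left_mono add_mono order_refl nn_integral_square_Pn_le[OF \<mu> dS] ck) auto
    finally show ?thesis .
  qed
  show ?thesis
  proof (rule order_tendstoI)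
    fix a :: ennreal assume "0 < a"
    \<comment> \<open>Nine: three error terms, times the factor 3 from squaring a sum of
      three.\<close>
    then have a: "0 < a / 9" by (simp add: ennreal_divide_eq_0_iff zero_less_iff_neq_zero ennreal_zero_less_divide)
    obtain \<epsilon> where \<epsilon>: "0 < \<epsilon>" "\<epsilon> < a / 9" using dense[OF a] by blast
    then have \<epsilon>': "9 * \<epsilon> < a"
    proof -
      have "\<epsilon> * 9 < (a / 9) * 9" using \<epsilon> by (intro ennreal_mult_strict_right_mono) auto
      also have "\<dots> = a" by (simp add: ennreal_divide_times mult_divide_eq_ennreal)
      finally show ?thesis by (simp add: mult.commute)
    qed
    obtain k where k: "?E k < \<epsilon>"
      using order_tendstoD(2)[OF E0 \<epsilon>(1)] by (auto simp: eventually_at_top_linorder)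
    show "\<forall>\<^sub>F n in sequentially. (\<integral>\<^sup>+ x. ennreal (((LINT y|Pn n x. \<phi> y) - ?c)\<^sup>2) \<partial>\<mu>) < a"
      using order_tendstoD(2)[OF mid[of k] \<epsilon>(1)]
    proof eventually_elim
      case (elim n)
      have "3 * (?E k + (\<integral>\<^sup>+ x. ennreal (((LINT y|Pn n x. \<psi> k y) - ?ck k)\<^sup>2) \<partial>\<mu>) + ?E k) \<le> 3 * (\<epsilon> + \<epsilon> + \<epsilon>)"
        using k elim by (intro mult_left_mono add_mono) auto
      also have "\<dots> = 9 * \<epsilon>"
      proof -
        have "\<epsilon> + \<epsilon> + \<epsilon> = 3 * \<epsilon>" by (metis (no_types, lifting) distrib_right mult_1 one_add_one numeral_Bit1 numeral_One add.assoc)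
        then show ?thesis by (simp add: mult.assoc[symmetric])
      qed
      finally show ?case using bound[of n k] \<epsilon>' by (meson le_less_trans order_trans)
    qed
  qed simp
qed

end

text \<open>The initial block is a fixed number, outweighed by \<open>m\<close>, and the tail is
  small term by term. The sum has \<open>m + 1\<close> terms over the divisor \<open>m\<close>, to
  match the averages in \<open>ergodic_prob\<close>.\<close>

lemma cesaro_null:
  fixes a :: "nat \<Rightarrow> real"
  assumes a: "a \<longlonglongrightarrow> 0" and nn: "\<And>n. 0 \<le> a n"
  shows "(\<lambda>m. (\<Sum>n = 0..m. a n) / real m) \<longlonglongrightarrow> 0"
proof (rule LIMSEQ_I)
  fix r :: real assume r: "0 < r"
  obtain n0 where n0: "\<And>n. n \<ge> n0 \<Longrightarrow> a n < r / 4"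
    using order_tendstoD(2)[OF a, of "r / 4"] r by (auto simp: eventually_at_top_linorder)
  define B where "B = (\<Sum>n = 0..n0. a n)"
  obtain m0 :: nat where m0: "4 * B / r < real m0" using reals_Archimedean2 by blast
  show "\<exists>k. \<forall>m\<ge>k. norm ((\<Sum>n = 0..m. a n) / real m - 0) < r"
  proof (intro exI allI impI)
    fix m assume m: "max (max n0 m0) 1 \<le> m"
    have "{0..m} = {0..n0} \<union> {n0 + 1..m}" using m by auto
    then have "(\<Sum>n = 0..m. a n) = B + (\<Sum>n = n0 + 1..m. a n)"
      unfolding B_def by (simp add: sum.union_disjoint)
    also have "(\<Sum>n = n0 + 1..m. a n) \<le> (\<Sum>n = n0 + 1..m. r / 4)"
      using n0 by (intro sum_mono) (auto intro!: less_imp_le)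
    also have "\<dots> \<le> real m * (r / 4)" using r by simp
    finally have "(\<Sum>n = 0..m. a n) \<le> B + real m * (r / 4)" by simp
    moreover have "B \<le> real m * (r / 4)"
    proof -
      have "4 * B / r < real m" using m0 m by linarith
      then show ?thesis using r by (simp add: divide_less_eq)
    qed
    moreover have "0 < real m * r" using r m by simp
    ultimately have "(\<Sum>n = 0..m. a n) < real m * r" by simp
    moreover have "0 \<le> (\<Sum>n = 0..m. a n)" using nn by (intro sum_nonneg) auto
    ultimately show "norm ((\<Sum>n = 0..m. a n) / real m - 0) < r"
      using m by (simp add: divide_less_eq mult.commute)
  qed
qed

context markov_kernel
begin

text \<open>Cauchy-Schwarz bounds the square of an average by an average of squares, so the mean
  square convergence of the single terms passes to their averages by a Cesaro argument.\<close>

lemma ergodic_averages: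
  assumes \<mu>: "invariant \<mu>"
    and lim: "\<And>A x. A \<in> sets S \<Longrightarrow> x \<in> space S \<Longrightarrow> (\<lambda>n. measure (Pn n x) A) \<longlonglongrightarrow> measure \<mu> A"
    and \<phi>: "\<phi> \<in> L2_space \<mu>"
  shows "L2_tendsto \<mu> (\<lambda>m x. (1 / real m) * (\<Sum>n = 0..m. LINT y|Pn n x. \<phi> y)) (\<lambda>_. LINT y|\<mu>. \<phi> y)"
proof -
  interpret \<mu>: prob_space \<mu> using invariantD(1)[OF \<mu>] .
  note bm = borel_measurable_invariant[OF \<mu>]
  let ?c = "LINT y|\<mu>. \<phi> y"
  let ?Q = "\<lambda>n x. LINT y|Pn n x. \<phi> y"
  have \<phi>S: "\<phi> \<in> borel_measurable S" and sq: "integrable \<mu> (\<lambda>x. (\<phi> x)\<^sup>2)"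
    using \<phi> bm by (auto simp: L2_space_def)
  have Qm[measurable]: "?Q n \<in> borel_measurable \<mu>" for n
    unfolding bm by (rule measurable_integral_Pn[OF \<phi>S])
  have Q2: "integrable \<mu> (\<lambda>x. (?Q n x)\<^sup>2)" for n
  proof (rule integrableI_nonneg)
    have "(\<integral>\<^sup>+ x. ennreal ((?Q n x)\<^sup>2) \<partial>\<mu>) \<le> (\<integral>\<^sup>+ x. ennreal ((\<phi> x)\<^sup>2) \<partial>\<mu>)"
      by (rule nn_integral_square_Pn_le[OF \<mu> \<phi>S])
    also have "\<dots> < \<infinity>" using nn_integral_eq_integral[OF sq] by simp
    finally show "(\<integral>\<^sup>+ x. ennreal ((?Q n x)\<^sup>2) \<partial>\<mu>) < \<infinity>" .
  qed auto
  have Q1: "integrable \<mu> (?Q n)" for n by (rule \<mu>.square_integrable_imp_integrable[OF Qm Q2])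
  have D2: "integrable \<mu> (\<lambda>x. (?Q n x - ?c)\<^sup>2)" for n
    using Q1 Q2 by (simp add: power2_diff)
  define a where "a n = (LINT x|\<mu>. (?Q n x - ?c)\<^sup>2)" for n
  have a0: "a \<longlonglongrightarrow> 0"
  proof -
    have "(\<lambda>n. ennreal (a n)) \<longlonglongrightarrow> ennreal 0"
      using L2_convergence[OF \<mu> lim \<phi>] nn_integral_eq_integral[OF D2] unfolding a_def by simp
    then show ?thesis by (rule tendsto_ennrealD) (auto simp: a_def)
  qed
  have ann: "0 \<le> a n" for n unfolding a_def by simp
  let ?u = "\<lambda>m x. (1 / real m) * (\<Sum>n = 0..m. ?Q n x)"
  have sum_sq: "(\<Sum>n = 0..m. h n)\<^sup>2 \<le> (real m + 1) * (\<Sum>n = 0..m. (h n)\<^sup>2)" for h :: "nat \<Rightarrow> real" and m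
    using Cauchy_Schwarz_ineq_sum[of "\<lambda>_. 1" h "{0..m}"] by (simp add: add.commute)
  have um: "?u m \<in> borel_measurable \<mu>" for m by measurable
  have uL: "?u m \<in> L2_space \<mu>" for m
  proof -
    have "integrable \<mu> (\<lambda>x. (?u m x)\<^sup>2)"
    proof (rule Bochner_Integration.integrable_bound)
      show "integrable \<mu> (\<lambda>x. (1 / real m)\<^sup>2 * ((real m + 1) * (\<Sum>n = 0..m. (?Q n x)\<^sup>2)))"
        using Q2 by (intro integrable_mult_right Bochner_Integration.integrable_sum) auto
      show "AE x in \<mu>. norm ((?u m x)\<^sup>2) \<le> norm ((1 / real m)\<^sup>2 * ((real m + 1) * (\<Sum>n = 0..m. (?Q n x)\<^sup>2)))"
      proof (rule AE_I2)
        fix x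
        have "(?u m x)\<^sup>2 \<le> (1 / real m)\<^sup>2 * ((real m + 1) * (\<Sum>n = 0..m. (?Q n x)\<^sup>2))"
          unfolding power_mult_distrib by (intro mult_left_mono sum_sq) auto
        then show "norm ((?u m x)\<^sup>2) \<le> norm ((1 / real m)\<^sup>2 * ((real m + 1) * (\<Sum>n = 0..m. (?Q n x)\<^sup>2)))"
          by simp
      qed
    qed (use um in measurable)
    then show ?thesis using um unfolding L2_space_def by blast
  qed
  have bound: "(LINT x|\<mu>. (?u m x - ?c)\<^sup>2) \<le> 4 * ((\<Sum>n = 0..m. a n) / real m) + 2 * (?c / real m)\<^sup>2" if m: "m \<ge> 1" for m
  proof -
    have "(LINT x|\<mu>. (?u m x - ?c)\<^sup>2) \<le> (LINT x|\<mu>. 4 / real m * (\<Sum>n = 0..m. (?Q n x - ?c)\<^sup>2) + 2 * (?c / real m)\<^sup>2)"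
    proof (rule integral_mono')
      show "integrable \<mu> (\<lambda>x. 4 / real m * (\<Sum>n = 0..m. (?Q n x - ?c)\<^sup>2) + 2 * (?c / real m)\<^sup>2)"
        using D2 by (intro Bochner_Integration.integrable_add integrable_mult_right Bochner_Integration.integrable_sum) auto
      fix x
      let ?T = "\<Sum>n = 0..m. (?Q n x - ?c)"
      have "?T = (\<Sum>n = 0..m. ?Q n x) - (real m + 1) * ?c" by (simp add: sum_subtractf)
      \<comment> \<open>Dividing \<open>m + 1\<close> terms by \<open>m\<close> counts the constant
        \<open>?c / real m\<close> too much; this remainder vanishes in the limit.\<close>
      then have "?u m x - ?c = (1 / real m) * ?T + ?c / real m" using m by (simp add: field_simps)
      moreover have "(p + q)\<^sup>2 \<le> 2 * p\<^sup>2 + 2 * q\<^sup>2" for p q :: real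
        using sum_squares_bound[of p q] by (simp add: power2_sum)
      ultimately have "(?u m x - ?c)\<^sup>2 \<le> 2 * ((1 / real m) * ?T)\<^sup>2 + 2 * (?c / real m)\<^sup>2" by metis
      also have "((1 / real m) * ?T)\<^sup>2 \<le> (1 / real m)\<^sup>2 * ((real m + 1) * (\<Sum>n = 0..m. (?Q n x - ?c)\<^sup>2))"
        unfolding power_mult_distrib by (intro mult_left_mono sum_sq) auto
      also have "\<dots> \<le> 2 / real m * (\<Sum>n = 0..m. (?Q n x - ?c)\<^sup>2)"
      proof -
        have "(1 / real m)\<^sup>2 * (real m + 1) \<le> (1 / real m)\<^sup>2 * (2 * real m)"
          using m by (intro mult_left_mono) auto
        also have "\<dots> = 2 / real m" using m by (simp add: power2_eq_square)
        finally show ?thesis unfolding mult.assoc[symmetric]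
          by (intro mult_right_mono sum_nonneg) auto
      qed
      finally show "(?u m x - ?c)\<^sup>2 \<le> 4 / real m * (\<Sum>n = 0..m. (?Q n x - ?c)\<^sup>2) + 2 * (?c / real m)\<^sup>2"
        by simp
      show "0 \<le> 4 / real m * (\<Sum>n = 0..m. (?Q n x - ?c)\<^sup>2) + 2 * (?c / real m)\<^sup>2"
        by (intro add_nonneg_nonneg mult_nonneg_nonneg sum_nonneg) auto
    qed
    also have "\<dots> = 4 / real m * (LINT x|\<mu>. (\<Sum>n = 0..m. (?Q n x - ?c)\<^sup>2)) + 2 * (?c / real m)\<^sup>2"
      using D2 by (subst Bochner_Integration.integral_add) (auto simp: \<mu>.prob_space)
    also have "(LINT x|\<mu>. (\<Sum>n = 0..m. (?Q n x - ?c)\<^sup>2)) = (\<Sum>n = 0..m. a n)"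
      unfolding a_def using D2 by (intro Bochner_Integration.integral_sum) auto
    finally show ?thesis by simp
  qed
  have "(\<lambda>m. LINT x|\<mu>. (?u m x - ?c)\<^sup>2) \<longlonglongrightarrow> 0"
  proof (rule tendsto_sandwich[OF _ _ tendsto_const])
    show "\<forall>\<^sub>F m in sequentially. (LINT x|\<mu>. (?u m x - ?c)\<^sup>2) \<le> 4 * ((\<Sum>n = 0..m. a n) / real m) + 2 * (?c / real m)\<^sup>2"
      using bound by (auto simp: eventually_at_top_linorder)
    have "(\<lambda>m. 4 * ((\<Sum>n = 0..m. a n) / real m) + 2 * (?c / real m)\<^sup>2) \<longlonglongrightarrow> 4 * 0 + 2 * 0\<^sup>2"
      by (intro tendsto_intros cesaro_null[OF a0 ann] tendsto_divide_0[OF tendsto_const] filterlim_at_top_imp_at_infinity filterlim_real_sequentially)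
    then show "(\<lambda>m. 4 * ((\<Sum>n = 0..m. a n) / real m) + 2 * (?c / real m)\<^sup>2) \<longlonglongrightarrow> 0" by simp
  qed simp
  moreover have "(\<lambda>_. ?c) \<in> L2_space \<mu>" unfolding L2_space_def by simp
  ultimately show "L2_tendsto \<mu> ?u (\<lambda>_. ?c)" unfolding L2_tendsto_def using uL by blast
qed

text \<open>Integrating \<open>measure (Pn n x) A\<close> over an invariant \<open>\<mu>\<close>
  gives \<open>measure \<mu> A\<close> for every \<open>n\<close>, while by dominated convergence
  the same integrals tend to \<open>measure \<pi> A\<close>.\<close>

lemma invariant_eq_limit:
  assumes \<mu>: "invariant \<mu>" and \<pi>: "sets \<pi> = sets S" "finite_measure \<pi>"
    and lim: "\<And>A x. A \<in> sets S \<Longrightarrow> x \<in> space S \<Longrightarrow> (\<lambda>n. measure (Pn n x) A) \<longlonglongrightarrow> measure \<pi> A"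
  shows "\<mu> = \<pi>"
proof (rule measure_eqI)
  interpret \<mu>: prob_space \<mu> using invariantD(1)[OF \<mu>] .
  interpret \<pi>: finite_measure \<pi> by fact
  show "sets \<mu> = sets \<pi>" using invariantD(2)[OF \<mu>] \<pi> by simp
  fix A assume "A \<in> sets \<mu>"
  then have A: "A \<in> sets S" using invariantD(2)[OF \<mu>] by simp
  note bm = borel_measurable_invariant[OF \<mu>]
  have meas: "(\<lambda>x. measure (Pn n x) A) \<in> borel_measurable \<mu>" for n
    unfolding bm by (rule measurable_compose[OF Pn_sub measurable_measure_subprob_algebra[OF A]])
  have eq: "(LINT x|\<mu>. measure (Pn n x) A) = measure \<mu> A" for n
  proof -
    have "Pn n \<in> \<mu> \<rightarrow>\<^sub>M subprob_algebra S"
      using Pn_sub unfolding measurable_cong_sets[OF invariantD(2)[OF \<mu>] refl] .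
    from \<mu>.measure_bind[OF this A] show ?thesis unfolding bind_invariant[OF \<mu>] by simp
  qed
  have "(\<lambda>n. LINT x|\<mu>. measure (Pn n x) A) \<longlonglongrightarrow> (LINT x|\<mu>. measure \<pi> A)"
  proof (rule integral_dominated_convergence[where w = "\<lambda>_. 1"])
    show "AE x in \<mu>. (\<lambda>n. measure (Pn n x) A) \<longlonglongrightarrow> measure \<pi> A"
      using lim[OF A] invariantD(3)[OF \<mu>] by (intro AE_I2) auto
    show "AE x in \<mu>. norm (measure (Pn n x) A) \<le> 1" for n
    proof (rule AE_I2)
      fix x assume "x \<in> space \<mu>"
      then have "prob_space (Pn n x)" using prob_Pn invariantD(3)[OF \<mu>] by simp
      then show "norm (measure (Pn n x) A) \<le> 1" using prob_space.prob_le_1 by fastforce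
    qed
  qed (use meas in auto)
  then have "(\<lambda>n. measure \<mu> A) \<longlonglongrightarrow> measure \<pi> A" unfolding eq by (simp add: \<mu>.prob_space)
  then have "measure \<mu> A = measure \<pi> A" by (simp add: LIMSEQ_const_iff)
  then show "emeasure \<mu> A = emeasure \<pi> A" by (simp add: \<mu>.emeasure_eq_measure \<pi>.emeasure_eq_measure)
qed

text \<open>The limit is taken in the Chapman-Kolmogorov identity
  \<open>measure (Pn (Suc n) x) A = (LINT y|Pn n x. measure (P y) A)\<close>. Setwise convergence
  applies to its integrand, which is bounded and measurable in \<open>y\<close>.\<close>

lemma invariant_of_limit:
  assumes \<pi>: "prob_space \<pi>" "sets \<pi> = sets S"
    and lim: "\<And>A x. A \<in> sets S \<Longrightarrow> x \<in> space S \<Longrightarrow> (\<lambda>n. measure (Pn n x) A) \<longlonglongrightarrow> measure \<pi> A"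
  shows "invariant \<pi>"
  unfolding invariant_def
proof (intro conjI ballI \<pi>)
  interpret \<pi>: prob_space \<pi> by fact
  fix A assume A: "A \<in> sets S"
  obtain x where x: "x \<in> space S" using S_ne by blast
  have PA: "(\<lambda>y. measure (P y) A) \<in> borel_measurable S"
    by (rule measurable_compose[OF P_sub measurable_measure_subprob_algebra[OF A]])
  have PA1: "\<bar>measure (P y) A\<bar> \<le> 1" if "y \<in> space S" for y
    using prob_space.prob_le_1[OF prob_P[OF that]] by simp
  have "(\<lambda>n. LINT y|Pn n x. measure (P y) A) \<longlonglongrightarrow> (LINT y|\<pi>. measure (P y) A)"
    by (rule tendsto_integral_of_setwise[OF prob_Pn[OF x] sets_Pn[OF x] \<pi> lim[OF _ x] PA PA1])
  moreover have "(LINT y|Pn n x. measure (P y) A) = measure (Pn (Suc n) x) A" for n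
  proof -
    interpret prob_space "Pn n x" by (rule prob_Pn[OF x])
    have "P \<in> Pn n x \<rightarrow>\<^sub>M subprob_algebra S"
      using P_sub unfolding measurable_cong_sets[OF sets_Pn[OF x] refl] .
    from measure_bind[OF this A] show ?thesis by simp
  qed
  ultimately have "(LINT y|\<pi>. measure (P y) A) = measure \<pi> A"
    using LIMSEQ_unique[OF LIMSEQ_Suc[OF lim[OF A x]]] by simp
  moreover have "(\<integral>\<^sup>+ y. emeasure (P y) A \<partial>\<pi>) = (\<integral>\<^sup>+ y. ennreal (measure (P y) A) \<partial>\<pi>)"
  proof (rule nn_integral_cong)
    fix y assume "y \<in> space \<pi>"
    then have y: "y \<in> space S" using sets_eq_imp_space_eq[OF \<pi>(2)] by simp
    interpret prob_space "P y" by (rule prob_P[OF y])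
    show "emeasure (P y) A = ennreal (measure (P y) A)" by (rule emeasure_eq_measure)
  qed
  moreover have "(\<integral>\<^sup>+ y. ennreal (measure (P y) A) \<partial>\<pi>) = ennreal (LINT y|\<pi>. measure (P y) A)"
    using integrable_bounded[OF \<pi> PA PA1] by (intro nn_integral_eq_integral) auto
  ultimately show "(\<integral>\<^sup>+ y. emeasure (P y) A \<partial>\<pi>) = emeasure \<pi> A"
    by (simp add: \<pi>.emeasure_eq_measure)
qed

end

section \<open>Harris' theorem: the limit of the iterated laws\<close>

context harris_kernel
begin

text \<open>The functions \<open>\<psi> A n\<close> start with values in [0,1], so the weighted
  oscillation is at most 1 at the outset and shrinks by \<open>\<rho>\<close> with every step.
  Consecutive values at a fixed point then differ by a geometric amount, with a constant free of
  \<open>A\<close>.\<close>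

lemma setwise_limit:
  obtains \<pi> where "prob_space \<pi>" "sets \<pi> = sets S"
    "\<And>A x. A \<in> sets S \<Longrightarrow> x \<in> space S \<Longrightarrow> (\<lambda>n. measure (Pn n x) A) \<longlonglongrightarrow> measure \<pi> A"
proof (rule weighted_contraction)
  fix \<beta> \<rho> assume \<beta>: "\<beta> > 0" and \<rho>: "0 < \<rho>" "\<rho> < 1"
    and contr: "\<And>\<phi> B L x y. \<phi> \<in> borel_measurable S \<Longrightarrow> (\<And>x. x \<in> space S \<Longrightarrow> \<bar>\<phi> x\<bar> \<le> B) \<Longrightarrow> L > 0 \<Longrightarrow>
      (\<And>x y. x \<in> space S \<Longrightarrow> y \<in> space S \<Longrightarrow> \<phi> x - \<phi> y \<le> L * (2 + \<beta> * V x + \<beta> * V y)) \<Longrightarrow>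
      x \<in> space S \<Longrightarrow> y \<in> space S \<Longrightarrow>
      (LINT z|P x. \<phi> z) - (LINT z|P y. \<phi> z) \<le> (\<rho> * L) * (2 + \<beta> * V x + \<beta> * V y)"
  define \<psi> where "\<psi> A n x = measure (Pn n x) A" for A n x
  have \<psi>m: "\<psi> A n \<in> borel_measurable S" if "A \<in> sets S" for A n
    unfolding \<psi>_def by (rule measurable_compose[OF Pn_sub measurable_measure_subprob_algebra[OF that]])
  have \<psi>01: "0 \<le> \<psi> A n x \<and> \<psi> A n x \<le> 1" if "x \<in> space S" for A n x
    unfolding \<psi>_def using prob_space.prob_le_1[OF prob_Pn[OF that]] by simp
  have \<psi>b: "\<bar>\<psi> A n x\<bar> \<le> 1" if "x \<in> space S" for A n x using \<psi>01[OF that, of A n] by simp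
  have \<psi>Suc: "\<psi> A (Suc n) x = (LINT y|P x. \<psi> A n y)" if A: "A \<in> sets S" and x: "x \<in> space S" for A n x
  proof -
    interpret prob_space "P x" by (rule prob_P[OF x])
    have "Pn n \<in> P x \<rightarrow>\<^sub>M subprob_algebra S"
      using Pn_sub unfolding measurable_cong_sets[OF sets_P[OF x] refl] .
    from measure_bind[OF this A] show ?thesis unfolding \<psi>_def P_bind_Pn[OF x] by simp
  qed
  have osc: "\<psi> A n x - \<psi> A n y \<le> \<rho> ^ n * (2 + \<beta> * V x + \<beta> * V y)"
    if A: "A \<in> sets S" and "x \<in> space S" "y \<in> space S" for A n x y
    using that(2,3)
  proof (induction n arbitrary: x y)
    case 0
    have "0 \<le> \<beta> * V x" "0 \<le> \<beta> * V y" using \<beta> V_nonneg 0 by auto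
    then show ?case using \<psi>01[OF 0(1), of A 0] \<psi>01[OF 0(2), of A 0] by simp
  next
    case (Suc n)
    show ?case
      unfolding \<psi>Suc[OF A Suc.prems(1)] \<psi>Suc[OF A Suc.prems(2)] power_Suc
      by (rule contr[OF \<psi>m[OF A] \<psi>b _ Suc.IH Suc.prems]) (use \<rho> in auto)
  qed
  \<comment> \<open>The increment \<open>\<psi> A (Suc n) x - \<psi> A n x\<close> is the mean over
    the first step of \<open>\<psi> A n y - \<psi> A n x\<close>; \<open>C x\<close> is the mean
    weight, with \<open>V\<close> after that step bounded by the drift.\<close>
  define C where "C x = 2 + \<beta> * V x + \<beta> * (g * V x + K)" for x
  have incr: "\<bar>\<psi> A (Suc n) x - \<psi> A n x\<bar> \<le> C x * \<rho> ^ n" if A: "A \<in> sets S" and x: "x \<in> space S" for A n x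
  proof -
    interpret p: prob_space "P x" by (rule prob_P[OF x])
    have i: "integrable (P x) (\<psi> A n)" by (rule integrable_bounded[OF prob_P[OF x] sets_P[OF x] \<psi>m[OF A] \<psi>b])
    have "\<psi> A (Suc n) x - \<psi> A n x = (LINT y|P x. \<psi> A n y - \<psi> A n x)"
      unfolding \<psi>Suc[OF A x] using i by (simp add: p.prob_space)
    also have "\<bar>\<dots>\<bar> \<le> (LINT y|P x. \<bar>\<psi> A n y - \<psi> A n x\<bar>)" by (rule integral_abs_bound)
    also have "\<dots> \<le> (LINT y|P x. \<rho> ^ n * (2 + \<beta> * V x + \<beta> * V y))"
    proof (rule integral_mono)
      show "integrable (P x) (\<lambda>y. \<rho> ^ n * (2 + \<beta> * V x + \<beta> * V y))" using integrable_V[OF x] by simp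
      fix y assume "y \<in> space (P x)"
      then have y: "y \<in> space S" using space_P[OF x] by simp
      show "\<bar>\<psi> A n y - \<psi> A n x\<bar> \<le> \<rho> ^ n * (2 + \<beta> * V x + \<beta> * V y)"
        using osc[OF A x y, of n] osc[OF A y x, of n] by (simp add: abs_le_iff algebra_simps)
    qed (use i in simp)
    also have "\<dots> = \<rho> ^ n * (2 + \<beta> * V x + \<beta> * (LINT y|P x. V y))"
      using integrable_V[OF x] by (simp add: p.prob_space)
    also have "\<dots> \<le> \<rho> ^ n * C x"
      unfolding C_def using \<beta> \<rho> integral_V[OF x] by (intro mult_left_mono add_left_mono) auto
    finally show ?thesis by (simp add: mult.commute)
  qed
  obtain x0 where x0: "x0 \<in> space S" using S_ne by blast
  define l where "l A = lim (\<lambda>n. \<psi> A n x0)" for A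
  define D where "D = C x0 / (1 - \<rho>)"
  have l: "(\<lambda>n. \<psi> A n x0) \<longlonglongrightarrow> l A" and lb: "\<bar>l A - \<psi> A m x0\<bar> \<le> D * \<rho> ^ m" if "A \<in> sets S" for A m
    unfolding l_def D_def
    using geometric_increments_converge[of "\<lambda>n. \<psi> A n x0", OF incr[OF that x0] \<rho>] by auto
  have l0: "0 \<le> l A" if "A \<in> sets S" for A
    using l[OF that] \<psi>01[OF x0, of A] by (intro LIMSEQ_le_const) auto
  define \<pi> where "\<pi> = measure_of (space S) (sets S) (\<lambda>A. ennreal (l A))"
  have sets\<pi>: "sets \<pi> = sets S" and space\<pi>: "space \<pi> = space S" unfolding \<pi>_def by auto
  have pos: "positive (sets S) (\<lambda>A. ennreal (l A))"
    unfolding positive_def l_def \<psi>_def by (simp add: lim_const)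
  have add: "additive (sets S) (\<lambda>A. ennreal (l A))"
    unfolding Measure_Space.additive_def
  proof (intro ballI impI)
    fix A B assume A: "A \<in> sets S" and B: "B \<in> sets S" and d: "A \<inter> B = {}"
    have "\<psi> (A \<union> B) n x0 = \<psi> A n x0 + \<psi> B n x0" for n
    proof -
      interpret prob_space "Pn n x0" by (rule prob_Pn[OF x0])
      show ?thesis unfolding \<psi>_def using A B d sets_Pn[OF x0] by (intro finite_measure_Union) auto
    qed
    then have "(\<lambda>n. \<psi> (A \<union> B) n x0) \<longlonglongrightarrow> l A + l B" using l[OF A] l[OF B] by (simp add: tendsto_add)
    then have "l (A \<union> B) = l A + l B" using l[of "A \<union> B"] A B by (intro LIMSEQ_unique) auto
    then show "ennreal (l (A \<union> B)) = ennreal (l A) + ennreal (l B)" using l0 A B by simp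
  qed
  \<comment> \<open>Continuity at the empty set. Along a decreasing sequence of sets,
    \<open>l\<close> is compared with a single law \<open>Pn m x0\<close>, where \<open>m\<close> is
    chosen before the sets by the uniform rate.\<close>
  have "countably_additive (sets S) (\<lambda>A. ennreal (l A))"
  proof (rule sets.empty_continuous_imp_countably_additive[OF pos add])
    show "\<forall>A\<in>sets S. ennreal (l A) \<noteq> \<infinity>" by simp
    fix A :: "nat \<Rightarrow> 'a set" assume A: "range A \<subseteq> sets S" "decseq A" "(\<Inter>i. A i) = {}"
    have AS: "A i \<in> sets S" for i using A(1) by auto
    have "(\<lambda>i. l (A i)) \<longlonglongrightarrow> 0"
    proof (rule LIMSEQ_I)
      fix r :: real assume r: "0 < r"
      have Dl: "(\<lambda>m. D * \<rho> ^ m) \<longlonglongrightarrow> 0" using \<rho> by (intro tendsto_mult_right_zero LIMSEQ_power_zero) auto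
      obtain m where m: "D * \<rho> ^ m < r / 2"
        using order_tendstoD(2)[OF Dl, of "r / 2"] r by (auto simp: eventually_at_top_linorder)
      interpret prob_space "Pn m x0" by (rule prob_Pn[OF x0])
      have "(\<lambda>i. \<psi> (A i) m x0) \<longlonglongrightarrow> measure (Pn m x0) (\<Inter>i. A i)"
        unfolding \<psi>_def using A sets_Pn[OF x0] by (intro finite_Lim_measure_decseq) auto
      then have Al: "(\<lambda>i. \<psi> (A i) m x0) \<longlonglongrightarrow> 0" unfolding A(3) by simp
      obtain i0 where i0: "\<And>i. i \<ge> i0 \<Longrightarrow> \<psi> (A i) m x0 < r / 2"
        using order_tendstoD(2)[OF Al, of "r / 2"] r by (auto simp: eventually_at_top_linorder)
      show "\<exists>no. \<forall>i\<ge>no. norm (l (A i) - 0) < r"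
      proof (intro exI allI impI)
        fix i assume "i0 \<le> i"
        then show "norm (l (A i) - 0) < r" using i0[of i] lb[OF AS[of i], of m] m l0[OF AS[of i]] by simp
      qed
    qed
    then have "(\<lambda>i. ennreal (l (A i))) \<longlonglongrightarrow> ennreal 0" by (rule tendsto_ennrealI)
    then show "(\<lambda>i. ennreal (l (A i))) \<longlonglongrightarrow> 0" by simp
  qed
  then have em: "emeasure \<pi> A = ennreal (l A)" if "A \<in> sets S" for A
    unfolding \<pi>_def using pos that
    by (intro emeasure_measure_of_sigma sets.sigma_algebra_axioms)
  have me: "measure \<pi> A = l A" if "A \<in> sets S" for A
    using em[OF that] l0[OF that] by (simp add: measure_def)
  have prob: "prob_space \<pi>"
  proof
    have "\<psi> (space S) n x0 = 1" for n
      using prob_space.prob_space[OF prob_Pn[OF x0], of n] unfolding \<psi>_def space_Pn[OF x0] .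
    then have "l (space S) = 1" unfolding l_def by (simp add: lim_const)
    then show "emeasure \<pi> (space \<pi>) = 1" unfolding space\<pi> using em[of "space S"] by simp
  qed
  show thesis
  proof (rule that[OF prob sets\<pi>])
    fix A x assume A: "A \<in> sets S" and x: "x \<in> space S"
    \<comment> \<open>The oscillation bound also shows that the starting point is forgotten, which
      extends the limit from \<open>x0\<close> to every \<open>x\<close>.\<close>
    have null: "(\<lambda>n. \<rho> ^ n * (2 + \<beta> * V x + \<beta> * V x0)) \<longlonglongrightarrow> 0"
      using \<rho> by (intro tendsto_mult_left_zero LIMSEQ_power_zero) auto
    have dom: "norm (\<psi> A n x - \<psi> A n x0) \<le> \<rho> ^ n * (2 + \<beta> * V x + \<beta> * V x0)" for n
      using osc[OF A x x0, of n] osc[OF A x0 x, of n] by (simp add: abs_le_iff algebra_simps)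
    have "(\<lambda>n. \<psi> A n x - \<psi> A n x0) \<longlonglongrightarrow> 0"
      by (rule Lim_null_comparison[OF always_eventually[OF allI[OF dom]] null])
    from tendsto_add[OF this l[OF A]] show "(\<lambda>n. measure (Pn n x) A) \<longlonglongrightarrow> measure \<pi> A"
      unfolding me[OF A] \<psi>_def by simp
  qed
qed

theorem harris:
  "\<exists>!\<mu>. invariant \<mu>"
  "invariant \<mu> \<Longrightarrow> \<phi> \<in> L2_space \<mu> \<Longrightarrow>
    L2_tendsto \<mu> (\<lambda>m x. (1 / real m) * (\<Sum>n = 0..m. LINT y|Pn n x. \<phi> y)) (\<lambda>_. LINT y|\<mu>. \<phi> y)"
proof -
  have "\<exists>\<pi>. prob_space \<pi> \<and> sets \<pi> = sets S \<and>
      (\<forall>A \<in> sets S. \<forall>x \<in> space S. (\<lambda>n. measure (Pn n x) A) \<longlonglongrightarrow> measure \<pi> A)"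
    by (rule setwise_limit) blast
  then obtain \<pi> where \<pi>: "prob_space \<pi>" "sets \<pi> = sets S"
    "\<And>A x. A \<in> sets S \<Longrightarrow> x \<in> space S \<Longrightarrow> (\<lambda>n. measure (Pn n x) A) \<longlonglongrightarrow> measure \<pi> A"
    by blast
  have inv: "invariant \<pi>" by (rule invariant_of_limit[OF \<pi>])
  have uniq: "\<mu> = \<pi>" if "invariant \<mu>" for \<mu>
    by (rule invariant_eq_limit[OF that \<pi>(2) prob_space.finite_measure[OF \<pi>(1)] \<pi>(3)])
  show "\<exists>!\<mu>. invariant \<mu>" using inv uniq by blast
  show "L2_tendsto \<mu> (\<lambda>m x. (1 / real m) * (\<Sum>n = 0..m. LINT y|Pn n x. \<phi> y)) (\<lambda>_. LINT y|\<mu>. \<phi> y)"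
    if \<mu>: "invariant \<mu>" and \<phi>: "\<phi> \<in> L2_space \<mu>"
    using ergodic_averages[OF inv \<pi>(3), of \<phi>] \<phi> unfolding uniq[OF \<mu>] by blast
qed

end

section \<open>The Cameron-Martin inequality for white noise\<close>

definition gauss :: "real \<Rightarrow> real measure" where
  "gauss \<sigma> = density lborel (\<lambda>x. ennreal (normal_density 0 \<sigma> x))"

lemma sets_gauss[simp, measurable_cong]: "sets (gauss \<sigma>) = sets borel"
  and space_gauss[simp]: "space (gauss \<sigma>) = UNIV"
  unfolding gauss_def by auto

lemma prob_space_gauss: "\<sigma> > 0 \<Longrightarrow> prob_space (gauss \<sigma>)"
  unfolding gauss_def by (rule prob_space_normal_density)

text \<open>The shift is moved onto the density, and the density quotient \<open>?D\<close> has
  second moment exp(s^2 / \<sigma>^2) under the Gaussian law; Cauchy-Schwarz does the rest. The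
  quadratic form is chosen because such inequalities multiply over independent coordinates.\<close>

lemma cameron_martin_1d:
  fixes F :: "real \<Rightarrow> ennreal"
  assumes \<sigma>: "\<sigma> > 0" and F[measurable]: "F \<in> borel_measurable borel"
  shows "(\<integral>\<^sup>+ t. F (t + s) \<partial>gauss \<sigma>)\<^sup>2 \<le> ennreal (exp (s\<^sup>2 / \<sigma>\<^sup>2)) * (\<integral>\<^sup>+ t. (F t)\<^sup>2 \<partial>gauss \<sigma>)"
proof -
  let ?n = "normal_density 0 \<sigma>"
  let ?D = "\<lambda>t. exp ((2 * t * s - s\<^sup>2) / (2 * \<sigma>\<^sup>2))"
  have D: "?n (t - s) = ?n t * ?D t" for t
    unfolding normal_density_def by (simp add: exp_add[symmetric] field_simps power2_eq_square)
      (simp add: add_divide_distrib[symmetric] diff_divide_distrib[symmetric] algebra_simps)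
  \<comment> \<open>Completing the square: density times squared quotient is, up to a constant
    factor, the normal density centred at \<open>2 * s\<close>.\<close>
  have D2: "?n t * (?D t)\<^sup>2 = exp (s\<^sup>2 / \<sigma>\<^sup>2) * normal_density (2 * s) \<sigma> t" for t
  proof -
    have "- t\<^sup>2 / (2 * \<sigma>\<^sup>2) + 2 * ((2 * t * s - s\<^sup>2) / (2 * \<sigma>\<^sup>2)) = s\<^sup>2 / \<sigma>\<^sup>2 + (- (t - 2 * s)\<^sup>2 / (2 * \<sigma>\<^sup>2))"
      using \<sigma> by (simp add: field_simps power2_eq_square)
    then have "exp (- t\<^sup>2 / (2 * \<sigma>\<^sup>2)) * (?D t)\<^sup>2 = exp (s\<^sup>2 / \<sigma>\<^sup>2) * exp (- (t - 2 * s)\<^sup>2 / (2 * \<sigma>\<^sup>2))"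
      by (metis exp_add exp_double)
    then show ?thesis unfolding normal_density_def by (simp add: mult_ac)
  qed
  have "(\<integral>\<^sup>+ t. F (t + s) \<partial>gauss \<sigma>) = (\<integral>\<^sup>+ t. ennreal (?n t) * F (t + s) \<partial>lborel)"
    unfolding gauss_def by (rule nn_integral_density) auto
  also have "\<dots> = (\<integral>\<^sup>+ t. ennreal (?n (t - s)) * F t \<partial>lborel)"
    using nn_integral_real_affine[of "\<lambda>t. ennreal (?n (t - s)) * F t" 1 s] by (simp add: add.commute)
  also have "\<dots> = (\<integral>\<^sup>+ t. ennreal (?n t) * (F t * ennreal (?D t)) \<partial>lborel)"
    unfolding D by (intro nn_integral_cong) (simp add: ennreal_mult' mult_ac)
  also have "\<dots> = (\<integral>\<^sup>+ t. F t * ennreal (?D t) \<partial>gauss \<sigma>)"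
    unfolding gauss_def by (rule nn_integral_density[symmetric]) auto
  finally have "(\<integral>\<^sup>+ t. F (t + s) \<partial>gauss \<sigma>)\<^sup>2 = (\<integral>\<^sup>+ t. F t * ennreal (?D t) \<partial>gauss \<sigma>)\<^sup>2" by simp
  also have "\<dots> \<le> (\<integral>\<^sup>+ t. (F t)\<^sup>2 \<partial>gauss \<sigma>) * (\<integral>\<^sup>+ t. (ennreal (?D t))\<^sup>2 \<partial>gauss \<sigma>)"
    by (rule Cauchy_Schwarz_nn_integral) auto
  also have "(\<integral>\<^sup>+ t. (ennreal (?D t))\<^sup>2 \<partial>gauss \<sigma>) = (\<integral>\<^sup>+ t. ennreal (?n t) * (ennreal (?D t))\<^sup>2 \<partial>lborel)"
    unfolding gauss_def by (rule nn_integral_density) auto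
  also have "\<dots> = (\<integral>\<^sup>+ t. ennreal (exp (s\<^sup>2 / \<sigma>\<^sup>2)) * ennreal (normal_density (2 * s) \<sigma> t) \<partial>lborel)"
    by (intro nn_integral_cong) (simp only: ennreal_power exp_ge_zero ennreal_mult'[symmetric] normal_density_nonneg D2)
  also have "\<dots> = ennreal (exp (s\<^sup>2 / \<sigma>\<^sup>2)) * (\<integral>\<^sup>+ t. ennreal (normal_density (2 * s) \<sigma> t) \<partial>lborel)"
    by (rule nn_integral_cmult) auto
  also have "(\<integral>\<^sup>+ t. ennreal (normal_density (2 * s) \<sigma> t) \<partial>lborel) = 1"
    using prob_space.emeasure_space_1[OF prob_space_normal_density[OF \<sigma>, of "2 * s"]]
    by (simp add: emeasure_density)
  finally show ?thesis by (simp add: mult.commute)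
qed

text \<open>Points of a product over \<open>J\<close> are \<open>undefined\<close> outside
  \<open>J\<close>, so the missing coordinates are constant and measurable. This allows one Borel
  function on all sequences to be integrated over every finite product.\<close>

lemma measurable_PiM_gauss_borel:
  "(\<lambda>x. x) \<in> PiM J (\<lambda>_::nat. gauss \<sigma>) \<rightarrow>\<^sub>M (borel :: (nat \<Rightarrow> real) measure)"
proof (rule measurable_coordinatewise_then_product)
  fix i
  show "(\<lambda>x. x i) \<in> borel_measurable (PiM J (\<lambda>_. gauss \<sigma>))"
  proof (cases "i \<in> J")
    case True
    then have "(\<lambda>x. x i) \<in> PiM J (\<lambda>_. gauss \<sigma>) \<rightarrow>\<^sub>M gauss \<sigma>" by (rule measurable_component_singleton)
    then show ?thesis unfolding measurable_cong_sets[OF refl sets_gauss] .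
  next
    case False
    have "(\<lambda>x. x i) \<in> borel_measurable (PiM J (\<lambda>_. gauss \<sigma>)) \<longleftrightarrow>
      (\<lambda>x. undefined :: real) \<in> borel_measurable (PiM J (\<lambda>_. gauss \<sigma>))"
      by (rule measurable_cong) (use False in \<open>auto simp: space_PiM PiE_def extensional_def\<close>)
    then show ?thesis by simp
  qed
qed

lemma measurable_fun_upd_seq:
  assumes [measurable]: "f \<in> A \<rightarrow>\<^sub>M (borel :: (nat \<Rightarrow> real) measure)" "h \<in> borel_measurable A"
  shows "(\<lambda>x. (f x)(i := h x)) \<in> A \<rightarrow>\<^sub>M (borel :: (nat \<Rightarrow> real) measure)"
proof (rule measurable_coordinatewise_then_product)
  fix k
  have "(\<lambda>x. f x k) \<in> borel_measurable A"
    by (rule measurable_compose[OF assms(1)]) (intro borel_measurable_continuous_onI continuous_on_product_coordinates)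
  then show "(\<lambda>x. ((f x)(i := h x)) k) \<in> borel_measurable A" by (cases "k = i") auto
qed

lemma measurable_shift_seq:
  assumes "f \<in> A \<rightarrow>\<^sub>M (borel :: (nat \<Rightarrow> real) measure)"
  shows "(\<lambda>x k. f x k + a k) \<in> A \<rightarrow>\<^sub>M (borel :: (nat \<Rightarrow> real) measure)"
proof (rule measurable_coordinatewise_then_product)
  fix k
  have [measurable]: "(\<lambda>x. f x k) \<in> borel_measurable A"
    by (rule measurable_compose[OF assms]) (intro borel_measurable_continuous_onI continuous_on_product_coordinates)
  show "(\<lambda>x. f x k + a k) \<in> borel_measurable A" by measurable
qed

text \<open>Integrate out the new coordinate together with its shift, apply the induction hypothesis
  to the resulting function \<open>G\<close>, and bound \<open>G\<close> pointwise by the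
  one-dimensional inequality; the exponents add up to the energy of the shift. Off \<open>J\<close>
  the shift is 0, so the \<open>undefined\<close> coordinates stay as they are.\<close>

lemma cameron_martin_finite:
  fixes F :: "(nat \<Rightarrow> real) \<Rightarrow> ennreal"
  assumes \<sigma>: "\<sigma> > 0" and J: "finite J" and F: "F \<in> borel_measurable borel"
  shows "(\<integral>\<^sup>+ x. F (\<lambda>i. x i + (if i \<in> J then s i else 0)) \<partial>PiM J (\<lambda>_. gauss \<sigma>))\<^sup>2
    \<le> ennreal (exp ((\<Sum>i \<in> J. (s i)\<^sup>2) / \<sigma>\<^sup>2)) * (\<integral>\<^sup>+ x. (F x)\<^sup>2 \<partial>PiM J (\<lambda>_. gauss \<sigma>))"
  using J F
proof (induction J arbitrary: F rule: finite_induct)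
  case empty
  then show ?case by (simp add: PiM_empty nn_integral_count_space_finite)
next
  case (insert j J)
  interpret g: prob_space "gauss \<sigma>" by (rule prob_space_gauss[OF \<sigma>])
  interpret product_sigma_finite "\<lambda>_::nat. gauss \<sigma>" by standard
  note F = insert.prems
  let ?P = "PiM J (\<lambda>_. gauss \<sigma>)"
  let ?s = "\<lambda>J i. if i \<in> J then s i else 0"
  define G where "G x = (\<integral>\<^sup>+ y. F (x(j := y + s j)) \<partial>gauss \<sigma>)" for x
  have Gm[measurable]: "G \<in> borel_measurable borel"
  proof -
    have "(\<lambda>z. F ((fst z)(j := snd z + s j))) \<in> borel_measurable (borel \<Otimes>\<^sub>M gauss \<sigma>)"
      by (rule measurable_compose[OF measurable_fun_upd_seq F]) measurable
    then show ?thesis unfolding G_def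
      by (intro g.borel_measurable_nn_integral) (simp add: split_beta')
  qed
  have Fins: "(\<lambda>x. F (\<lambda>i. x i + ?s (insert j J) i)) \<in> borel_measurable (PiM (insert j J) (\<lambda>_. gauss \<sigma>))"
    by (rule measurable_compose[OF measurable_shift_seq[OF measurable_PiM_gauss_borel] F])
  have "(\<integral>\<^sup>+ x. F (\<lambda>i. x i + ?s (insert j J) i) \<partial>PiM (insert j J) (\<lambda>_. gauss \<sigma>))
    = (\<integral>\<^sup>+ x. \<integral>\<^sup>+ y. F (\<lambda>i. (x(j := y)) i + ?s (insert j J) i) \<partial>gauss \<sigma> \<partial>?P)"
    by (rule product_nn_integral_insert[OF insert.hyps(1,2) Fins])
  also have "\<dots> = (\<integral>\<^sup>+ x. G (\<lambda>i. x i + ?s J i) \<partial>?P)"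
    unfolding G_def using insert.hyps(2)
    by (intro nn_integral_cong arg_cong[of _ _ F]) (auto simp: fun_eq_iff)
  finally have "(\<integral>\<^sup>+ x. F (\<lambda>i. x i + ?s (insert j J) i) \<partial>PiM (insert j J) (\<lambda>_. gauss \<sigma>))\<^sup>2
    = (\<integral>\<^sup>+ x. G (\<lambda>i. x i + ?s J i) \<partial>?P)\<^sup>2" by simp
  also have "\<dots> \<le> ennreal (exp ((\<Sum>i \<in> J. (s i)\<^sup>2) / \<sigma>\<^sup>2)) * (\<integral>\<^sup>+ x. (G x)\<^sup>2 \<partial>?P)"
    by (rule insert.IH[OF Gm])
  also have "(\<integral>\<^sup>+ x. (G x)\<^sup>2 \<partial>?P) \<le> (\<integral>\<^sup>+ x. ennreal (exp ((s j)\<^sup>2 / \<sigma>\<^sup>2)) * (\<integral>\<^sup>+ y. (F (x(j := y)))\<^sup>2 \<partial>gauss \<sigma>) \<partial>?P)"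
  proof (rule nn_integral_mono)
    fix x
    have "(\<lambda>y. F (x(j := y))) \<in> borel_measurable borel"
      by (rule measurable_compose[OF measurable_fun_upd_seq F]) measurable
    from cameron_martin_1d[OF \<sigma> this, of "s j"]
    show "(G x)\<^sup>2 \<le> ennreal (exp ((s j)\<^sup>2 / \<sigma>\<^sup>2)) * (\<integral>\<^sup>+ y. (F (x(j := y)))\<^sup>2 \<partial>gauss \<sigma>)"
      unfolding G_def .
  qed
  also have "\<dots> = ennreal (exp ((s j)\<^sup>2 / \<sigma>\<^sup>2)) * (\<integral>\<^sup>+ x. \<integral>\<^sup>+ y. (F (x(j := y)))\<^sup>2 \<partial>gauss \<sigma> \<partial>?P)"
  proof (rule nn_integral_cmult)
    have "(\<lambda>z. F ((fst z)(j := snd z))) \<in> borel_measurable (?P \<Otimes>\<^sub>M gauss \<sigma>)"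
      by (intro measurable_compose[OF measurable_fun_upd_seq F]
          measurable_compose[OF measurable_fst measurable_PiM_gauss_borel]) measurable
    then have "(\<lambda>z. (F ((fst z)(j := snd z)))\<^sup>2) \<in> borel_measurable (?P \<Otimes>\<^sub>M gauss \<sigma>)"
      unfolding power2_eq_square by measurable
    then show "(\<lambda>x. \<integral>\<^sup>+ y. (F (x(j := y)))\<^sup>2 \<partial>gauss \<sigma>) \<in> borel_measurable ?P"
      by (intro g.borel_measurable_nn_integral) (simp add: split_beta')
  qed
  also have "(\<integral>\<^sup>+ x. \<integral>\<^sup>+ y. (F (x(j := y)))\<^sup>2 \<partial>gauss \<sigma> \<partial>?P) = (\<integral>\<^sup>+ x. (F x)\<^sup>2 \<partial>PiM (insert j J) (\<lambda>_. gauss \<sigma>))"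
  proof (rule product_nn_integral_insert[symmetric, OF insert.hyps(1,2)])
    have "F \<in> borel_measurable (PiM (insert j J) (\<lambda>_. gauss \<sigma>))"
      by (rule measurable_compose[OF measurable_PiM_gauss_borel F])
    then show "(\<lambda>x. (F x)\<^sup>2) \<in> borel_measurable (PiM (insert j J) (\<lambda>_. gauss \<sigma>))"
      unfolding power2_eq_square by measurable
  qed
  finally have "(\<integral>\<^sup>+ x. F (\<lambda>i. x i + ?s (insert j J) i) \<partial>PiM (insert j J) (\<lambda>_. gauss \<sigma>))\<^sup>2
    \<le> ennreal (exp ((\<Sum>i \<in> J. (s i)\<^sup>2) / \<sigma>\<^sup>2)) * (ennreal (exp ((s j)\<^sup>2 / \<sigma>\<^sup>2)) *
        (\<integral>\<^sup>+ x. (F x)\<^sup>2 \<partial>PiM (insert j J) (\<lambda>_. gauss \<sigma>)))"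
    by (simp add: mult_left_mono)
  also have "\<dots> = ennreal (exp ((\<Sum>i \<in> insert j J. (s i)\<^sup>2) / \<sigma>\<^sup>2)) * (\<integral>\<^sup>+ x. (F x)\<^sup>2 \<partial>PiM (insert j J) (\<lambda>_. gauss \<sigma>))"
    using insert.hyps by (simp add: mult.assoc[symmetric] ennreal_mult'[symmetric] exp_add[symmetric] add_divide_distrib add.commute)
  finally show ?case .
qed

text \<open>The law of the whole sequence of Brownian increments over one time step, once
  \<open>\<sigma>\<close> is the square root of the step. It is placed on the Borel space of
  sequences, where Lipschitz functions for the metric of that space can be integrated.\<close>

definition white :: "real \<Rightarrow> (nat \<Rightarrow> real) measure" where
  "white \<sigma> = distr (PiM UNIV (\<lambda>_. gauss \<sigma>)) borel (\<lambda>x. x)"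

lemma sets_white[simp, measurable_cong]: "sets (white \<sigma>) = sets borel"
  and space_white[simp]: "space (white \<sigma>) = UNIV"
  unfolding white_def by auto

lemma prob_space_white: "\<sigma> > 0 \<Longrightarrow> prob_space (white \<sigma>)"
  unfolding white_def
  by (intro prob_space.prob_space_distr measurable_PiM_gauss_borel prob_space_PiM prob_space_gauss)

lemma nn_integral_white_finite:
  fixes F :: "(nat \<Rightarrow> real) \<Rightarrow> ennreal"
  assumes \<sigma>: "\<sigma> > 0" and F: "F \<in> borel_measurable borel"
    and dep: "\<And>x y. (\<And>i. i < m \<Longrightarrow> x i = y i) \<Longrightarrow> F x = F y"
  shows "(\<integral>\<^sup>+ x. F x \<partial>white \<sigma>) = (\<integral>\<^sup>+ x. F x \<partial>PiM {..<m} (\<lambda>_. gauss \<sigma>))"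
proof -
  interpret g: prob_space "gauss \<sigma>" by (rule prob_space_gauss[OF \<sigma>])
  interpret product_prob_space "\<lambda>_::nat. gauss \<sigma>" UNIV by standard
  have "(\<integral>\<^sup>+ x. F x \<partial>white \<sigma>) = (\<integral>\<^sup>+ x. F x \<partial>PiM UNIV (\<lambda>_. gauss \<sigma>))"
    unfolding white_def by (rule nn_integral_distr[OF measurable_PiM_gauss_borel]) (simp add: F)
  also have "\<dots> = (\<integral>\<^sup>+ x. F (restrict x {..<m}) \<partial>PiM UNIV (\<lambda>_. gauss \<sigma>))"
    by (intro nn_integral_cong dep) auto
  also have "\<dots> = (\<integral>\<^sup>+ x. F x \<partial>distr (PiM UNIV (\<lambda>_. gauss \<sigma>)) (PiM {..<m} (\<lambda>_. gauss \<sigma>)) (\<lambda>x. restrict x {..<m}))"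
  proof (rule nn_integral_distr[symmetric])
    show "(\<lambda>x. restrict x {..<m}) \<in> PiM UNIV (\<lambda>_. gauss \<sigma>) \<rightarrow>\<^sub>M PiM {..<m} (\<lambda>_. gauss \<sigma>)"
      by (rule measurable_restrict_subset) simp
    show "F \<in> borel_measurable (distr (PiM UNIV (\<lambda>_. gauss \<sigma>)) (PiM {..<m} (\<lambda>_. gauss \<sigma>)) (\<lambda>x. restrict x {..<m}))"
      using measurable_compose[OF measurable_PiM_gauss_borel F] by simp
  qed
  also have "\<dots> = (\<integral>\<^sup>+ x. F x \<partial>PiM {..<m} (\<lambda>_. gauss \<sigma>))"
    by (subst distr_PiM_restrict_finite) auto
  finally show ?thesis .
qed

text \<open>A function of the first \<open>m\<close> coordinates sees only a finite product. The
  constant depends on \<open>m\<close> only through a partial energy, so a square summable shift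
  gives a bound uniform in \<open>m\<close>.\<close>

lemma cameron_martin_white:
  fixes F :: "(nat \<Rightarrow> real) \<Rightarrow> ennreal"
  assumes \<sigma>: "\<sigma> > 0" and F: "F \<in> borel_measurable borel"
    and dep: "\<And>x y. (\<And>i. i < m \<Longrightarrow> x i = y i) \<Longrightarrow> F x = F y"
  shows "(\<integral>\<^sup>+ x. F (\<lambda>i. x i + s i) \<partial>white \<sigma>)\<^sup>2
    \<le> ennreal (exp ((\<Sum>i<m. (s i)\<^sup>2) / \<sigma>\<^sup>2)) * (\<integral>\<^sup>+ x. (F x)\<^sup>2 \<partial>white \<sigma>)"
proof -
  have Fs: "F (\<lambda>i. x i + s i) = F (\<lambda>i. x i + (if i \<in> {..<m} then s i else 0))" for x
    by (rule dep) simp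
  have "(\<integral>\<^sup>+ x. F (\<lambda>i. x i + s i) \<partial>white \<sigma>) = (\<integral>\<^sup>+ x. F (\<lambda>i. x i + s i) \<partial>PiM {..<m} (\<lambda>_. gauss \<sigma>))"
    by (rule nn_integral_white_finite[OF \<sigma>])
      (auto intro!: measurable_compose[OF measurable_shift_seq[OF measurable_ident] F, unfolded id_def] dep)
  moreover have "(\<integral>\<^sup>+ x. (F x)\<^sup>2 \<partial>white \<sigma>) = (\<integral>\<^sup>+ x. (F x)\<^sup>2 \<partial>PiM {..<m} (\<lambda>_. gauss \<sigma>))"
    by (rule nn_integral_white_finite[OF \<sigma>]) (use F in \<open>auto intro!: arg_cong[of _ _ "\<lambda>x. x\<^sup>2"] dep\<close>)
  ultimately show ?thesis
    using cameron_martin_finite[OF \<sigma> _ F, of "{..<m}" s] unfolding Fs by simp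
qed

section \<open>The sine basis\<close>

lemma integrable_unit_continuous:
  fixes h :: "real \<Rightarrow> real"
  assumes "continuous_on UNIV h"
  shows "integrable unit_interval h"
proof -
  have "integrable (lebesgue_on {0..1}) h"
    by (rule continuous_imp_integrable_real) (use assms in \<open>auto intro: continuous_on_subset\<close>)
  then have "set_integrable lebesgue {0..1} h" by (simp add: set_integrable_def integrable_restrict_space)
  then have "set_integrable lebesgue {0<..<1} h" by (rule set_integrable_subset) auto
  then show ?thesis by (simp add: set_integrable_def integrable_restrict_space)
qed

lemma integral_unit_FTC:
  fixes h H :: "real \<Rightarrow> real"
  assumes h: "continuous_on UNIV h" and H: "\<And>x. (H has_real_derivative h x) (at x)"
  shows "(LINT x|unit_interval. h x) = H 1 - H 0"
proof -
  have "(h has_integral (H 1 - H 0)) {0..1}"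
    using H by (intro fundamental_theorem_of_calculus) (auto simp: has_real_derivative_iff_has_vector_derivative[symmetric] intro: DERIV_subset)
  then have "(h has_integral (H 1 - H 0)) {0<..<1}"
    by (simp add: has_integral_Icc_iff_Ioo)
  moreover have "(h has_integral (LINT x|unit_interval. h x)) {0<..<1}"
    using integrable_unit_continuous[OF h] by (intro has_integral_integral_lebesgue_on) auto
  ultimately show ?thesis by (rule has_integral_unique[rotated])
qed

text \<open>The frequency is an integer because the product formulas for sines and cosines produce
  differences of indices.\<close>

lemma integral_cos_unit:
  "(LINT x|unit_interval. cos (real_of_int n * pi * x)) = (if n = 0 then 1 else 0)"
proof (cases "n = 0")
  case True
  then show ?thesis using integral_unit_FTC[of "\<lambda>_. 1" "\<lambda>x. x"] by (auto intro!: derivative_eq_intros)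
next
  case False
  have "(LINT x|unit_interval. cos (real_of_int n * pi * x))
     = sin (real_of_int n * pi * 1) / (real_of_int n * pi) - sin (real_of_int n * pi * 0) / (real_of_int n * pi)"
    using False by (intro integral_unit_FTC[where H = "\<lambda>x. sin (real_of_int n * pi * x) / (real_of_int n * pi)"])
      (auto intro!: derivative_eq_intros continuous_intros)
  then show ?thesis using False by (simp add: sin_zero_iff_int2)
qed

lemma cos_unit_diff_sum:
  fixes j k :: nat
  assumes "j \<ge> 1" "k \<ge> 1"
  shows "(LINT x|unit_interval. cos ((real j - real k) * pi * x)) = (if j = k then 1 else 0)"
    and "(LINT x|unit_interval. cos ((real j + real k) * pi * x)) = 0"
  using integral_cos_unit[of "int j - int k"] integral_cos_unit[of "int j + int k"] assms by auto

lemma ip_e: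
  assumes "j \<ge> 1" "k \<ge> 1"
  shows "ip (e j) (e k) = (if j = k then 1 else 0)"
proof -
  have eq: "e j x * e k x = cos ((real j - real k) * pi * x) - cos ((real j + real k) * pi * x)" for x
  proof -
    have "e j x * e k x = 2 * (sin (real j * pi * x) * sin (real k * pi * x))" unfolding e_def by simp
    also have "\<dots> = cos ((real j - real k) * pi * x) - cos ((real j + real k) * pi * x)"
      by (simp add: sin_times_sin left_diff_distrib distrib_right)
    finally show ?thesis .
  qed
  have "ip (e j) (e k) = (LINT x|unit_interval. cos ((real j - real k) * pi * x)) - (LINT x|unit_interval. cos ((real j + real k) * pi * x))"
    unfolding ip_def eq
    by (rule Bochner_Integration.integral_diff; intro integrable_unit_continuous continuous_intros)
  then show ?thesis using cos_unit_diff_sum[OF assms] by simp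
qed

lemma deriv_e: "deriv (e k) = (\<lambda>\<xi>. sqrt 2 * (real k * pi) * cos (real k * pi * \<xi>))"
  unfolding e_def by (rule ext, rule DERIV_imp_deriv) (auto intro!: derivative_eq_intros)

lemma ip_deriv_e:
  assumes "j \<ge> 1" "k \<ge> 1"
  shows "ip (deriv (e j)) (deriv (e k)) = (if j = k then (real j * pi)\<^sup>2 else 0)"
proof -
  have eq: "deriv (e j) x * deriv (e k) x
     = (real j * pi) * (real k * pi) * (cos ((real j - real k) * pi * x) + cos ((real j + real k) * pi * x))" for x
  proof -
    have "deriv (e j) x * deriv (e k) x = (real j * pi) * (real k * pi) * (2 * (cos (real j * pi * x) * cos (real k * pi * x)))"
      unfolding deriv_e by (simp add: mult_ac)
    also have "2 * (cos (real j * pi * x) * cos (real k * pi * x)) = cos ((real j - real k) * pi * x) + cos ((real j + real k) * pi * x)"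
      by (simp add: cos_times_cos left_diff_distrib distrib_right)
    finally show ?thesis .
  qed
  have "(LINT x|unit_interval. cos ((real j - real k) * pi * x) + cos ((real j + real k) * pi * x))
    = (LINT x|unit_interval. cos ((real j - real k) * pi * x)) + (LINT x|unit_interval. cos ((real j + real k) * pi * x))"
    by (rule Bochner_Integration.integral_add; intro integrable_unit_continuous continuous_intros)
  then show ?thesis using cos_unit_diff_sum[OF assms] unfolding ip_def eq
    by (simp add: power2_eq_square)
qed

lemma continuous_on_e[continuous_intros]: "continuous_on A (e k)"
  unfolding e_def by (intro continuous_intros)

lemma abs_e_le: "\<bar>e k x\<bar> \<le> sqrt 2"
  unfolding e_def using abs_sin_le_one[of "real k * pi * x"] by (simp add: abs_mult)

lemma e_measurable[measurable]: "e k \<in> borel_measurable borel"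
  by (intro borel_measurable_continuous_onI continuous_on_e)

text \<open>States are handled through coordinate sequences of type
  \<open>nat \<Rightarrow> real\<close>, one Polish space for all \<open>N\<close>, on which Borel
  measures, products and a metric are at hand. Only the indices from 1 to \<open>N\<close>
  matter.\<close>

definition syn :: "nat \<Rightarrow> (nat \<Rightarrow> real) \<Rightarrow> real \<Rightarrow> real" where
  "syn N c = (\<lambda>\<xi>. \<Sum>k = 1..N. c k * e k \<xi>)"

text \<open>The zeros outside 1 to \<open>N\<close> select one sequence among all those with the
  same sine polynomial, so that equality of states becomes equality of sequences.\<close>

definition coef :: "nat \<Rightarrow> (real \<Rightarrow> real) \<Rightarrow> nat \<Rightarrow> real" where
  "coef N u = (\<lambda>k. if k \<in> {1..N} then ip u (e k) else 0)"

lemma VN_eq: "VN N = range (syn N)"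
  unfolding VN_def syn_def by auto

lemma syn_in_VN[simp]: "syn N c \<in> VN N" unfolding VN_eq by simp

lemma continuous_on_syn[continuous_intros]: "continuous_on A (syn N c)"
  unfolding syn_def by (intro continuous_intros)

lemma syn_cong: "(\<And>k. k \<in> {1..N} \<Longrightarrow> c k = d k) \<Longrightarrow> syn N c = syn N d"
  unfolding syn_def by (auto intro!: sum.cong)

lemma ip_sum_right:
  fixes u :: "real \<Rightarrow> real"
  assumes "\<And>k. k \<in> {1..N} \<Longrightarrow> integrable unit_interval (\<lambda>\<xi>. u \<xi> * e k \<xi>)"
  shows "ip u (syn N c) = (\<Sum>k = 1..N. c k * ip u (e k))"
proof -
  have "ip u (syn N c) = (LINT \<xi>|unit_interval. (\<Sum>k = 1..N. c k * (u \<xi> * e k \<xi>)))"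
    unfolding ip_def syn_def by (simp add: sum_distrib_left mult_ac)
  also have "\<dots> = (\<Sum>k = 1..N. LINT \<xi>|unit_interval. c k * (u \<xi> * e k \<xi>))"
    using assms by (intro Bochner_Integration.integral_sum integrable_mult_right) auto
  finally show ?thesis unfolding ip_def by simp
qed

lemma ip_commute: "ip u v = ip v u"
  unfolding ip_def by (simp add: mult.commute)

lemma ip_syn_e: "k \<in> {1..N} \<Longrightarrow> ip (syn N c) (e k) = c k"
proof -
  assume k: "k \<in> {1..N}"
  have "ip (syn N c) (e k) = ip (e k) (syn N c)" by (rule ip_commute)
  also have "\<dots> = (\<Sum>j = 1..N. c j * ip (e k) (e j))"
    by (rule ip_sum_right) (intro integrable_unit_continuous continuous_intros)
  also have "\<dots> = (\<Sum>j = 1..N. if j = k then c j else 0)"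
    using k by (intro sum.cong) (auto simp: ip_e)
  finally show ?thesis using k by simp
qed

lemma coef_syn: "coef N (syn N c) = (\<lambda>k. if k \<in> {1..N} then c k else 0)"
  unfolding coef_def by (auto simp: ip_syn_e)

lemma syn_coef: "u \<in> VN N \<Longrightarrow> syn N (coef N u) = u"
  unfolding VN_eq using coef_syn by (auto intro!: syn_cong)

lemma ip_syn_syn: "ip (syn N c) (syn N d) = (\<Sum>k = 1..N. c k * d k)"
  by (subst ip_sum_right) (auto intro!: integrable_unit_continuous continuous_intros sum.cong simp: ip_syn_e mult.commute)

lemma nrm_syn: "nrm (syn N c) = sqrt (\<Sum>k = 1..N. (c k)\<^sup>2)"
  unfolding nrm_def ip_syn_syn by (simp add: power2_eq_square)

lemma syn_diff: "(\<lambda>\<xi>. syn N c \<xi> - syn N d \<xi>) = syn N (\<lambda>k. c k - d k)"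
  unfolding syn_def by (simp add: sum_subtractf left_diff_distrib)

lemma nrm_syn_diff: "nrm (\<lambda>\<xi>. syn N c \<xi> - syn N d \<xi>) = sqrt (\<Sum>k = 1..N. (c k - d k)\<^sup>2)"
  unfolding syn_diff nrm_syn ..

text \<open>For general functions distance 0 does not imply equality, since they may differ outside
  (0,1) or on a null set. A sine polynomial is recovered from its inner products with the
  \<open>e k\<close>, which gives definiteness; the triangle inequality is that of Euclidean
  space.\<close>

lemma Metric_space_VN: "Metric_space (VN N) (\<lambda>u v. nrm (\<lambda>\<xi>. u \<xi> - v \<xi>))"
proof
  show "0 \<le> nrm (\<lambda>\<xi>. u \<xi> - v \<xi>)" for u v :: "real \<Rightarrow> real"
    unfolding nrm_def ip_def by (auto intro!: real_sqrt_ge_zero integral_nonneg)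
  show "nrm (\<lambda>\<xi>. u \<xi> - v \<xi>) = nrm (\<lambda>\<xi>. v \<xi> - u \<xi>)" for u v :: "real \<Rightarrow> real"
    unfolding nrm_def ip_def by (simp add: algebra_simps)
  show "nrm (\<lambda>\<xi>. u \<xi> - v \<xi>) = 0 \<longleftrightarrow> u = v" if uv: "u \<in> VN N" "v \<in> VN N" for u v
  proof -
    obtain c d where c: "u = syn N c" and d: "v = syn N d" using uv unfolding VN_eq by auto
    have "nrm (\<lambda>\<xi>. u \<xi> - v \<xi>) = 0 \<longleftrightarrow> (\<forall>k \<in> {1..N}. c k = d k)"
      unfolding c d nrm_syn_diff by (auto simp: sum_nonneg_eq_0_iff)
    also have "\<dots> \<longleftrightarrow> u = v"
      unfolding c d using ip_syn_e[of _ N c] ip_syn_e[of _ N d] by (metis syn_cong)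
    finally show ?thesis .
  qed
  show "nrm (\<lambda>\<xi>. u \<xi> - w \<xi>) \<le> nrm (\<lambda>\<xi>. u \<xi> - v \<xi>) + nrm (\<lambda>\<xi>. v \<xi> - w \<xi>)"
    if uvw: "u \<in> VN N" "v \<in> VN N" "w \<in> VN N" for u v w
  proof -
    obtain a b c where a: "u = syn N a" and b: "v = syn N b" and c: "w = syn N c"
      using uvw unfolding VN_eq by auto
    have "sqrt (\<Sum>k = 1..N. (a k - c k)\<^sup>2) = L2_set (\<lambda>k. (a k - b k) + (b k - c k)) {1..N}"
      unfolding L2_set_def by simp
    also have "\<dots> \<le> L2_set (\<lambda>k. a k - b k) {1..N} + L2_set (\<lambda>k. b k - c k) {1..N}"
      by (rule L2_set_triangle_ineq)
    finally show ?thesis unfolding a b c nrm_syn_diff by (simp add: L2_set_def)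
  qed
qed

lemma space_borelVN[simp]: "space (borelVN N) = VN N"
  unfolding borelVN_def by (simp add: space_measure_of_conv)

lemma openin_VN_iff:
  "openin (Metric_space.mtopology (VN N) (\<lambda>u v. nrm (\<lambda>\<xi>. u \<xi> - v \<xi>))) U \<longleftrightarrow>
     U \<subseteq> VN N \<and> (\<forall>u \<in> U. \<exists>r>0. \<forall>v \<in> VN N. nrm (\<lambda>\<xi>. u \<xi> - v \<xi>) < r \<longrightarrow> v \<in> U)"
proof -
  interpret Metric_space "VN N" "\<lambda>u v. nrm (\<lambda>\<xi>. u \<xi> - v \<xi>)" by (rule Metric_space_VN)
  show ?thesis unfolding openin_mtopology mball_def by blast
qed

lemma sets_borelVN_openI:
  assumes "U \<subseteq> VN N" "\<And>u. u \<in> U \<Longrightarrow> \<exists>r>0. \<forall>v \<in> VN N. nrm (\<lambda>\<xi>. u \<xi> - v \<xi>) < r \<longrightarrow> v \<in> U"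
  shows "U \<in> sets (borelVN N)"
  unfolding borelVN_def openin_VN_iff using assms by (intro in_measure_of) auto

lemma abs_coord_le_nrm:
  assumes "k \<in> {1..N}"
  shows "\<bar>c k - d k\<bar> \<le> nrm (\<lambda>\<xi>. syn N c \<xi> - syn N d \<xi>)"
proof -
  have "(c k - d k)\<^sup>2 \<le> (\<Sum>k = 1..N. (c k - d k)\<^sup>2)"
    using assms by (intro member_le_sum) auto
  then have "sqrt ((c k - d k)\<^sup>2) \<le> sqrt (\<Sum>k = 1..N. (c k - d k)\<^sup>2)" by (rule real_sqrt_le_mono)
  then show ?thesis unfolding nrm_syn_diff by simp
qed

lemma measurable_ip_e[measurable]:
  assumes k: "k \<in> {1..N}"
  shows "(\<lambda>u. ip u (e k)) \<in> borelVN N \<rightarrow>\<^sub>M borel"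
proof (rule borel_measurableI)
  fix T :: "real set" assume T: "open T"
  show "(\<lambda>u. ip u (e k)) -` T \<inter> space (borelVN N) \<in> sets (borelVN N)"
  proof (rule sets_borelVN_openI)
    fix u assume "u \<in> (\<lambda>u. ip u (e k)) -` T \<inter> space (borelVN N)"
    then obtain c where c: "u = syn N c" "c k \<in> T" using k by (auto simp: VN_eq ip_syn_e)
    obtain r where r: "r > 0" "\<And>y. dist y (c k) < r \<Longrightarrow> y \<in> T" using T c(2) unfolding open_dist by blast
    show "\<exists>r>0. \<forall>v \<in> VN N. nrm (\<lambda>\<xi>. u \<xi> - v \<xi>) < r \<longrightarrow> v \<in> (\<lambda>u. ip u (e k)) -` T \<inter> space (borelVN N)"
    proof (intro exI[of _ r] conjI ballI impI r(1))
      fix v assume v: "v \<in> VN N" "nrm (\<lambda>\<xi>. u \<xi> - v \<xi>) < r"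
      then obtain d where d: "v = syn N d" by (auto simp: VN_eq)
      have "dist (d k) (c k) < r" using abs_coord_le_nrm[OF k, of c d] v(2) unfolding c d by (simp add: dist_real_def abs_minus_commute)
      then show "v \<in> (\<lambda>u. ip u (e k)) -` T \<inter> space (borelVN N)" using r(2) k unfolding d by (simp add: ip_syn_e)
    qed
  qed auto
qed

text \<open>The opposite direction is \<open>measurable_syn\<close>; together they transport laws on
  \<open>VN N\<close> to sequences and back.\<close>

lemma measurable_coef[measurable]: "coef N \<in> borelVN N \<rightarrow>\<^sub>M borel"
proof (rule measurable_coordinatewise_then_product)
  show "(\<lambda>u. coef N u i) \<in> borel_measurable (borelVN N)" for i
    by (cases "i \<in> {1..N}") (simp_all only: coef_def if_True if_False measurable_ip_e measurable_const space_borel UNIV_I)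
qed

lemma measurable_coordinate[measurable]: "(\<lambda>c::nat \<Rightarrow> real. c k) \<in> borel_measurable borel"
  by (intro borel_measurable_continuous_onI continuous_on_product_coordinates)

lemma measurable_syn[measurable]: "syn N \<in> borel \<rightarrow>\<^sub>M borelVN N"
  unfolding borelVN_def
proof (rule measurable_measure_of)
  show "{U. openin (Metric_space.mtopology (VN N) (\<lambda>u v. nrm (\<lambda>\<xi>. u \<xi> - v \<xi>))) U} \<subseteq> Pow (VN N)"
    unfolding openin_VN_iff by auto
  show "syn N \<in> space borel \<rightarrow> VN N" by simp
  fix U assume "U \<in> {U. openin (Metric_space.mtopology (VN N) (\<lambda>u v. nrm (\<lambda>\<xi>. u \<xi> - v \<xi>))) U}"
  then have U: "\<And>u. u \<in> U \<Longrightarrow> \<exists>r>0. \<forall>v \<in> VN N. nrm (\<lambda>\<xi>. u \<xi> - v \<xi>) < r \<longrightarrow> v \<in> U"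
    unfolding openin_VN_iff by blast
  have "open (syn N -` U)"
  proof (subst open_subopen, intro ballI)
    fix c assume "c \<in> syn N -` U"
    then obtain r where r: "r > 0" "\<And>v. v \<in> VN N \<Longrightarrow> nrm (\<lambda>\<xi>. syn N c \<xi> - v \<xi>) < r \<Longrightarrow> v \<in> U"
      using U[of "syn N c"] by auto
    let ?T = "{d. sqrt (\<Sum>k = 1..N. (c k - d k)\<^sup>2) < r}"
    have "open ?T"
      by (intro open_Collect_less continuous_intros continuous_on_product_coordinates)
    moreover have "c \<in> ?T" using r by simp
    moreover have "?T \<subseteq> syn N -` U" using r(2)[OF syn_in_VN] unfolding nrm_syn_diff by auto
    ultimately show "\<exists>T. open T \<and> c \<in> T \<and> T \<subseteq> syn N -` U" by blast
  qed
  then show "syn N -` U \<inter> space borel \<in> sets borel" by simp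
qed

section \<open>The implicit step\<close>

lemma prob_space_unit_interval: "prob_space unit_interval"
  by (rule prob_spaceI) (simp add: space_restrict_space emeasure_restrict_space)

lemma borel_imp_unit_measurable:
  "h \<in> borel_measurable borel \<Longrightarrow> h \<in> borel_measurable unit_interval"
  by (intro measurable_restrict_space1 measurable_completion) simp

lemma integrable_unit_bounded:
  fixes h :: "real \<Rightarrow> real"
  assumes "h \<in> borel_measurable unit_interval" "\<And>x. \<bar>h x\<bar> \<le> B"
  shows "integrable unit_interval h"
proof -
  interpret prob_space unit_interval by (rule prob_space_unit_interval)
  show ?thesis using assms by (intro integrable_const_bound[where B = B]) auto
qed

lemma syn_bound: "\<bar>syn N c x\<bar> \<le> sqrt 2 * (\<Sum>k = 1..N. \<bar>c k\<bar>)"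
proof -
  have "\<bar>syn N c x\<bar> \<le> (\<Sum>k = 1..N. \<bar>c k * e k x\<bar>)" unfolding syn_def by (rule sum_abs)
  also have "\<dots> \<le> (\<Sum>k = 1..N. \<bar>c k\<bar> * sqrt 2)"
    unfolding abs_mult by (intro sum_mono mult_left_mono abs_e_le) auto
  finally show ?thesis by (simp add: sum_distrib_left mult.commute)
qed

lemma syn_measurable[measurable]: "syn N c \<in> borel_measurable borel"
  by (intro borel_measurable_continuous_onI continuous_on_syn)

lemma VN_eqI:
  assumes w: "w \<in> VN N" "w' \<in> VN N" and eq: "\<And>k. k \<in> {1..N} \<Longrightarrow> ip w (e k) = ip w' (e k)"
  shows "w = w'"
proof -
  have "coef N w k = coef N w' k" for k unfolding coef_def by (cases "k \<in> {1..N}") (simp_all only: eq if_True if_False)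
  then have "coef N w = coef N w'" ..
  then show ?thesis using syn_coef[OF w(1)] syn_coef[OF w(2)] by metis
qed

lemma e_in_VN: "k \<in> {1..N} \<Longrightarrow> e k \<in> VN N"
proof -
  assume k: "k \<in> {1..N}"
  have "syn N (\<lambda>j. if j = k then 1 else 0) = e k"
  proof (rule ext)
    fix x
    have "syn N (\<lambda>j. if j = k then 1 else 0) x = (\<Sum>j = 1..N. if j = k then e j x else 0)"
      unfolding syn_def by (intro sum.cong) auto
    then show "syn N (\<lambda>j. if j = k then 1 else 0) x = e k x" using k by simp
  qed
  then show ?thesis unfolding VN_eq by (metis rangeI)
qed

text \<open>Integrability of the products with the \<open>e k\<close> makes the pairing of
  \<open>u\<close> with \<open>VN N\<close> linear in the coordinates, so the coefficient sum solves
  the defining equation. Testing with each \<open>e k\<close> shows that there is no other solution,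
  as \<open>THE\<close> requires.\<close>

lemma PN_eq:
  assumes i: "\<And>k. k \<in> {1..N} \<Longrightarrow> integrable unit_interval (\<lambda>\<xi>. u \<xi> * e k \<xi>)"
  shows "PN N u = syn N (coef N u)"
  unfolding PN_def
proof (rule the_equality)
  have "ip (syn N (coef N u)) v = ip u v" if v: "v \<in> VN N" for v
  proof -
    obtain d where d: "v = syn N d" using v unfolding VN_eq by auto
    have "ip u v = (\<Sum>k = 1..N. d k * ip u (e k))" unfolding d by (rule ip_sum_right[OF i])
    also have "\<dots> = (\<Sum>k = 1..N. coef N u k * d k)"
      by (intro sum.cong refl) (simp add: coef_def mult.commute)
    finally show ?thesis unfolding d ip_syn_syn by simp
  qed
  then show "syn N (coef N u) \<in> VN N \<and> (\<forall>v\<in>VN N. ip (syn N (coef N u)) v = ip u v)" by simp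
  fix w assume w: "w \<in> VN N \<and> (\<forall>v\<in>VN N. ip w v = ip u v)"
  show "w = syn N (coef N u)"
  proof (rule VN_eqI)
    fix k assume k: "k \<in> {1..N}"
    have "ip w (e k) = ip u (e k)" using w e_in_VN[OF k] by blast
    also have "\<dots> = ip (syn N (coef N u)) (e k)" unfolding ip_syn_e[OF k] using k by (simp add: coef_def)
    finally show "ip w (e k) = ip (syn N (coef N u)) (e k)" .
  qed (use w in auto)
qed

lemma deriv_syn: "deriv (syn N c) = (\<lambda>\<xi>. \<Sum>k = 1..N. c k * deriv (e k) \<xi>)"
proof (rule ext, rule DERIV_imp_deriv)
  fix \<xi>
  have "(e k has_real_derivative deriv (e k) \<xi>) (at \<xi>)" for k
    unfolding deriv_e unfolding e_def by (auto intro!: derivative_eq_intros)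
  then show "(syn N c has_real_derivative (\<Sum>k = 1..N. c k * deriv (e k) \<xi>)) (at \<xi>)"
    unfolding syn_def by (intro DERIV_sum DERIV_cmult)
qed

lemma ip_deriv_syn: "ip (deriv (syn N c)) (deriv (syn N d)) = (\<Sum>k = 1..N. (real k * pi)\<^sup>2 * c k * d k)"
proof -
  have int: "integrable unit_interval (\<lambda>x. deriv (e j) x * deriv (e k) x)" for j k
    unfolding deriv_e by (intro integrable_unit_continuous continuous_intros)
  have "ip (deriv (syn N c)) (deriv (syn N d))
     = (LINT x|unit_interval. (\<Sum>j = 1..N. \<Sum>k = 1..N. (c j * d k) * (deriv (e j) x * deriv (e k) x)))"
    unfolding ip_def deriv_syn by (simp add: sum_product mult_ac)
  also have "\<dots> = (\<Sum>j = 1..N. \<Sum>k = 1..N. (c j * d k) * ip (deriv (e j)) (deriv (e k)))"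
    unfolding ip_def using int
    by (simp add: Bochner_Integration.integral_sum Bochner_Integration.integrable_sum)
  also have "\<dots> = (\<Sum>j = 1..N. \<Sum>k = 1..N. if k = j then (c j * d k) * (real j * pi)\<^sup>2 else 0)"
    by (intro sum.cong) (auto simp: ip_deriv_e)
  finally show ?thesis by (simp add: mult_ac)
qed

lemma DeltaN_syn: "DeltaN N (syn N c) = syn N (\<lambda>k. - ((real k * pi)\<^sup>2 * c k))"
  unfolding DeltaN_def
proof (rule the_equality)
  let ?w = "syn N (\<lambda>k. - ((real k * pi)\<^sup>2 * c k))"
  have w: "ip ?w v = - ip (deriv (syn N c)) (deriv v)" if "v \<in> VN N" for v
    using that unfolding VN_eq by (auto simp: ip_syn_syn ip_deriv_syn sum_negf)
  then show "?w \<in> VN N \<and> (\<forall>v\<in>VN N. ip ?w v = - ip (deriv (syn N c)) (deriv v))" by simp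
  fix w' assume w': "w' \<in> VN N \<and> (\<forall>v\<in>VN N. ip w' v = - ip (deriv (syn N c)) (deriv v))"
  show "w' = ?w"
  proof (rule VN_eqI)
    fix k assume "k \<in> {1..N}"
    then have "e k \<in> VN N" by (rule e_in_VN)
    then show "ip w' (e k) = ip ?w (e k)" using w' w by metis
  qed (use w' in auto)
qed

text \<open>McShane's extension. The bound \<open>lip\<close> makes \<open>h c\<close> a function of
  the coordinates of \<open>A c\<close> in \<open>I\<close>, Lipschitz on the range of
  \<open>A\<close>; an infimum of cones extends it to all sequences with the same constant and
  without knowledge of that range. Since \<open>D\<close> involves finitely many coordinates, the
  extension is continuous for the product topology, hence Borel.\<close>

lemma lipschitz_extension:
  fixes A :: "'b \<Rightarrow> nat \<Rightarrow> real" and h :: "'b \<Rightarrow> real"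
  assumes L: "L \<ge> 0" and I: "finite I"
    and lip: "\<And>c d. h c \<le> h d + L * (\<Sum>k \<in> I. \<bar>A c k - A d k\<bar>)"
  obtains F :: "(nat \<Rightarrow> real) \<Rightarrow> real" where "F \<in> borel_measurable borel"
    "\<And>y c. (\<And>k. k \<in> I \<Longrightarrow> y k = A c k) \<Longrightarrow> F y = h c"
proof -
  define D where "D y z = (\<Sum>k \<in> I. \<bar>y k - z k\<bar>)" for y z :: "nat \<Rightarrow> real"
  have Dtri: "D y z \<le> D y w + D w z" for y z w
    unfolding D_def sum.distrib[symmetric] by (intro sum_mono) auto
  have Dsym: "D y z = D z y" for y z unfolding D_def by (simp add: abs_minus_commute)
  have lip': "h c \<le> h d + L * D (A c) (A d)" for c d using lip unfolding D_def .
  define F where "F y = (INF c. h c + L * D y (A c))" for y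
  \<comment> \<open>By the triangle inequality every term of the infimum is bounded below by a value
    taken from any other index \<open>d\<close>. This gives finiteness of the infimum and, with
    \<open>D y (A c) = 0\<close>, the value \<open>h c\<close> on the range.\<close>
  have low: "h d - L * D y (A d) \<le> h c + L * D y (A c)" for y c d
  proof -
    have "L * D (A d) (A c) \<le> L * (D (A d) y + D y (A c))" using L Dtri by (intro mult_left_mono) auto
    then show ?thesis using lip'[of d c] Dsym[of "A d" y] by (simp add: algebra_simps)
  qed
  have bdd: "bdd_below (range (\<lambda>c. h c + L * D y (A c)))" for y
    using low by (intro bdd_belowI2) auto
  have FL: "F y \<le> F z + L * D y z" for y z
  proof -
    have "F y - L * D y z \<le> F z"
      unfolding F_def[of z]
    proof (rule cINF_greatest)
      fix c
      have "F y \<le> h c + L * D y (A c)" unfolding F_def by (rule cINF_lower[OF bdd]) simp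
      also have "\<dots> \<le> h c + L * (D y z + D z (A c))" using L Dtri by (intro add_left_mono mult_left_mono) auto
      finally show "F y - L * D y z \<le> h c + L * D z (A c)" by (simp add: algebra_simps)
    qed simp
    then show ?thesis by simp
  qed
  have cont: "continuous_on UNIV F"
    unfolding continuous_on_def
  proof (intro ballI)
    fix y :: "nat \<Rightarrow> real"
    have "((\<lambda>z. D y z) \<longlongrightarrow> D y y) (at y within UNIV)"
    proof -
      have "continuous_on UNIV (\<lambda>z. D y z)" unfolding D_def
        by (intro continuous_intros continuous_on_product_coordinates)
      then show ?thesis unfolding continuous_on_def by blast
    qed
    moreover have "D y y = 0" unfolding D_def by simp
    ultimately have "((\<lambda>z. D y z) \<longlongrightarrow> 0) (at y within UNIV)" by metis
    then have D0: "((\<lambda>z. L * D y z) \<longlongrightarrow> 0) (at y within UNIV)"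
      by (rule tendsto_mult_right_zero)
    have "((\<lambda>z. F z - F y) \<longlongrightarrow> 0) (at y within UNIV)"
    proof (rule Lim_null_comparison[OF _ D0])
      show "\<forall>\<^sub>F z in at y within UNIV. norm (F z - F y) \<le> L * D y z"
      proof (rule always_eventually, rule allI)
        fix z
        show "norm (F z - F y) \<le> L * D y z"
          using FL[of z y] FL[of y z] Dsym[of z y] by (simp add: abs_le_iff)
      qed
    qed
    then show "(F \<longlongrightarrow> F y) (at y within UNIV)" by (simp add: LIM_zero_iff)
  qed
  show thesis
  proof (rule that)
    show "F \<in> borel_measurable borel" by (rule borel_measurable_continuous_onI[OF cont])
    fix y c assume "\<And>k. k \<in> I \<Longrightarrow> y k = A c k"
    then have D0: "D y (A c) = 0" unfolding D_def by simp
    have "F y \<le> h c + L * D y (A c)" unfolding F_def by (rule cINF_lower[OF bdd]) simp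
    moreover have "h c - L * D y (A c) \<le> F y" unfolding F_def by (rule cINF_greatest) (use low in auto)
    ultimately show "F y = h c" using D0 by simp
  qed
qed

section \<open>The implicit operator: monotonicity, measurable inverse, coercivity\<close>

locale drift_term =
  fixes f :: "real \<Rightarrow> real" and K1 K2 K3 K4 K5 q \<tau> :: real and N :: nat
  assumes f_one_sided: "\<And>\<xi> \<eta>. (f \<xi> - f \<eta>) * (\<xi> - \<eta>) \<le> K1 * (\<xi> - \<eta>)\<^sup>2"
    and f_coercive: "\<And>\<xi>. f \<xi> * \<xi> \<le> K2 * \<bar>\<xi>\<bar>\<^sup>2 + K3"
    and q: "q \<ge> 1"
    and f_growth: "\<And>\<xi>. \<bar>f \<xi>\<bar> \<le> K4 * \<bar>\<xi>\<bar> powr q + K5"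
    and K2: "K2 < pi\<^sup>2"
    and \<tau>: "0 < \<tau>" "(K1 - pi\<^sup>2) * \<tau> < 1"
begin

text \<open>The one-sided Lipschitz condition says that \<open>K1 * \<xi> - f \<xi>\<close> is
  increasing, and monotone functions are Borel even where they jump.\<close>

lemma f_measurable[measurable]: "f \<in> borel_measurable borel"
proof -
  have "mono (\<lambda>\<xi>. K1 * \<xi> - f \<xi>)"
  proof (rule monoI)
    fix x y :: real assume "x \<le> y"
    show "K1 * x - f x \<le> K1 * y - f y"
    proof (cases "x = y")
      case False
      then have xy: "0 < y - x" using \<open>x \<le> y\<close> by simp
      have "(f y - f x) * (y - x) \<le> (K1 * (y - x)) * (y - x)"
        using f_one_sided[of y x] by (simp add: power2_eq_square mult_ac)
      then have "f y - f x \<le> K1 * (y - x)" using xy by (simp add: mult_le_cancel_right)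
      then show ?thesis by (simp add: algebra_simps)
    qed simp
  qed
  then have "(\<lambda>\<xi>. K1 * \<xi> - f \<xi>) \<in> borel_measurable borel" by (rule borel_measurable_mono)
  then have "(\<lambda>\<xi>. K1 * \<xi> - (K1 * \<xi> - f \<xi>)) \<in> borel_measurable borel" by measurable
  then show ?thesis by simp
qed

lemma f_bounded: "\<bar>x\<bar> \<le> R \<Longrightarrow> \<bar>f x\<bar> \<le> \<bar>K4\<bar> * R powr q + \<bar>K5\<bar>"
proof -
  assume "\<bar>x\<bar> \<le> R"
  then have "\<bar>x\<bar> powr q \<le> R powr q" using q by (intro powr_mono2) auto
  then have "K4 * \<bar>x\<bar> powr q \<le> \<bar>K4\<bar> * R powr q"
    by (intro order_trans[OF mult_right_mono[of K4 "\<bar>K4\<bar>"] mult_left_mono]) auto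
  then show ?thesis using f_growth[of x] by linarith
qed

lemma Fop_syn_bounded: "\<exists>B. \<forall>x. \<bar>Fop f (syn N c) x\<bar> \<le> B"
  unfolding Fop_def using f_bounded[OF syn_bound] by blast

lemma Fop_syn_measurable[measurable]: "Fop f (syn N c) \<in> borel_measurable borel"
  unfolding Fop_def by measurable

lemma integrable_Fop_e: "integrable unit_interval (\<lambda>\<xi>. Fop f (syn N c) \<xi> * e k \<xi>)"
proof -
  obtain B where B: "\<And>x. \<bar>Fop f (syn N c) x\<bar> \<le> B" using Fop_syn_bounded by blast
  show ?thesis
  proof (rule integrable_unit_bounded)
    show "(\<lambda>\<xi>. Fop f (syn N c) \<xi> * e k \<xi>) \<in> borel_measurable unit_interval"
      by (rule borel_imp_unit_measurable) measurable
    show "\<bar>Fop f (syn N c) x * e k x\<bar> \<le> B * sqrt 2" for x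
      unfolding abs_mult using B[of x] abs_e_le by (intro mult_mono) auto
  qed
qed

definition nl :: "(nat \<Rightarrow> real) \<Rightarrow> nat \<Rightarrow> real" where
  "nl c k = ip (Fop f (syn N c)) (e k)"

lemma ip_Fop_syn: "ip (Fop f (syn N c)) (syn N d) = (\<Sum>k = 1..N. d k * nl c k)"
  unfolding nl_def by (rule ip_sum_right[OF integrable_Fop_e])

lemma integrable_Fop_syn: "integrable unit_interval (\<lambda>\<xi>. Fop f (syn N c) \<xi> * syn N d \<xi>)"
proof -
  have eq: "(\<lambda>\<xi>. Fop f (syn N c) \<xi> * syn N d \<xi>) = (\<lambda>\<xi>. \<Sum>k = 1..N. d k * (Fop f (syn N c) \<xi> * e k \<xi>))"
    unfolding syn_def[of N d] by (simp only: sum_distrib_left) (simp add: mult_ac)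
  show ?thesis unfolding eq using integrable_Fop_e by (intro Bochner_Integration.integrable_sum integrable_mult_right)
qed

lemma PN_Fop: "PN N (Fop f (syn N c)) = syn N (nl c)"
  unfolding PN_eq[OF integrable_Fop_e] by (rule syn_cong) (simp add: coef_def nl_def)

text \<open>The left-hand side w - \<tau> Delta w - \<tau> P F(w) of the implicit equation in sine
  coordinates, where the Laplacian is diagonal.\<close>

definition step :: "(nat \<Rightarrow> real) \<Rightarrow> nat \<Rightarrow> real" where
  "step c k = (1 + \<tau> * (real k * pi)\<^sup>2) * c k - \<tau> * nl c k"

lemma step_of_scheme:
  assumes u: "u \<in> VN N" "v \<in> VN N" "z \<in> VN N"
    and eq: "v = (\<lambda>\<xi>. u \<xi> + \<tau> * DeltaN N v \<xi> + \<tau> * PN N (Fop f v) \<xi> + z \<xi>)" and k: "k \<in> {1..N}"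
  shows "step (coef N v) k = coef N u k + coef N z k"
proof -
  obtain a b c where a: "u = syn N a" and b: "v = syn N b" and c: "z = syn N c" using u unfolding VN_eq by auto
  have cb: "syn N (coef N v) = syn N b" using syn_coef[OF u(2)] b by simp
  have "syn N b = (\<lambda>\<xi>. syn N a \<xi> + \<tau> * syn N (\<lambda>k. - ((real k * pi)\<^sup>2 * b k)) \<xi> + \<tau> * syn N (nl b) \<xi> + syn N c \<xi>)"
    using eq unfolding a b c DeltaN_syn PN_Fop .
  also have "\<dots> = syn N (\<lambda>k. a k + \<tau> * (- ((real k * pi)\<^sup>2 * b k)) + \<tau> * nl b k + c k)"
    unfolding syn_def by (simp add: sum.distrib sum_distrib_left sum_subtractf algebra_simps sum_negf)
  finally have "ip (syn N b) (e k) = ip (syn N (\<lambda>k. a k + \<tau> * (- ((real k * pi)\<^sup>2 * b k)) + \<tau> * nl b k + c k)) (e k)" by simp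
  then have "b k = a k + \<tau> * (- ((real k * pi)\<^sup>2 * b k)) + \<tau> * nl b k + c k"
    unfolding ip_syn_e[OF k] .
  moreover have "nl (coef N v) = nl b" unfolding nl_def cb ..
  moreover have "coef N v k = b k" "coef N u k = a k" "coef N z k = c k"
    using k unfolding a b c coef_syn by auto
  ultimately show ?thesis unfolding step_def by (simp add: algebra_simps)
qed

definition mono_const :: real where "mono_const = 1 - (K1 - pi\<^sup>2) * \<tau>"

lemma mono_const_pos: "mono_const > 0" unfolding mono_const_def using \<tau> by simp

lemma eigenvalue_ge:
  assumes "k \<in> {1..N}" shows "pi\<^sup>2 \<le> (real k * pi)\<^sup>2"
  using assms by (intro power_mono) auto

text \<open>The nonlinear part is estimated by the one-sided Lipschitz condition, applied pointwise
  to two sine polynomials and integrated; the linear part contributes at least the lowest eigenvalue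
  pi^2 in every coordinate. What remains is \<open>mono_const\<close>, positive by the step size
  condition.\<close>

lemma step_mono:
  "mono_const * (\<Sum>k = 1..N. (c k - d k)\<^sup>2) \<le> (\<Sum>k = 1..N. (step c k - step d k) * (c k - d k))"
proof -
  let ?\<delta> = "\<lambda>k. c k - d k"
  have "(\<Sum>k = 1..N. ?\<delta> k * nl c k) - (\<Sum>k = 1..N. ?\<delta> k * nl d k)
    = (LINT \<xi>|unit_interval. Fop f (syn N c) \<xi> * syn N ?\<delta> \<xi>) - (LINT \<xi>|unit_interval. Fop f (syn N d) \<xi> * syn N ?\<delta> \<xi>)"
    using ip_Fop_syn[of c ?\<delta>] ip_Fop_syn[of d ?\<delta>] unfolding ip_def by simp
  also have "\<dots> = (LINT \<xi>|unit_interval. Fop f (syn N c) \<xi> * syn N ?\<delta> \<xi> - Fop f (syn N d) \<xi> * syn N ?\<delta> \<xi>)"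
    by (rule Bochner_Integration.integral_diff[symmetric]; rule integrable_Fop_syn)
  also have "\<dots> \<le> (LINT \<xi>|unit_interval. K1 * (syn N ?\<delta> \<xi> * syn N ?\<delta> \<xi>))"
  proof (rule integral_mono)
    show "integrable unit_interval (\<lambda>\<xi>. Fop f (syn N c) \<xi> * syn N ?\<delta> \<xi> - Fop f (syn N d) \<xi> * syn N ?\<delta> \<xi>)"
      by (intro Bochner_Integration.integrable_diff integrable_Fop_syn)
    show "integrable unit_interval (\<lambda>\<xi>. K1 * (syn N ?\<delta> \<xi> * syn N ?\<delta> \<xi>))"
      by (intro integrable_unit_continuous continuous_intros)
    fix \<xi>
    show "Fop f (syn N c) \<xi> * syn N ?\<delta> \<xi> - Fop f (syn N d) \<xi> * syn N ?\<delta> \<xi> \<le> K1 * (syn N ?\<delta> \<xi> * syn N ?\<delta> \<xi>)"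
      using f_one_sided[of "syn N c \<xi>" "syn N d \<xi>"] fun_cong[OF syn_diff[of N c d], of \<xi>]
      unfolding Fop_def by (simp add: power2_eq_square left_diff_distrib)
  qed
  also have "\<dots> = K1 * (\<Sum>k = 1..N. (?\<delta> k)\<^sup>2)"
    using ip_syn_syn[of N ?\<delta> ?\<delta>] unfolding ip_def by (simp add: power2_eq_square)
  finally have nlb: "(\<Sum>k = 1..N. ?\<delta> k * nl c k) - (\<Sum>k = 1..N. ?\<delta> k * nl d k) \<le> K1 * (\<Sum>k = 1..N. (?\<delta> k)\<^sup>2)" .
  have lin: "(1 + \<tau> * pi\<^sup>2) * (\<Sum>k = 1..N. (?\<delta> k)\<^sup>2) \<le> (\<Sum>k = 1..N. (1 + \<tau> * (real k * pi)\<^sup>2) * (?\<delta> k)\<^sup>2)"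
    unfolding sum_distrib_left using \<tau> eigenvalue_ge
    by (intro sum_mono mult_right_mono add_left_mono mult_left_mono) auto
  have "(\<Sum>k = 1..N. (step c k - step d k) * ?\<delta> k)
    = (\<Sum>k = 1..N. (1 + \<tau> * (real k * pi)\<^sup>2) * (?\<delta> k)\<^sup>2 - \<tau> * (?\<delta> k * nl c k - ?\<delta> k * nl d k))"
    unfolding step_def by (intro sum.cong refl) (simp add: power2_eq_square algebra_simps)
  also have "\<dots> = (\<Sum>k = 1..N. (1 + \<tau> * (real k * pi)\<^sup>2) * (?\<delta> k)\<^sup>2)
      - \<tau> * ((\<Sum>k = 1..N. ?\<delta> k * nl c k) - (\<Sum>k = 1..N. ?\<delta> k * nl d k))"
    by (simp add: sum_subtractf sum_distrib_left right_diff_distrib)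
  also have "\<dots> \<ge> (1 + \<tau> * pi\<^sup>2) * (\<Sum>k = 1..N. (?\<delta> k)\<^sup>2) - \<tau> * (K1 * (\<Sum>k = 1..N. (?\<delta> k)\<^sup>2))"
    using lin nlb \<tau> by (intro diff_mono mult_left_mono) auto
  finally show ?thesis unfolding mono_const_def by (simp add: algebra_simps)
qed

text \<open>Cauchy-Schwarz turns strong monotonicity into a Lipschitz bound in the Euclidean norm.
  The right-hand side is then weakened to a sum of absolute values, the form that
  \<open>lipschitz_extension\<close> takes.\<close>

lemma step_inverse_lipschitz:
  assumes i: "i \<in> {1..N}"
  shows "\<bar>c i - d i\<bar> \<le> (1 / mono_const) * (\<Sum>k = 1..N. \<bar>step c k - step d k\<bar>)"
proof -
  let ?x = "L2_set (\<lambda>k. c k - d k) {1..N}" and ?y = "L2_set (\<lambda>k. step c k - step d k) {1..N}"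
  have sq: "?x\<^sup>2 = (\<Sum>k = 1..N. (c k - d k)\<^sup>2)" unfolding L2_set_def by (simp add: sum_nonneg)
  have "(\<Sum>k = 1..N. (step c k - step d k) * (c k - d k)) \<le> (\<Sum>k = 1..N. \<bar>step c k - step d k\<bar> * \<bar>c k - d k\<bar>)"
    by (intro sum_mono) (simp add: abs_mult[symmetric])
  also have "\<dots> \<le> ?y * ?x" by (rule L2_set_mult_ineq)
  finally have "mono_const * ?x\<^sup>2 \<le> ?y * ?x" using step_mono[of c d] sq by simp
  then have "(mono_const * ?x) * ?x \<le> ?y * ?x" by (simp add: power2_eq_square)
  moreover have "0 \<le> ?x" "0 \<le> ?y" by (rule L2_set_nonneg)+
  ultimately have "mono_const * ?x \<le> ?y"
    by (cases "?x = 0") (auto simp del: L2_set_nonneg intro: mult_right_le_imp_le)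
  also have "?y \<le> (\<Sum>k = 1..N. \<bar>step c k - step d k\<bar>)" by (rule L2_set_le_sum_abs)
  finally have "?x \<le> (1 / mono_const) * (\<Sum>k = 1..N. \<bar>step c k - step d k\<bar>)"
    using mono_const_pos by (simp add: pos_le_divide_eq mult.commute)
  moreover have "\<bar>c i - d i\<bar> \<le> ?x"
    using member_le_L2_set[of "{1..N}" i "\<lambda>k. \<bar>c k - d k\<bar>"] i unfolding L2_set_def by simp
  ultimately show ?thesis by linarith
qed

text \<open>Each coordinate of the solution is a Lipschitz function of the data on the range of
  \<open>step\<close> and is extended separately. Off that range the values of \<open>r\<close>
  carry no information on the scheme, which is why later statements about it are almost sure
  ones.\<close>

lemma measurable_step_inverse:
  obtains r :: "(nat \<Rightarrow> real) \<Rightarrow> nat \<Rightarrow> real" where "r \<in> borel_measurable borel"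
    "\<And>y c i. (\<And>k. k \<in> {1..N} \<Longrightarrow> y k = step c k) \<Longrightarrow> i \<in> {1..N} \<Longrightarrow> r y i = c i"
proof -
  have "\<forall>i. \<exists>F :: (nat \<Rightarrow> real) \<Rightarrow> real. F \<in> borel_measurable borel \<and>
     (i \<in> {1..N} \<longrightarrow> (\<forall>y c. (\<forall>k \<in> {1..N}. y k = step c k) \<longrightarrow> F y = c i))"
  proof
    fix i
    show "\<exists>F :: (nat \<Rightarrow> real) \<Rightarrow> real. F \<in> borel_measurable borel \<and>
     (i \<in> {1..N} \<longrightarrow> (\<forall>y c. (\<forall>k \<in> {1..N}. y k = step c k) \<longrightarrow> F y = c i))"
    proof (cases "i \<in> {1..N}")
      case True
      show ?thesis
      proof (rule lipschitz_extension[of "1 / mono_const" "{1..N}" "\<lambda>c. c i" step])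
        show "c i \<le> d i + 1 / mono_const * (\<Sum>k = 1..N. \<bar>step c k - step d k\<bar>)" for c d
          using step_inverse_lipschitz[OF True, of c d] by linarith
        fix F assume "F \<in> borel_measurable borel" "\<And>y c. (\<And>k. k \<in> {1..N} \<Longrightarrow> y k = step c k) \<Longrightarrow> F y = c i"
        then show ?thesis by blast
      qed (use mono_const_pos in auto)
    next
      case False
      then show ?thesis by (intro exI[of _ "\<lambda>_. 0"]) auto
    qed
  qed
  then obtain F where F: "\<And>i. F i \<in> borel_measurable borel"
    "\<And>i y c. i \<in> {1..N} \<Longrightarrow> (\<forall>k \<in> {1..N}. y k = step c k) \<Longrightarrow> F i y = c i" by metis
  show thesis
  proof (rule that)
    show "(\<lambda>y i. F i y) \<in> borel_measurable borel"
      by (rule measurable_coordinatewise_then_product) (rule F(1))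
  qed (use F(2) in blast)
qed

text \<open>The equation is paired with its own solution: the Laplacian gains pi^2, the drift costs
  at most K2, and Young's inequality splits \<open>step c k * c k\<close> into halves of squares. As
  K2 < pi^2, the factor on the left exceeds 1; this is the source of the Lyapunov drift.\<close>

lemma step_coercive:
  "(2 * (1 + \<tau> * (pi\<^sup>2 - K2)) - 1) * (\<Sum>k = 1..N. (c k)\<^sup>2) \<le> (\<Sum>k = 1..N. (step c k)\<^sup>2) + 2 * \<tau> * K3"
proof -
  interpret u: prob_space unit_interval by (rule prob_space_unit_interval)
  have "(\<Sum>k = 1..N. c k * nl c k) = (LINT \<xi>|unit_interval. Fop f (syn N c) \<xi> * syn N c \<xi>)"
    using ip_Fop_syn[of c c] unfolding ip_def by simp
  also have "\<dots> \<le> (LINT \<xi>|unit_interval. K2 * (syn N c \<xi> * syn N c \<xi>) + K3)"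
  proof (rule integral_mono[OF integrable_Fop_syn])
    show "integrable unit_interval (\<lambda>\<xi>. K2 * (syn N c \<xi> * syn N c \<xi>) + K3)"
      by (intro integrable_unit_continuous continuous_intros)
    show "Fop f (syn N c) \<xi> * syn N c \<xi> \<le> K2 * (syn N c \<xi> * syn N c \<xi>) + K3" for \<xi>
      using f_coercive[of "syn N c \<xi>"] unfolding Fop_def by (simp add: power2_eq_square)
  qed
  also have "\<dots> = K2 * ip (syn N c) (syn N c) + K3"
  proof -
    have "integrable unit_interval (\<lambda>\<xi>. K2 * (syn N c \<xi> * syn N c \<xi>))"
      by (intro integrable_unit_continuous continuous_intros)
    from Bochner_Integration.integral_add[OF this, of "\<lambda>_. K3"] show ?thesis
      unfolding ip_def lebesgue_integral_const u.prob_space integral_mult_right_zero by simp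
  qed
  finally have nlb: "(\<Sum>k = 1..N. c k * nl c k) \<le> K2 * (\<Sum>k = 1..N. (c k)\<^sup>2) + K3"
    unfolding ip_syn_syn by (simp add: power2_eq_square)
  have lin: "(1 + \<tau> * pi\<^sup>2) * (\<Sum>k = 1..N. (c k)\<^sup>2) \<le> (\<Sum>k = 1..N. (1 + \<tau> * (real k * pi)\<^sup>2) * (c k)\<^sup>2)"
    unfolding sum_distrib_left using \<tau> eigenvalue_ge
    by (intro sum_mono mult_right_mono add_left_mono mult_left_mono) auto
  have "(1 + \<tau> * pi\<^sup>2) * (\<Sum>k = 1..N. (c k)\<^sup>2) - \<tau> * (K2 * (\<Sum>k = 1..N. (c k)\<^sup>2) + K3)
    \<le> (\<Sum>k = 1..N. (1 + \<tau> * (real k * pi)\<^sup>2) * (c k)\<^sup>2) - \<tau> * (\<Sum>k = 1..N. c k * nl c k)"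
    using lin nlb \<tau> by (intro diff_mono mult_left_mono) auto
  also have "\<dots> = (\<Sum>k = 1..N. step c k * c k)"
    unfolding step_def by (simp add: sum_subtractf sum_distrib_left power2_eq_square algebra_simps)
  also have "\<dots> \<le> (\<Sum>k = 1..N. ((step c k)\<^sup>2 + (c k)\<^sup>2) / 2)"
  proof (rule sum_mono)
    fix k
    show "step c k * c k \<le> ((step c k)\<^sup>2 + (c k)\<^sup>2) / 2" using sum_squares_bound[of "step c k" "c k"] by simp
  qed
  also have "\<dots> = ((\<Sum>k = 1..N. (step c k)\<^sup>2) + (\<Sum>k = 1..N. (c k)\<^sup>2)) / 2"
    by (simp add: sum_divide_distrib[symmetric] sum.distrib)
  finally show ?thesis by (simp add: field_simps)
qed

end

section \<open>Lipschitz test functions\<close>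

lemma nn_integral_affine_square_gauss:
  assumes \<sigma>: "\<sigma> > 0"
  shows "(\<integral>\<^sup>+ y. ennreal ((a + w * y)\<^sup>2) \<partial>gauss \<sigma>) = ennreal (a\<^sup>2 + w\<^sup>2 * \<sigma>\<^sup>2)"
proof -
  let ?n = "normal_density 0 \<sigma>"
  have h0: "has_bochner_integral lborel (\<lambda>x. ?n x) 1"
    using normal_moment_even[OF \<sigma>, of 0 0] by simp
  have h1: "has_bochner_integral lborel (\<lambda>x. ?n x * x) 0"
    using normal_moment_odd[OF \<sigma>, of 0 0] by simp
  have h2: "has_bochner_integral lborel (\<lambda>x. ?n x * x\<^sup>2) (\<sigma>\<^sup>2)"
    using normal_moment_even[OF \<sigma>, of 0 1] \<sigma> by (simp add: fact_numeral power2_eq_square)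
  have "has_bochner_integral lborel (\<lambda>x. a\<^sup>2 * ?n x + ((2 * a * w) * (?n x * x) + w\<^sup>2 * (?n x * x\<^sup>2)))
      (a\<^sup>2 * 1 + ((2 * a * w) * 0 + w\<^sup>2 * \<sigma>\<^sup>2))"
    by (intro has_bochner_integral_add has_bochner_integral_mult_right h0 h1 h2)
  moreover have "a\<^sup>2 * ?n x + ((2 * a * w) * (?n x * x) + w\<^sup>2 * (?n x * x\<^sup>2)) = ?n x * (a + w * x)\<^sup>2" for x
    by (simp add: power2_sum algebra_simps power_mult_distrib)
  ultimately have hb: "has_bochner_integral lborel (\<lambda>x. ?n x * (a + w * x)\<^sup>2) (a\<^sup>2 + w\<^sup>2 * \<sigma>\<^sup>2)" by simp
  have "(\<integral>\<^sup>+ x. ennreal (?n x * (a + w * x)\<^sup>2) \<partial>lborel) = ennreal (LINT x|lborel. ?n x * (a + w * x)\<^sup>2)"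
    using integrable.intros[OF hb] by (intro nn_integral_eq_integral) auto
  then have "(\<integral>\<^sup>+ x. ennreal (?n x * (a + w * x)\<^sup>2) \<partial>lborel) = ennreal (a\<^sup>2 + w\<^sup>2 * \<sigma>\<^sup>2)"
    unfolding has_bochner_integral_integral_eq[OF hb] .
  moreover have "(\<integral>\<^sup>+ y. ennreal ((a + w * y)\<^sup>2) \<partial>gauss \<sigma>) = (\<integral>\<^sup>+ x. ennreal (?n x) * ennreal ((a + w * x)\<^sup>2) \<partial>lborel)"
    unfolding gauss_def by (rule nn_integral_density) auto
  ultimately show ?thesis by (simp add: ennreal_mult')
qed

lemma measurable_linear_square_PiM:
  "(\<lambda>x. ennreal ((a + (\<Sum>k \<in> K. w k * x k))\<^sup>2)) \<in> borel_measurable (PiM J (\<lambda>_::nat. gauss \<sigma>))"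
proof (rule measurable_compose[OF measurable_PiM_gauss_borel])
  have [measurable]: "(\<lambda>x::nat \<Rightarrow> real. x k) \<in> borel_measurable borel" for k by (rule measurable_coordinate)
  show "(\<lambda>x. ennreal ((a + (\<Sum>k \<in> K. w k * x k))\<^sup>2)) \<in> borel_measurable borel" by measurable
qed

text \<open>One coordinate is integrated at a time: the mean 0 removes the cross term and the
  variance is added to the square.\<close>

lemma nn_integral_linear_square_PiM:
  assumes \<sigma>: "\<sigma> > 0" and J: "finite (J :: nat set)"
  shows "(\<integral>\<^sup>+ x. ennreal ((a + (\<Sum>k \<in> J. w k * x k))\<^sup>2) \<partial>PiM J (\<lambda>_. gauss \<sigma>)) = ennreal (a\<^sup>2 + \<sigma>\<^sup>2 * (\<Sum>k \<in> J. (w k)\<^sup>2))"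
  using J
proof (induction J arbitrary: a rule: finite_induct)
  case empty
  then show ?case by (simp add: PiM_empty nn_integral_count_space_finite)
next
  case (insert j J)
  interpret g: prob_space "gauss \<sigma>" by (rule prob_space_gauss[OF \<sigma>])
  interpret product_sigma_finite "\<lambda>_::nat. gauss \<sigma>" by standard
  have m: "(\<lambda>x. ennreal ((a + (\<Sum>k \<in> insert j J. w k * x k))\<^sup>2)) \<in> borel_measurable (PiM (insert j J) (\<lambda>_. gauss \<sigma>))"
    by (rule measurable_linear_square_PiM)
  have "(\<integral>\<^sup>+ x. ennreal ((a + (\<Sum>k \<in> insert j J. w k * x k))\<^sup>2) \<partial>PiM (insert j J) (\<lambda>_. gauss \<sigma>))
    = (\<integral>\<^sup>+ x. \<integral>\<^sup>+ y. ennreal ((a + (\<Sum>k \<in> insert j J. w k * (x(j := y)) k))\<^sup>2) \<partial>gauss \<sigma> \<partial>PiM J (\<lambda>_. gauss \<sigma>))"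
    by (rule product_nn_integral_insert[OF insert.hyps m])
  also have "\<dots> = (\<integral>\<^sup>+ x. \<integral>\<^sup>+ y. ennreal (((a + (\<Sum>k \<in> J. w k * x k)) + w j * y)\<^sup>2) \<partial>gauss \<sigma> \<partial>PiM J (\<lambda>_. gauss \<sigma>))"
  proof (intro nn_integral_cong arg_cong[of _ _ "\<lambda>t. ennreal (t\<^sup>2)"])
    fix x :: "nat \<Rightarrow> real" and y
    have "(\<Sum>k \<in> J. w k * (x(j := y)) k) = (\<Sum>k \<in> J. w k * x k)"
      using insert.hyps by (intro sum.cong) auto
    then show "a + (\<Sum>k \<in> insert j J. w k * (x(j := y)) k) = a + (\<Sum>k \<in> J. w k * x k) + w j * y"
      using insert.hyps by simp
  qed
  also have "\<dots> = (\<integral>\<^sup>+ x. ennreal ((a + (\<Sum>k \<in> J. w k * x k))\<^sup>2) + ennreal ((w j)\<^sup>2 * \<sigma>\<^sup>2) \<partial>PiM J (\<lambda>_. gauss \<sigma>))"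
    unfolding nn_integral_affine_square_gauss[OF \<sigma>] by (intro nn_integral_cong) simp
  also have "\<dots> = (\<integral>\<^sup>+ x. ennreal ((a + (\<Sum>k \<in> J. w k * x k))\<^sup>2) \<partial>PiM J (\<lambda>_. gauss \<sigma>))
      + (\<integral>\<^sup>+ x. ennreal ((w j)\<^sup>2 * \<sigma>\<^sup>2) \<partial>PiM J (\<lambda>_. gauss \<sigma>))"
    by (rule nn_integral_add[OF measurable_linear_square_PiM]) simp
  also have "(\<integral>\<^sup>+ x. ennreal ((w j)\<^sup>2 * \<sigma>\<^sup>2) \<partial>PiM J (\<lambda>_. gauss \<sigma>)) = ennreal ((w j)\<^sup>2 * \<sigma>\<^sup>2)"
  proof -
    interpret P: prob_space "PiM J (\<lambda>_. gauss \<sigma>)" by (intro prob_space_PiM prob_space_gauss[OF \<sigma>])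
    show ?thesis by (simp only: nn_integral_const P.emeasure_space_1 mult_1_right)
  qed
  finally show ?case unfolding insert.IH using insert.hyps
    by (simp add: ennreal_plus[symmetric] sum_nonneg algebra_simps del: ennreal_plus)
qed

lemma nn_integral_linear_square_white:
  assumes \<sigma>: "\<sigma> > 0"
  shows "(\<integral>\<^sup>+ x. ennreal ((a + (\<Sum>k<m. w k * x k))\<^sup>2) \<partial>white \<sigma>) = ennreal (a\<^sup>2 + \<sigma>\<^sup>2 * (\<Sum>k<m. (w k)\<^sup>2))"
proof -
  have coord: "(\<lambda>x::nat \<Rightarrow> real. x k) \<in> borel_measurable borel" for k
    by (rule measurable_coordinate)
  have "(\<integral>\<^sup>+ x. ennreal ((a + (\<Sum>k<m. w k * x k))\<^sup>2) \<partial>white \<sigma>)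
    = (\<integral>\<^sup>+ x. ennreal ((a + (\<Sum>k<m. w k * x k))\<^sup>2) \<partial>PiM {..<m} (\<lambda>_. gauss \<sigma>))"
  proof (rule nn_integral_white_finite[OF \<sigma>])
    show "(\<lambda>x. ennreal ((a + (\<Sum>k<m. w k * x k))\<^sup>2)) \<in> borel_measurable borel" using coord by measurable
  qed auto
  then show ?thesis using nn_integral_linear_square_PiM[OF \<sigma>, of "{..<m}"] by simp
qed

text \<open>The metric on sequences sums truncated coordinate distances with weights (1/2)^n, of
  total weight 2. If only the coordinates 1 to \<open>N\<close> differ, each distance is below their
  sum, so coordinatewise estimates reach Lipschitz functions.\<close>

lemma dist_seq_le:
  fixes u w :: "nat \<Rightarrow> real"
  assumes "\<And>i. i \<notin> {1..N} \<Longrightarrow> u i = w i"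
  shows "dist u w \<le> 2 * (\<Sum>i = 1..N. \<bar>u i - w i\<bar>)"
proof -
  let ?S = "\<Sum>i = 1..N. \<bar>u i - w i\<bar>"
  have c: "\<bar>u i - w i\<bar> \<le> ?S" for i
  proof (cases "i \<in> {1..N}")
    case True
    then show ?thesis by (intro member_le_sum[where f = "\<lambda>i. \<bar>u i - w i\<bar>"]) auto
  qed (use assms in \<open>auto intro: sum_nonneg\<close>)
  have "dist u w = (\<Sum>n. (1/2)^n * min (dist (u (from_nat n)) (w (from_nat n))) 1)"
    by (rule dist_fun_def)
  also have "\<dots> \<le> (\<Sum>n. (1/2)^n * ?S)"
  proof (rule suminf_le)
    show "(1/2)^n * min (dist (u (from_nat n)) (w (from_nat n))) 1 \<le> (1/2)^n * ?S" for n
      using c[of "from_nat n"] by (intro mult_left_mono) (auto simp: dist_real_def)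
    show "summable (\<lambda>n. (1/2)^n * min (dist (u (from_nat n)) (w (from_nat n))) 1)"
      by (rule summable_comparison_test'[of "\<lambda>n. (1/2)^n"]) (auto simp: summable_geometric_iff)
    show "summable (\<lambda>n. (1/2)^n * ?S)" by (intro summable_mult2) (simp add: summable_geometric_iff)
  qed
  also have "\<dots> = 2 * ?S"
    using suminf_mult2[of "\<lambda>n. (1/2::real)^n" ?S] suminf_geometric[of "1/2::real"] by (simp add: summable_geometric_iff)
  finally show ?thesis .
qed

text \<open>Serves to keep the class of test functions stable under translations of the
  argument.\<close>

lemma dist_seq_translate:
  fixes u w y :: "nat \<Rightarrow> real"
  shows "dist (\<lambda>i. u i + y i) (\<lambda>i. w i + y i) = dist u w"
  unfolding dist_fun_def by (simp add: dist_real_def)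

text \<open>The class meets two demands: expectations of its members converge along truncations that
  converge in mean square, and it contains the \<open>cutoff\<close> functions, which determine a
  finite Borel measure.\<close>

definition test_fun :: "real \<Rightarrow> ('b::metric_space \<Rightarrow> real) \<Rightarrow> bool" where
  "test_fun L \<phi> \<longleftrightarrow> 0 \<le> L \<and> (\<forall>u. 0 \<le> \<phi> u \<and> \<phi> u \<le> 1) \<and> (\<forall>u w. \<bar>\<phi> u - \<phi> w\<bar> \<le> L * dist u w)"

lemma test_funD:
  assumes "test_fun L \<phi>"
  shows "0 \<le> L" "0 \<le> \<phi> u" "\<phi> u \<le> 1" "\<bar>\<phi> u - \<phi> w\<bar> \<le> L * dist u w"
  using assms unfolding test_fun_def by auto

lemma test_fun_measurable:
  assumes "test_fun L \<phi>"
  shows "\<phi> \<in> borel_measurable borel"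
proof (rule borel_measurable_continuous_onI)
  have "L-lipschitz_on UNIV \<phi>"
    using assms by (intro lipschitz_onI) (auto simp: test_fun_def dist_real_def)
  then show "continuous_on UNIV \<phi>" by (rule lipschitz_on_continuous_on)
qed

text \<open>Lipschitz functions that decrease to the indicator of a closed set. For empty
  \<open>C\<close> the infimum distance is 0 by convention and the function is constantly 1, whence
  the condition \<open>C \<noteq> {}\<close> in the lemmas below.\<close>

definition cutoff :: "'b::metric_space set \<Rightarrow> nat \<Rightarrow> 'b \<Rightarrow> real" where
  "cutoff C n u = max 0 (1 - real n * infdist u C)"

lemma test_fun_cutoff: "test_fun (real n) (cutoff C n)"
  unfolding test_fun_def
proof (intro conjI allI)
  fix u w
  have "\<bar>cutoff C n u - cutoff C n w\<bar> \<le> real n * \<bar>infdist u C - infdist w C\<bar>"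
    unfolding cutoff_def by (simp add: abs_mult[symmetric, of "real n", simplified] right_diff_distrib)
  also have "\<dots> \<le> real n * dist u w"
    by (intro mult_left_mono infdist_triangle_abs) auto
  finally show "\<bar>cutoff C n u - cutoff C n w\<bar> \<le> real n * dist u w" .
qed (auto simp: cutoff_def infdist_nonneg)

lemma cutoff_tendsto:
  assumes C: "closed C" "C \<noteq> {}"
  shows "(\<lambda>n. cutoff C n u) \<longlonglongrightarrow> indicator C u"
proof (cases "u \<in> C")
  case True
  then show ?thesis by (simp add: cutoff_def)
next
  case False
  then have pos: "infdist u C > 0" using C infdist_pos_not_in_closed by blast
  obtain n0 :: nat where "1 / infdist u C < real n0" using reals_Archimedean2 by blast
  then have n0: "1 < real n0 * infdist u C" using pos by (simp add: divide_less_eq)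
  have "cutoff C n u = 0" if "n \<ge> n0" for n
  proof -
    have "real n0 * infdist u C \<le> real n * infdist u C" using that pos by (intro mult_right_mono) auto
    then show ?thesis using n0 unfolding cutoff_def by simp
  qed
  then have "\<forall>\<^sub>F n in sequentially. cutoff C n u = 0" by (auto simp: eventually_at_top_linorder)
  then show ?thesis using False by (simp add: tendsto_eventually)
qed

lemma integral_cutoff_tendsto:
  fixes \<mu> :: "'b::metric_space measure"
  assumes \<mu>: "finite_measure \<mu>" "sets \<mu> = sets borel" and C: "closed C" "C \<noteq> {}"
  shows "(\<lambda>n. LINT u|\<mu>. cutoff C n u) \<longlonglongrightarrow> measure \<mu> C"
proof -
  interpret finite_measure \<mu> by fact
  have sp: "space \<mu> = UNIV" using sets_eq_imp_space_eq[OF \<mu>(2)] by simp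
  have Cs: "C \<in> sets \<mu>" using C \<mu>(2) by simp
  have "(\<lambda>n. LINT u|\<mu>. cutoff C n u) \<longlonglongrightarrow> (LINT u|\<mu>. indicator C u)"
  proof (rule integral_dominated_convergence[where w = "\<lambda>_. 1"])
    show "cutoff C n \<in> borel_measurable \<mu>" for n
      using test_fun_measurable[OF test_fun_cutoff] unfolding measurable_cong_sets[OF \<mu>(2) refl] .
    show "AE u in \<mu>. (\<lambda>n. cutoff C n u) \<longlonglongrightarrow> indicator C u" using cutoff_tendsto[OF C] by simp
    show "AE u in \<mu>. norm (cutoff C n u) \<le> 1" for n using test_funD(2,3)[OF test_fun_cutoff, of C n] by simp
  qed (use Cs in auto)
  then show ?thesis using Cs sp by simp
qed

text \<open>Closed sets form an intersection-stable generator, and their measures are limits of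
  integrals of \<open>cutoff\<close> functions.\<close>

lemma measure_eqI_test_fun:
  fixes \<mu> \<nu> :: "'b::metric_space measure"
  assumes \<mu>: "finite_measure \<mu>" "sets \<mu> = sets borel" and \<nu>: "finite_measure \<nu>" "sets \<nu> = sets borel"
    and eq: "\<And>L \<phi>. test_fun L \<phi> \<Longrightarrow> (LINT u|\<mu>. \<phi> u) = (LINT u|\<nu>. \<phi> u)"
  shows "\<mu> = \<nu>"
proof (rule measure_eqI_generator_eq[where E = "Collect closed" and \<Omega> = UNIV and A = "\<lambda>_. UNIV"])
  interpret \<mu>: finite_measure \<mu> by fact
  interpret \<nu>: finite_measure \<nu> by fact
  show "Int_stable (Collect closed :: 'b set set)" by (auto intro!: Int_stableI)
  show "sets \<mu> = sigma_sets UNIV (Collect closed)" "sets \<nu> = sigma_sets UNIV (Collect closed)"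
    using \<mu> \<nu> by (simp_all add: borel_eq_closed)
  fix C :: "'b set" assume "C \<in> Collect closed"
  then have C: "closed C" by simp
  have "measure \<mu> C = measure \<nu> C"
  proof (cases "C = {}")
    case False
    show ?thesis
      using integral_cutoff_tendsto[OF \<mu> C False] integral_cutoff_tendsto[OF \<nu> C False] eq[OF test_fun_cutoff]
      by (simp add: LIMSEQ_unique)
  qed simp
  then show "emeasure \<mu> C = emeasure \<nu> C" by (simp add: \<mu>.emeasure_eq_measure \<nu>.emeasure_eq_measure)
qed (use \<mu> in \<open>auto simp: finite_measure.emeasure_finite\<close>)

lemma ennreal_tendsto_zero_of_square:
  fixes x :: "nat \<Rightarrow> ennreal"
  assumes "(\<lambda>n. (x n)\<^sup>2) \<longlonglongrightarrow> 0"
  shows "x \<longlonglongrightarrow> 0"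
proof (rule order_tendstoI)
  fix a :: ennreal assume a: "0 < a"
  then have "0 < a\<^sup>2" by (simp add: power2_eq_square ennreal_zero_less_mult_iff)
  from order_tendstoD(2)[OF assms this] show "\<forall>\<^sub>F n in sequentially. x n < a"
  proof eventually_elim
    case (elim n)
    show ?case
    proof (rule ccontr)
      assume "\<not> x n < a"
      then have "a\<^sup>2 \<le> (x n)\<^sup>2" unfolding power2_eq_square by (intro mult_mono) auto
      then show False using elim by simp
    qed
  qed
qed simp

text \<open>On a probability space Cauchy-Schwarz turns mean square convergence of each coordinate
  into convergence in L1, and a Lipschitz function passes it on. The weight \<open>w\<close> will be
  the indicator of an event of the past, which yields statements about conditional laws.\<close>

lemma tendsto_expectation_test_fun:
  fixes U :: "'a \<Rightarrow> nat \<Rightarrow> real" and Vn :: "nat \<Rightarrow> 'a \<Rightarrow> nat \<Rightarrow> real"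
  assumes M: "prob_space M" and Um[measurable]: "U \<in> M \<rightarrow>\<^sub>M borel" "\<And>n. Vn n \<in> M \<rightarrow>\<^sub>M borel"
    and out: "\<And>n \<omega> i. \<omega> \<in> space M \<Longrightarrow> i \<notin> {1..N} \<Longrightarrow> Vn n \<omega> i = U \<omega> i"
    and lim: "\<And>i. i \<in> {1..N} \<Longrightarrow> (\<lambda>n. \<integral>\<^sup>+ \<omega>. ennreal ((Vn n \<omega> i - U \<omega> i)\<^sup>2) \<partial>M) \<longlonglongrightarrow> 0"
    and \<phi>: "test_fun L \<phi>" and w[measurable]: "w \<in> borel_measurable M" and w1: "\<And>\<omega>. \<bar>w \<omega>\<bar> \<le> 1"
  shows "(\<lambda>n. LINT \<omega>|M. w \<omega> * \<phi> (Vn n \<omega>)) \<longlonglongrightarrow> (LINT \<omega>|M. w \<omega> * \<phi> (U \<omega>))"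
proof -
  interpret prob_space M by fact
  have [measurable]: "\<phi> \<in> borel_measurable borel" by (rule test_fun_measurable[OF \<phi>])
  have coord: "(\<lambda>\<omega>. f \<omega> i) \<in> borel_measurable M" if "f \<in> M \<rightarrow>\<^sub>M borel" for f :: "'a \<Rightarrow> nat \<Rightarrow> real" and i
    by (rule measurable_compose[OF that measurable_coordinate])
  note [measurable] = coord[OF Um(1)] coord[OF Um(2)]
  have \<phi>w: "\<bar>w \<omega> * \<phi> u\<bar> \<le> 1" for \<omega> u
    using w1[of \<omega>] test_funD(2,3)[OF \<phi>, of u] unfolding abs_mult by (intro mult_le_one) auto
  have int: "integrable M (\<lambda>\<omega>. w \<omega> * \<phi> (f \<omega>))" if [measurable]: "f \<in> M \<rightarrow>\<^sub>M borel" for f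
    by (rule integrable_const_bound[where B = 1]) (use \<phi>w in auto)
  define d where "d i n = (\<integral>\<^sup>+ \<omega>. ennreal \<bar>Vn n \<omega> i - U \<omega> i\<bar> \<partial>M)" for i n
  have d0: "d i \<longlonglongrightarrow> 0" if i: "i \<in> {1..N}" for i
  proof (rule ennreal_tendsto_zero_of_square, rule tendsto_sandwich[OF _ _ tendsto_const lim[OF i]])
    show "\<forall>\<^sub>F n in sequentially. (d i n)\<^sup>2 \<le> (\<integral>\<^sup>+ \<omega>. ennreal ((Vn n \<omega> i - U \<omega> i)\<^sup>2) \<partial>M)"
    proof (rule always_eventually, rule allI)
      fix n
      have "(\<integral>\<^sup>+ \<omega>. ennreal \<bar>Vn n \<omega> i - U \<omega> i\<bar> * 1 \<partial>M)\<^sup>2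
        \<le> (\<integral>\<^sup>+ \<omega>. (ennreal \<bar>Vn n \<omega> i - U \<omega> i\<bar>)\<^sup>2 \<partial>M) * (\<integral>\<^sup>+ \<omega>. 1\<^sup>2 \<partial>M)"
        by (rule Cauchy_Schwarz_nn_integral) auto
      then show "(d i n)\<^sup>2 \<le> (\<integral>\<^sup>+ \<omega>. ennreal ((Vn n \<omega> i - U \<omega> i)\<^sup>2) \<partial>M)"
        unfolding d_def by (simp add: emeasure_space_1 ennreal_power)
    qed
  qed simp
  have L: "0 \<le> L" by (rule test_funD(1)[OF \<phi>])
  have bound: "ennreal \<bar>(LINT \<omega>|M. w \<omega> * \<phi> (Vn n \<omega>)) - (LINT \<omega>|M. w \<omega> * \<phi> (U \<omega>))\<bar> \<le> ennreal (2 * L) * (\<Sum>i = 1..N. d i n)" for n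
  proof -
    have "\<bar>(LINT \<omega>|M. w \<omega> * \<phi> (Vn n \<omega>)) - (LINT \<omega>|M. w \<omega> * \<phi> (U \<omega>))\<bar>
      = \<bar>LINT \<omega>|M. w \<omega> * \<phi> (Vn n \<omega>) - w \<omega> * \<phi> (U \<omega>)\<bar>"
      using Bochner_Integration.integral_diff[OF int[OF Um(2)] int[OF Um(1)]] by simp
    also have "\<dots> \<le> (LINT \<omega>|M. \<bar>w \<omega> * \<phi> (Vn n \<omega>) - w \<omega> * \<phi> (U \<omega>)\<bar>)" by (rule integral_abs_bound)
    finally have "ennreal \<bar>(LINT \<omega>|M. w \<omega> * \<phi> (Vn n \<omega>)) - (LINT \<omega>|M. w \<omega> * \<phi> (U \<omega>))\<bar>
      \<le> ennreal (LINT \<omega>|M. \<bar>w \<omega> * \<phi> (Vn n \<omega>) - w \<omega> * \<phi> (U \<omega>)\<bar>)" by (rule ennreal_leI)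
    also have "\<dots> = (\<integral>\<^sup>+ \<omega>. ennreal \<bar>w \<omega> * \<phi> (Vn n \<omega>) - w \<omega> * \<phi> (U \<omega>)\<bar> \<partial>M)"
      using int[OF Um(2)] int[OF Um(1)] by (intro nn_integral_eq_integral[symmetric]) auto
    also have "\<dots> \<le> (\<integral>\<^sup>+ \<omega>. ennreal (2 * L) * (\<Sum>i = 1..N. ennreal \<bar>Vn n \<omega> i - U \<omega> i\<bar>) \<partial>M)"
    proof (rule nn_integral_mono)
      fix \<omega> assume \<omega>: "\<omega> \<in> space M"
      have "\<bar>w \<omega> * \<phi> (Vn n \<omega>) - w \<omega> * \<phi> (U \<omega>)\<bar> = \<bar>w \<omega>\<bar> * \<bar>\<phi> (Vn n \<omega>) - \<phi> (U \<omega>)\<bar>"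
        by (simp add: abs_mult[symmetric] right_diff_distrib)
      also have "\<dots> \<le> 1 * (L * dist (Vn n \<omega>) (U \<omega>))"
        using w1 test_funD(4)[OF \<phi>] by (intro mult_mono) auto
      also have "\<dots> \<le> L * (2 * (\<Sum>i = 1..N. \<bar>Vn n \<omega> i - U \<omega> i\<bar>))"
        using dist_seq_le[of N "Vn n \<omega>" "U \<omega>"] out[OF \<omega>] L by (simp add: mult_left_mono)
      finally have "ennreal \<bar>w \<omega> * \<phi> (Vn n \<omega>) - w \<omega> * \<phi> (U \<omega>)\<bar> \<le> ennreal ((2 * L) * (\<Sum>i = 1..N. \<bar>Vn n \<omega> i - U \<omega> i\<bar>))"
        by (intro ennreal_leI) (simp add: mult_ac)
      then show "ennreal \<bar>w \<omega> * \<phi> (Vn n \<omega>) - w \<omega> * \<phi> (U \<omega>)\<bar> \<le> ennreal (2 * L) * (\<Sum>i = 1..N. ennreal \<bar>Vn n \<omega> i - U \<omega> i\<bar>)"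
        using L by (simp add: ennreal_mult' sum_nonneg)
    qed
    also have "\<dots> = ennreal (2 * L) * (\<integral>\<^sup>+ \<omega>. (\<Sum>i = 1..N. ennreal \<bar>Vn n \<omega> i - U \<omega> i\<bar>) \<partial>M)"
      by (rule nn_integral_cmult) measurable
    also have "(\<integral>\<^sup>+ \<omega>. (\<Sum>i = 1..N. ennreal \<bar>Vn n \<omega> i - U \<omega> i\<bar>) \<partial>M) = (\<Sum>i = 1..N. d i n)"
      unfolding d_def by (rule nn_integral_sum) measurable
    finally show ?thesis .
  qed
  have "(\<lambda>n. \<Sum>i = 1..N. d i n) \<longlonglongrightarrow> (\<Sum>i = 1..N. 0)"
    by (rule tendsto_sum) (rule d0)
  then have "(\<lambda>n. \<Sum>i = 1..N. d i n) \<longlonglongrightarrow> 0" by simp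
  from ennreal_tendsto_cmult[OF _ this, of "ennreal (2 * L)"]
  have up: "(\<lambda>n. ennreal (2 * L) * (\<Sum>i = 1..N. d i n)) \<longlonglongrightarrow> ennreal 0" by simp
  have "(\<lambda>n. ennreal \<bar>(LINT \<omega>|M. w \<omega> * \<phi> (Vn n \<omega>)) - (LINT \<omega>|M. w \<omega> * \<phi> (U \<omega>))\<bar>) \<longlonglongrightarrow> ennreal 0"
  proof (rule tendsto_sandwich[OF _ _ tendsto_const up])
    show "\<forall>\<^sub>F n in sequentially. ennreal 0 \<le> ennreal \<bar>(LINT \<omega>|M. w \<omega> * \<phi> (Vn n \<omega>)) - (LINT \<omega>|M. w \<omega> * \<phi> (U \<omega>))\<bar>"
      by simp
  qed (rule always_eventually[OF allI[OF bound]])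
  then have "(\<lambda>n. \<bar>(LINT \<omega>|M. w \<omega> * \<phi> (Vn n \<omega>)) - (LINT \<omega>|M. w \<omega> * \<phi> (U \<omega>))\<bar>) \<longlonglongrightarrow> 0"
    by (rule tendsto_ennrealD) auto
  then have "(\<lambda>n. (LINT \<omega>|M. w \<omega> * \<phi> (Vn n \<omega>)) - (LINT \<omega>|M. w \<omega> * \<phi> (U \<omega>))) \<longlonglongrightarrow> 0"
    by (rule tendsto_rabs_zero_cancel)
  then show ?thesis by (rule LIM_zero_cancel)
qed

section \<open>Gaussian kernels\<close>

text \<open>The starting point plus the first \<open>m\<close> terms of the noise series, with
  \<open>s\<close> in the place of the increments. Here \<open>v c k i\<close> stands for the
  coordinate \<open>i\<close> of the image of the basis vector \<open>k\<close> under the noise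
  coefficient at the state \<open>c\<close>. Coordinates outside 1 to \<open>N\<close> are 0, in
  line with \<open>coef\<close>.\<close>

definition gauss_shift ::
  "nat \<Rightarrow> ((nat \<Rightarrow> real) \<Rightarrow> nat \<Rightarrow> nat \<Rightarrow> real) \<Rightarrow> nat \<Rightarrow> (nat \<Rightarrow> real) \<Rightarrow> (nat \<Rightarrow> real) \<Rightarrow> nat \<Rightarrow> real" where
  "gauss_shift N v m c s = (\<lambda>i. if i \<in> {1..N} then c i + (\<Sum>k<m. v c k i * s k) else 0)"

definition sqn :: "nat \<Rightarrow> (nat \<Rightarrow> real) \<Rightarrow> real" where
  "sqn N c = (\<Sum>i = 1..N. (c i)\<^sup>2)"

lemma sqn_nonneg[simp]: "0 \<le> sqn N c" unfolding sqn_def by (simp add: sum_nonneg)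

lemma sqn_measurable[measurable]: "sqn N \<in> borel_measurable borel"
proof -
  have [measurable]: "(\<lambda>c::nat \<Rightarrow> real. c i) \<in> borel_measurable borel" for i by (rule measurable_coordinate)
  show ?thesis unfolding sqn_def by measurable
qed

text \<open>The law \<open>\<kappa> c\<close> of the perturbed state is accessible through
  \<open>\<kappa>_lim\<close>, as a weak limit of truncated series in white noise; measurability in
  \<open>c\<close> and the translation estimate are both derived from the truncations.\<close>

locale gaussian_kernel =
  fixes N :: nat and \<sigma> :: real and v :: "(nat \<Rightarrow> real) \<Rightarrow> nat \<Rightarrow> nat \<Rightarrow> real"
    and \<kappa> :: "(nat \<Rightarrow> real) \<Rightarrow> (nat \<Rightarrow> real) measure"
  assumes \<sigma>: "\<sigma> > 0"
    and v_measurable: "\<And>k i. (\<lambda>c. v c k i) \<in> borel_measurable borel"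
    and prob_\<kappa>: "\<And>c. prob_space (\<kappa> c)" and sets_\<kappa>: "\<And>c. sets (\<kappa> c) = sets borel"
    and \<kappa>_supp: "\<And>c. AE u in \<kappa> c. \<forall>i. i \<notin> {1..N} \<longrightarrow> u i = 0"
    and \<kappa>_lim: "\<And>L \<phi> c. test_fun L \<phi> \<Longrightarrow>
      (\<lambda>m. LINT s|white \<sigma>. \<phi> (gauss_shift N v m c s)) \<longlonglongrightarrow> (LINT u|\<kappa> c. \<phi> u)"
begin

lemma space_\<kappa>: "space (\<kappa> c) = UNIV"
  using sets_eq_imp_space_eq[OF sets_\<kappa>] by simp

lemma measurable_gauss_shift:
  "(\<lambda>z. gauss_shift N v m (fst z) (snd z)) \<in> borel \<Otimes>\<^sub>M borel \<rightarrow>\<^sub>M borel"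
proof (rule measurable_coordinatewise_then_product)
  fix i
  have [measurable]: "(\<lambda>c. v c k i) \<in> borel_measurable borel" for k by (rule v_measurable)
  have [measurable]: "(\<lambda>c::nat \<Rightarrow> real. c k) \<in> borel_measurable borel" for k by (rule measurable_coordinate)
  show "(\<lambda>z. gauss_shift N v m (fst z) (snd z) i) \<in> borel_measurable (borel \<Otimes>\<^sub>M borel)"
    unfolding gauss_shift_def by measurable
qed

lemma measurable_gauss_shift2: "gauss_shift N v m c \<in> borel \<rightarrow>\<^sub>M borel"
proof -
  have "(\<lambda>s. (c, s)) \<in> borel \<rightarrow>\<^sub>M (borel :: (nat \<Rightarrow> real) measure) \<Otimes>\<^sub>M (borel :: (nat \<Rightarrow> real) measure)" by simp
  from measurable_compose[OF this measurable_gauss_shift[of m]] show ?thesis by simp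
qed

lemma measurable_integral_test_fun:
  assumes \<phi>: "test_fun L \<phi>"
  shows "(\<lambda>c. LINT u|\<kappa> c. \<phi> u) \<in> borel_measurable borel"
proof (rule borel_measurable_LIMSEQ_metric[OF _ \<kappa>_lim[OF \<phi>]])
  interpret w: prob_space "white \<sigma>" by (rule prob_space_white[OF \<sigma>])
  fix m
  have "(\<lambda>z. \<phi> (gauss_shift N v m (fst z) (snd z))) \<in> borel_measurable (borel \<Otimes>\<^sub>M white \<sigma>)"
    using measurable_compose[OF measurable_gauss_shift test_fun_measurable[OF \<phi>]]
    by (subst measurable_cong_sets[OF sets_pair_measure_cong[OF refl sets_white] refl])
  then show "(\<lambda>c. LINT s|white \<sigma>. \<phi> (gauss_shift N v m c s)) \<in> borel_measurable borel"
    by (intro w.borel_measurable_lebesgue_integral) (simp add: split_beta')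
qed

text \<open>Integrals of test functions are pointwise limits of parameter integrals over white
  noise, hence measurable in \<open>c\<close>. The \<open>cutoff\<close> functions transfer this to
  closed sets, which generate the Borel sets.\<close>

lemma measurable_\<kappa>: "\<kappa> \<in> borel \<rightarrow>\<^sub>M prob_algebra borel"
proof (rule measurable_prob_algebra_generated[where \<Omega> = UNIV and G = "Collect closed"])
  show "sets borel = sigma_sets UNIV (Collect (closed :: (nat \<Rightarrow> real) set \<Rightarrow> bool))"
    by (simp add: borel_eq_closed)
  show "Int_stable (Collect (closed :: (nat \<Rightarrow> real) set \<Rightarrow> bool))" by (auto intro!: Int_stableI)
  fix C :: "(nat \<Rightarrow> real) set" assume "C \<in> Collect closed"
  then have C: "closed C" by simp
  have "(\<lambda>c. measure (\<kappa> c) C) \<in> borel_measurable borel"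
  proof (cases "C = {}")
    case False
    show ?thesis
      by (rule borel_measurable_LIMSEQ_metric[OF measurable_integral_test_fun[OF test_fun_cutoff]
            integral_cutoff_tendsto[OF prob_space.finite_measure[OF prob_\<kappa>] sets_\<kappa> C False]])
  qed simp
  moreover have "emeasure (\<kappa> c) C = ennreal (measure (\<kappa> c) C)" for c
    by (rule finite_measure.emeasure_eq_measure[OF prob_space.finite_measure[OF prob_\<kappa>]])
  ultimately show "(\<lambda>c. emeasure (\<kappa> c) C) \<in> borel_measurable borel" by simp
qed (use prob_\<kappa> sets_\<kappa> in auto)

text \<open>Shifting the white noise by \<open>a\<close> moves the truncated state by the partial
  sums of \<open>v c k i * a k\<close>, which tend to \<open>y\<close>. A translation of the limit
  law is thus, up to a vanishing error, a shift of the noise, and Cameron-Martin applies with an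
  energy below \<open>D\<close> for every \<open>m\<close>.\<close>

lemma cameron_martin_test_fun:
  assumes \<phi>: "test_fun L \<phi>" and y0: "\<And>i. i \<notin> {1..N} \<Longrightarrow> y i = 0"
    and a: "\<And>i. i \<in> {1..N} \<Longrightarrow> (\<lambda>m. \<Sum>k<m. v c k i * a k) \<longlonglongrightarrow> y i"
    and E: "\<And>m. (\<Sum>k<m. (a k)\<^sup>2) \<le> D"
  shows "(LINT u|\<kappa> c. \<phi> (\<lambda>i. u i + y i))\<^sup>2 \<le> exp (D / \<sigma>\<^sup>2) * (LINT u|\<kappa> c. (\<phi> u)\<^sup>2)"
proof -
  interpret w: prob_space "white \<sigma>" by (rule prob_space_white[OF \<sigma>])
  let ?T = "\<lambda>m. gauss_shift N v m c"
  note \<phi>m = test_fun_measurable[OF \<phi>]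
  have Tm[measurable]: "(\<lambda>s. \<phi> (?T m s)) \<in> borel_measurable (white \<sigma>)" for m
    using measurable_compose[OF measurable_gauss_shift2 \<phi>m] by simp
  have Tam[measurable]: "(\<lambda>s. \<phi> (?T m (\<lambda>k. s k + a k))) \<in> borel_measurable (white \<sigma>)" for m
    using measurable_compose[OF measurable_compose[OF measurable_shift_seq[OF measurable_ident] measurable_gauss_shift2] \<phi>m]
    by (simp add: id_def)
  have Tym[measurable]: "(\<lambda>s. \<phi> (\<lambda>i. ?T m s i + y i)) \<in> borel_measurable (white \<sigma>)" for m
    using measurable_compose[OF measurable_shift_seq[OF measurable_gauss_shift2] \<phi>m] by simp
  have b: "\<bar>\<phi> u\<bar> \<le> 1" for u using test_funD(2,3)[OF \<phi>, of u] by simp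
  have i1: "integrable (white \<sigma>) (\<lambda>s. \<phi> (?T m (\<lambda>k. s k + a k)))"
    and i2: "integrable (white \<sigma>) (\<lambda>s. \<phi> (\<lambda>i. ?T m s i + y i))"
    and i3: "integrable (white \<sigma>) (\<lambda>s. (\<phi> (?T m s))\<^sup>2)" for m
    using b by (auto intro!: w.integrable_const_bound[where B = 1] simp: power_le_one abs_square_le_1)
  \<comment> \<open>In \<open>x m\<close> the noise is shifted, in \<open>p m\<close> the state is
    translated. Cameron-Martin speaks about \<open>x m\<close>, the limit law about
    \<open>p m\<close>; they are close because \<open>\<phi>\<close> is Lipschitz.\<close>
  define x where "x m = (LINT s|white \<sigma>. \<phi> (?T m (\<lambda>k. s k + a k)))" for m
  define p where "p m = (LINT s|white \<sigma>. \<phi> (\<lambda>i. ?T m s i + y i))" for m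
  define z where "z m = (LINT s|white \<sigma>. (\<phi> (?T m s))\<^sup>2)" for m
  have x0: "0 \<le> x m" for m unfolding x_def using test_funD(2)[OF \<phi>] by simp
  have z0: "0 \<le> z m" for m unfolding z_def by simp
  have xz: "(x m)\<^sup>2 \<le> exp (D / \<sigma>\<^sup>2) * z m" for m
  proof -
    have "(\<integral>\<^sup>+ s. ennreal (\<phi> (?T m (\<lambda>k. s k + a k))) \<partial>white \<sigma>)\<^sup>2
      \<le> ennreal (exp ((\<Sum>k<m. (a k)\<^sup>2) / \<sigma>\<^sup>2)) * (\<integral>\<^sup>+ s. (ennreal (\<phi> (?T m s)))\<^sup>2 \<partial>white \<sigma>)"
    proof (rule cameron_martin_white[OF \<sigma>])
      show "(\<lambda>s. ennreal (\<phi> (?T m s))) \<in> borel_measurable borel"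
        using measurable_compose[OF measurable_gauss_shift2 \<phi>m] by measurable
      show "ennreal (\<phi> (?T m s)) = ennreal (\<phi> (?T m t))" if "\<And>k. k < m \<Longrightarrow> s k = t k" for s t
      proof -
        have "?T m s = ?T m t" unfolding gauss_shift_def using that by (auto intro!: ext sum.cong)
        then show ?thesis by simp
      qed
    qed
    also have "(\<integral>\<^sup>+ s. ennreal (\<phi> (?T m (\<lambda>k. s k + a k))) \<partial>white \<sigma>) = ennreal (x m)"
      unfolding x_def by (rule nn_integral_eq_integral[OF i1]) (use test_funD(2)[OF \<phi>] in auto)
    also have "(\<integral>\<^sup>+ s. (ennreal (\<phi> (?T m s)))\<^sup>2 \<partial>white \<sigma>) = ennreal (z m)"
      unfolding z_def using nn_integral_eq_integral[OF i3[of m]] test_funD(2)[OF \<phi>] by (simp add: ennreal_power)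
    finally have "ennreal ((x m)\<^sup>2) \<le> ennreal (exp ((\<Sum>k<m. (a k)\<^sup>2) / \<sigma>\<^sup>2) * z m)"
      using x0 z0 by (simp add: ennreal_power ennreal_mult')
    then have "(x m)\<^sup>2 \<le> exp ((\<Sum>k<m. (a k)\<^sup>2) / \<sigma>\<^sup>2) * z m"
      using z0[of m] by (subst (asm) ennreal_le_iff) auto
    also have "\<dots> \<le> exp (D / \<sigma>\<^sup>2) * z m"
      using z0[of m] E[of m] by (intro mult_right_mono) (auto intro: divide_right_mono)
    finally show ?thesis .
  qed
  have px: "(\<lambda>m. x m - p m) \<longlonglongrightarrow> 0"
  proof (rule Lim_null_comparison)
    let ?r = "\<lambda>m. L * (2 * (\<Sum>i = 1..N. \<bar>(\<Sum>k<m. v c k i * a k) - y i\<bar>))"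
    show "\<forall>\<^sub>F m in sequentially. norm (x m - p m) \<le> ?r m"
    proof (rule always_eventually, rule allI)
      fix m
      have pt: "\<bar>\<phi> (?T m (\<lambda>k. s k + a k)) - \<phi> (\<lambda>i. ?T m s i + y i)\<bar> \<le> ?r m" for s
      proof -
        have "\<bar>\<phi> (?T m (\<lambda>k. s k + a k)) - \<phi> (\<lambda>i. ?T m s i + y i)\<bar>
          \<le> L * dist (?T m (\<lambda>k. s k + a k)) (\<lambda>i. ?T m s i + y i)" by (rule test_funD(4)[OF \<phi>])
        also have "\<dots> \<le> L * (2 * (\<Sum>i = 1..N. \<bar>?T m (\<lambda>k. s k + a k) i - (?T m s i + y i)\<bar>))"
        proof (intro mult_left_mono dist_seq_le test_funD(1)[OF \<phi>])
          fix i assume i: "i \<notin> {1..N}"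
          show "?T m (\<lambda>k. s k + a k) i = ?T m s i + y i"
            unfolding gauss_shift_def if_not_P[OF i] using y0[OF i] by simp
        qed
        also have "(\<Sum>i = 1..N. \<bar>?T m (\<lambda>k. s k + a k) i - (?T m s i + y i)\<bar>) = (\<Sum>i = 1..N. \<bar>(\<Sum>k<m. v c k i * a k) - y i\<bar>)"
          by (intro sum.cong refl) (simp add: gauss_shift_def distrib_left sum.distrib)
        finally show ?thesis .
      qed
      have "\<bar>x m - p m\<bar> = \<bar>LINT s|white \<sigma>. \<phi> (?T m (\<lambda>k. s k + a k)) - \<phi> (\<lambda>i. ?T m s i + y i)\<bar>"
        unfolding x_def p_def Bochner_Integration.integral_diff[OF i1 i2] ..
      also have "\<dots> \<le> (LINT s|white \<sigma>. \<bar>\<phi> (?T m (\<lambda>k. s k + a k)) - \<phi> (\<lambda>i. ?T m s i + y i)\<bar>)"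
        by (rule integral_abs_bound)
      also have "\<dots> \<le> (LINT s|white \<sigma>. ?r m)"
        using pt by (intro integral_mono integrable_abs Bochner_Integration.integrable_diff i1 i2) auto
      also have "\<dots> = ?r m" using w.prob_space by simp
      finally show "norm (x m - p m) \<le> ?r m" by simp
    qed
    have "?r \<longlonglongrightarrow> L * (2 * (\<Sum>i = 1..N. \<bar>y i - y i\<bar>))"
      by (intro tendsto_intros a) auto
    then show "?r \<longlonglongrightarrow> 0" by simp
  qed
  have "test_fun L (\<lambda>u. \<phi> (\<lambda>i. u i + y i))"
    using \<phi> unfolding test_fun_def by (metis dist_seq_translate)
  from \<kappa>_lim[OF this, of c] have "p \<longlonglongrightarrow> (LINT u|\<kappa> c. \<phi> (\<lambda>i. u i + y i))"
    unfolding p_def .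
  from tendsto_add[OF px this] have xl: "x \<longlonglongrightarrow> (LINT u|\<kappa> c. \<phi> (\<lambda>i. u i + y i))" by simp
  \<comment> \<open>The square is again a test function, so \<open>\<kappa>_lim\<close> covers the
    right-hand side as well.\<close>
  have "test_fun (2 * L) (\<lambda>u. (\<phi> u)\<^sup>2)"
    unfolding test_fun_def
  proof (intro conjI allI)
    fix u w
    show "(\<phi> u)\<^sup>2 \<le> 1" using test_funD(2,3)[OF \<phi>] by (simp add: power_le_one)
    have "(\<phi> u)\<^sup>2 - (\<phi> w)\<^sup>2 = (\<phi> u + \<phi> w) * (\<phi> u - \<phi> w)" by (simp add: power2_eq_square algebra_simps)
    then have "\<bar>(\<phi> u)\<^sup>2 - (\<phi> w)\<^sup>2\<bar> = (\<phi> u + \<phi> w) * \<bar>\<phi> u - \<phi> w\<bar>"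
      using test_funD(2)[OF \<phi>, of u] test_funD(2)[OF \<phi>, of w] by (simp add: abs_mult)
    also have "\<dots> \<le> 2 * (L * dist u w)"
      using test_funD(3)[OF \<phi>, of u] test_funD(3)[OF \<phi>, of w] test_funD(4)[OF \<phi>, of u w] by (intro mult_mono) auto
    finally show "\<bar>(\<phi> u)\<^sup>2 - (\<phi> w)\<^sup>2\<bar> \<le> 2 * L * dist u w" by simp
  qed (use test_funD(1)[OF \<phi>] in auto)
  from \<kappa>_lim[OF this, of c] have zl: "z \<longlonglongrightarrow> (LINT u|\<kappa> c. (\<phi> u)\<^sup>2)" unfolding z_def .
  show ?thesis
    by (rule LIMSEQ_le[OF tendsto_power[OF xl] tendsto_mult[OF tendsto_const zl]]) (use xz in auto)
qed

text \<open>From test functions to closed sets by \<open>cutoff\<close>, whose square is at most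
  itself, and then to Borel sets by inner regularity of the translated law: replacing a compact
  subset by \<open>A\<close> only increases the right-hand side.\<close>

lemma cameron_martin:
  assumes A: "A \<in> sets borel" and y0: "\<And>i. i \<notin> {1..N} \<Longrightarrow> y i = 0"
    and a: "\<And>i. i \<in> {1..N} \<Longrightarrow> (\<lambda>m. \<Sum>k<m. v c k i * a k) \<longlonglongrightarrow> y i"
    and E: "\<And>m. (\<Sum>k<m. (a k)\<^sup>2) \<le> D"
  shows "(measure (\<kappa> c) {u. (\<lambda>i. u i + y i) \<in> A})\<^sup>2 \<le> exp (D / \<sigma>\<^sup>2) * measure (\<kappa> c) A"
proof -
  interpret k: prob_space "\<kappa> c" by (rule prob_\<kappa>)
  have sm: "(\<lambda>u i. u i + y i) \<in> \<kappa> c \<rightarrow>\<^sub>M borel"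
    using measurable_shift_seq[OF measurable_ident, of y] unfolding measurable_cong_sets[OF sets_\<kappa> refl] by (simp add: id_def)
  let ?\<nu> = "distr (\<kappa> c) borel (\<lambda>u i. u i + y i)"
  interpret n: prob_space ?\<nu> by (rule k.prob_space_distr[OF sm])
  have \<nu>: "measure ?\<nu> B = measure (\<kappa> c) {u. (\<lambda>i. u i + y i) \<in> B}" if "B \<in> sets borel" for B
    using measure_distr[OF sm that] space_\<kappa> by (simp add: vimage_def)
  have closed: "(measure ?\<nu> C)\<^sup>2 \<le> exp (D / \<sigma>\<^sup>2) * measure (\<kappa> c) C" if C: "closed C" for C
  proof (cases "C = {}")
    case False
    have 1: "(\<lambda>n. (LINT u|\<kappa> c. cutoff C n (\<lambda>i. u i + y i))) \<longlonglongrightarrow> measure ?\<nu> C"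
      using integral_cutoff_tendsto[OF n.finite_measure_axioms _ C False]
        integral_distr[OF sm test_fun_measurable[OF test_fun_cutoff], of C] by simp
    have 2: "(\<lambda>n. LINT u|\<kappa> c. cutoff C n u) \<longlonglongrightarrow> measure (\<kappa> c) C"
      by (rule integral_cutoff_tendsto[OF k.finite_measure_axioms sets_\<kappa> C False])
    have le: "(LINT u|\<kappa> c. cutoff C n (\<lambda>i. u i + y i))\<^sup>2 \<le> exp (D / \<sigma>\<^sup>2) * (LINT u|\<kappa> c. cutoff C n u)" for n
    proof -
      have cm: "cutoff C n \<in> borel_measurable (\<kappa> c)"
        using test_fun_measurable[OF test_fun_cutoff] unfolding measurable_cong_sets[OF sets_\<kappa> refl] .
      note cb = test_funD(2,3)[OF test_fun_cutoff, of C n]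
      have i: "integrable (\<kappa> c) (cutoff C n)" "integrable (\<kappa> c) (\<lambda>u. (cutoff C n u)\<^sup>2)"
        using cm cb by (auto intro!: k.integrable_const_bound[where B = 1] simp: power_le_one)
      have "(LINT u|\<kappa> c. (cutoff C n u)\<^sup>2) \<le> (LINT u|\<kappa> c. cutoff C n u)"
        using cb i by (intro integral_mono) (auto simp: power2_eq_square intro: mult_left_le)
      then have "exp (D / \<sigma>\<^sup>2) * (LINT u|\<kappa> c. (cutoff C n u)\<^sup>2) \<le> exp (D / \<sigma>\<^sup>2) * (LINT u|\<kappa> c. cutoff C n u)"
        by (intro mult_left_mono) auto
      with cameron_martin_test_fun[OF test_fun_cutoff y0 a E, of C n] show ?thesis by linarith
    qed
    show ?thesis
      by (rule LIMSEQ_le[OF tendsto_power[OF 1] tendsto_mult[OF tendsto_const 2]]) (use le in auto)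
  qed simp
  let ?t = "sqrt (exp (D / \<sigma>\<^sup>2) * measure (\<kappa> c) A)"
  have "emeasure ?\<nu> A = (SUP K \<in> {K. K \<subseteq> A \<and> compact K}. emeasure ?\<nu> K)"
    by (rule inner_regular) (use A n.emeasure_finite in auto)
  also have "\<dots> \<le> ennreal ?t"
  proof (rule SUP_least)
    fix K assume "K \<in> {K. K \<subseteq> A \<and> compact K}"
    then have K: "K \<subseteq> A" "closed K" by (auto intro: compact_imp_closed)
    have "(measure ?\<nu> K)\<^sup>2 \<le> exp (D / \<sigma>\<^sup>2) * measure (\<kappa> c) K" by (rule closed[OF K(2)])
    also have "\<dots> \<le> exp (D / \<sigma>\<^sup>2) * measure (\<kappa> c) A"
      using K A sets_\<kappa> by (intro mult_left_mono k.finite_measure_mono) auto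
    finally have "measure ?\<nu> K \<le> ?t" by (rule real_le_rsqrt)
    then show "emeasure ?\<nu> K \<le> ennreal ?t" unfolding n.emeasure_eq_measure by (rule ennreal_leI)
  qed
  finally have "measure ?\<nu> A \<le> ?t" unfolding n.emeasure_eq_measure by (subst (asm) ennreal_le_iff) auto
  then have "(measure ?\<nu> A)\<^sup>2 \<le> ?t\<^sup>2" by (intro power_mono) auto
  then show ?thesis using \<nu>[OF A] by simp
qed

end

text \<open>\<open>control\<close> is a quantitative reachability condition: every displacement
  \<open>y\<close> of the state is produced by a shift of the noise with energy at most
  \<open>Q c\<close> times the squared norm of \<open>y\<close>. The cost \<open>Q\<close> may grow
  with the state but is bounded on bounded sets.\<close>

locale nondegenerate_gaussian_kernel = gaussian_kernel +
  fixes Q :: "(nat \<Rightarrow> real) \<Rightarrow> real" and B :: real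
  assumes second_moment: "\<And>c. (\<integral>\<^sup>+ u. ennreal (sqn N u) \<partial>\<kappa> c) \<le> ennreal (2 * sqn N c + B)"
    and control: "\<And>c y. \<exists>a. (\<forall>i \<in> {1..N}. (\<lambda>m. \<Sum>k<m. v c k i * a k) \<longlonglongrightarrow> y i) \<and>
        (\<forall>m. (\<Sum>k<m. (a k)\<^sup>2) \<le> Q c * sqn N y)"
    and Q_bounded: "\<And>R. \<exists>q. \<forall>c. sqn N c \<le> R \<longrightarrow> Q c \<le> q"
    and B: "0 \<le> B"
begin

text \<open>The integral is the mass of \<open>A\<close> under the convolution of the two laws. A
  displacement \<open>w\<close> drawn from \<open>\<kappa> c'\<close> either has squared norm above
  \<open>\<rho>\<close>, which contributes at most 1/8 by Markov's inequality, or it costs energy at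
  most \<open>q * \<rho>\<close>. In the second case the squared mass of the shifted set is at most
  exp(q \<rho> / \<sigma>^2) times the assumed mass of \<open>A\<close>, that is 1/64.\<close>

lemma convolution_small:
  assumes q: "Q c \<le> q" "0 \<le> q" and \<rho>: "\<rho> > 0"
    and m': "(\<integral>\<^sup>+ u. ennreal (sqn N u) \<partial>\<kappa> c') \<le> ennreal (\<rho> / 8)"
    and A: "A \<in> sets borel" and small: "measure (\<kappa> c) A \<le> exp (- (q * \<rho> / \<sigma>\<^sup>2)) / 64"
  shows "(\<integral>\<^sup>+ w. emeasure (\<kappa> c) {u. (\<lambda>i. u i + w i) \<in> A} \<partial>\<kappa> c') \<le> ennreal (1 / 4)"
proof -
  interpret k: prob_space "\<kappa> c" by (rule prob_\<kappa>)
  interpret k': prob_space "\<kappa> c'" by (rule prob_\<kappa>)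
  have sq[measurable]: "sqn N \<in> borel_measurable (\<kappa> c')"
    using sqn_measurable unfolding measurable_cong_sets[OF sets_\<kappa> refl] .
  have bound: "AE w in \<kappa> c'. emeasure (\<kappa> c) {u. (\<lambda>i. u i + w i) \<in> A} \<le> ennreal (1 / 8) + ennreal (sqn N w) * ennreal (1 / \<rho>)"
    using \<kappa>_supp[of c']
  proof eventually_elim
    case (elim w)
    show ?case
    proof (cases "sqn N w \<le> \<rho>")
      case True
      obtain a where a: "\<And>i. i \<in> {1..N} \<Longrightarrow> (\<lambda>m. \<Sum>k<m. v c k i * a k) \<longlonglongrightarrow> w i"
        "\<And>m. (\<Sum>k<m. (a k)\<^sup>2) \<le> Q c * sqn N w" using control[of c w] by blast
      have "Q c * sqn N w \<le> q * \<rho>" using q True by (meson mult_mono sqn_nonneg order_trans mult_right_mono mult_left_mono)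
      then have E: "(\<Sum>k<m. (a k)\<^sup>2) \<le> q * \<rho>" for m using a(2)[of m] by linarith
      have w0: "w i = 0" if "i \<notin> {1..N}" for i using elim that by blast
      have "(measure (\<kappa> c) {u. (\<lambda>i. u i + w i) \<in> A})\<^sup>2 \<le> exp (q * \<rho> / \<sigma>\<^sup>2) * measure (\<kappa> c) A"
        by (rule cameron_martin[OF A w0 a(1) E])
      also have "\<dots> \<le> exp (q * \<rho> / \<sigma>\<^sup>2) * (exp (- (q * \<rho> / \<sigma>\<^sup>2)) / 64)"
        using small by (intro mult_left_mono) auto
      also have "\<dots> = (1 / 8)\<^sup>2" by (simp add: exp_minus power2_eq_square)
      finally have "measure (\<kappa> c) {u. (\<lambda>i. u i + w i) \<in> A} \<le> 1 / 8"
        by (rule power2_le_imp_le) simp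
      then have "emeasure (\<kappa> c) {u. (\<lambda>i. u i + w i) \<in> A} \<le> ennreal (1 / 8)"
        unfolding k.emeasure_eq_measure by (rule ennreal_leI)
      then show ?thesis by (rule order_trans) simp
    next
      case False
      have "emeasure (\<kappa> c) {u. (\<lambda>i. u i + w i) \<in> A} \<le> 1" by (rule k.emeasure_le_1)
      also have "1 \<le> ennreal (sqn N w) * ennreal (1 / \<rho>)"
      proof -
        have "1 \<le> sqn N w * (1 / \<rho>)" using False \<rho> by (simp add: field_simps)
        then have "ennreal 1 \<le> ennreal (sqn N w * (1 / \<rho>))" by (rule ennreal_leI)
        then show ?thesis by (simp only: ennreal_mult'[OF sqn_nonneg] ennreal_1)
      qed
      finally show ?thesis by (rule order_trans) simp
    qed
  qed
  have "(\<integral>\<^sup>+ w. emeasure (\<kappa> c) {u. (\<lambda>i. u i + w i) \<in> A} \<partial>\<kappa> c')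
    \<le> (\<integral>\<^sup>+ w. ennreal (1 / 8) + ennreal (sqn N w) * ennreal (1 / \<rho>) \<partial>\<kappa> c')"
    by (rule nn_integral_mono_AE[OF bound])
  also have "\<dots> = (\<integral>\<^sup>+ w. ennreal (1 / 8) \<partial>\<kappa> c') + (\<integral>\<^sup>+ w. ennreal (sqn N w) * ennreal (1 / \<rho>) \<partial>\<kappa> c')"
    by (rule nn_integral_add) measurable
  also have "(\<integral>\<^sup>+ w. ennreal (sqn N w) * ennreal (1 / \<rho>) \<partial>\<kappa> c') = (\<integral>\<^sup>+ w. ennreal (sqn N w) \<partial>\<kappa> c') * ennreal (1 / \<rho>)"
    by (rule nn_integral_multc) measurable
  also have "(\<integral>\<^sup>+ w. ennreal (1 / 8) \<partial>\<kappa> c') = ennreal (1 / 8)"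
    by (simp only: nn_integral_const k'.emeasure_space_1 mult_1_right)
  also have "(\<integral>\<^sup>+ w. ennreal (sqn N w) \<partial>\<kappa> c') * ennreal (1 / \<rho>) \<le> ennreal (\<rho> / 8) * ennreal (1 / \<rho>)"
    using m' by (rule mult_right_mono) simp
  also have "ennreal (\<rho> / 8) * ennreal (1 / \<rho>) = ennreal (1 / 8)"
    using \<rho> by (simp add: ennreal_mult'[symmetric])
  also have "ennreal (1 / 8) + ennreal (1 / 8) = ennreal (1 / 4)"
    by (simp add: ennreal_plus[symmetric] del: ennreal_plus)
  finally show ?thesis by (simp add: add_left_mono)
qed

lemma small_set_condition:
  obtains \<epsilon> where "(\<epsilon> :: real) > 0"
    "\<And>c c' A. sqn N c + sqn N c' \<le> R \<Longrightarrow> A \<in> sets borel \<Longrightarrow> measure (\<kappa> c) A - measure (\<kappa> c') A \<le> 1 - \<epsilon>"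
proof -
  obtain q0 where q0: "\<And>c. sqn N c \<le> R \<Longrightarrow> Q c \<le> q0" using Q_bounded by blast
  define q where "q = max q0 0"
  have q: "0 \<le> q" "\<And>c. sqn N c \<le> R \<Longrightarrow> Q c \<le> q" using q0 unfolding q_def by (auto simp: max.coboundedI1)
  \<comment> \<open>Eight times a bound for the second moments of both laws, so that Markov's
    inequality yields 1/8.\<close>
  define \<rho> where "\<rho> = 8 * (2 * \<bar>R\<bar> + B + 1)"
  have \<rho>: "\<rho> > 0" unfolding \<rho>_def using B by simp
  have mom: "(\<integral>\<^sup>+ u. ennreal (sqn N u) \<partial>\<kappa> c) \<le> ennreal (\<rho> / 8)" if "sqn N c \<le> R" for c
    by (rule order_trans[OF second_moment]) (use that in \<open>auto intro!: ennreal_leI simp: \<rho>_def\<close>)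
  define \<epsilon> where "\<epsilon> = exp (- (q * \<rho> / \<sigma>\<^sup>2)) / 64"
  have \<epsilon>: "\<epsilon> > 0" unfolding \<epsilon>_def by simp
  show thesis
  proof (rule that[OF \<epsilon>])
    fix c c' :: "nat \<Rightarrow> real" and A :: "(nat \<Rightarrow> real) set" assume cc: "sqn N c + sqn N c' \<le> R" and A: "A \<in> sets borel"
    have c: "sqn N c \<le> R" "sqn N c' \<le> R"
      using cc sqn_nonneg[of N c] sqn_nonneg[of N c'] by linarith+
    interpret k: prob_space "\<kappa> c" by (rule prob_\<kappa>)
    interpret k': prob_space "\<kappa> c'" by (rule prob_\<kappa>)
    interpret pp: pair_prob_space "\<kappa> c" "\<kappa> c'" ..
    have comp: "measure (\<kappa> c) (- A) = 1 - measure (\<kappa> c) A"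
      using k.prob_compl[of A] A sets_\<kappa> space_\<kappa> by (simp add: Compl_eq_Diff_UNIV)
    have "\<not> (measure (\<kappa> c) (- A) \<le> \<epsilon> \<and> measure (\<kappa> c') A \<le> \<epsilon>)"
    proof
      assume small: "measure (\<kappa> c) (- A) \<le> \<epsilon> \<and> measure (\<kappa> c') A \<le> \<epsilon>"
      have add: "(\<lambda>z i. fst z i + snd z i) \<in> \<kappa> c \<Otimes>\<^sub>M \<kappa> c' \<rightarrow>\<^sub>M (borel :: (nat \<Rightarrow> real) measure)"
      proof (rule measurable_coordinatewise_then_product)
        fix i
        have [measurable]: "(\<lambda>c::nat \<Rightarrow> real. c i) \<in> borel_measurable (\<kappa> d)" for d
          using measurable_coordinate[of i] unfolding measurable_cong_sets[OF sets_\<kappa> refl] .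
        show "(\<lambda>z. fst z i + snd z i) \<in> borel_measurable (\<kappa> c \<Otimes>\<^sub>M \<kappa> c')" by measurable
      qed
      have S: "{z \<in> space (\<kappa> c \<Otimes>\<^sub>M \<kappa> c'). (\<lambda>i. fst z i + snd z i) \<in> X} \<in> sets (\<kappa> c \<Otimes>\<^sub>M \<kappa> c')" (is "?S X \<in> _")
        if "X \<in> sets borel" for X
        using measurable_sets[OF add that] by (simp add: vimage_def Int_def conj_commute)
      \<comment> \<open>The product measure is sliced both ways: here the second variable is frozen
        and translates \<open>\<kappa> c\<close>, in the next bound the first one is frozen and
        translates \<open>\<kappa> c'\<close>. The two masses add up to at most 1/2, although the
        sets cover the space.\<close>
      have 1: "emeasure (\<kappa> c \<Otimes>\<^sub>M \<kappa> c') (?S (- A)) \<le> ennreal (1 / 4)"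
      proof -
        have "emeasure (\<kappa> c \<Otimes>\<^sub>M \<kappa> c') (?S (- A)) = (\<integral>\<^sup>+ w. emeasure (\<kappa> c) ((\<lambda>u. (u, w)) -` ?S (- A)) \<partial>\<kappa> c')"
          by (rule pp.emeasure_pair_measure_alt2) (use S A in auto)
        also have "\<dots> = (\<integral>\<^sup>+ w. emeasure (\<kappa> c) {u. (\<lambda>i. u i + w i) \<in> - A} \<partial>\<kappa> c')"
          by (intro nn_integral_cong arg_cong[of _ _ "emeasure (\<kappa> c)"]) (auto simp: space_pair_measure space_\<kappa>)
        also have "\<dots> \<le> ennreal (1 / 4)"
          using A small by (intro convolution_small[OF q(2)[OF c(1)] q(1) \<rho> mom[OF c(2)]]) (auto simp: \<epsilon>_def)
        finally show ?thesis .
      qed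
      have 2: "emeasure (\<kappa> c \<Otimes>\<^sub>M \<kappa> c') (?S A) \<le> ennreal (1 / 4)"
      proof -
        have "emeasure (\<kappa> c \<Otimes>\<^sub>M \<kappa> c') (?S A) = (\<integral>\<^sup>+ u. emeasure (\<kappa> c') (Pair u -` ?S A) \<partial>\<kappa> c)"
          by (rule k'.emeasure_pair_measure_alt) (use S A in auto)
        also have "\<dots> = (\<integral>\<^sup>+ w. emeasure (\<kappa> c') {u. (\<lambda>i. u i + w i) \<in> A} \<partial>\<kappa> c)"
          by (intro nn_integral_cong arg_cong[of _ _ "emeasure (\<kappa> c')"]) (auto simp: space_pair_measure space_\<kappa> add.commute)
        also have "\<dots> \<le> ennreal (1 / 4)"
          using A small by (intro convolution_small[OF q(2)[OF c(2)] q(1) \<rho> mom[OF c(1)]]) (auto simp: \<epsilon>_def)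
        finally show ?thesis .
      qed
      have sp: "?S (- A) \<union> ?S A = space (\<kappa> c \<Otimes>\<^sub>M \<kappa> c')" by auto
      have "1 = emeasure (\<kappa> c \<Otimes>\<^sub>M \<kappa> c') (?S (- A) \<union> ?S A)"
        unfolding sp by (rule pp.emeasure_space_1[symmetric])
      also have "\<dots> \<le> emeasure (\<kappa> c \<Otimes>\<^sub>M \<kappa> c') (?S (- A)) + emeasure (\<kappa> c \<Otimes>\<^sub>M \<kappa> c') (?S A)"
        by (intro emeasure_subadditive S) (use A in auto)
      also have "\<dots> \<le> ennreal (1 / 4) + ennreal (1 / 4)" using 1 2 by (rule add_mono)
      also have "\<dots> = ennreal (1 / 2)" by (simp add: ennreal_plus[symmetric] del: ennreal_plus)
      finally have "ennreal 1 \<le> ennreal (1 / 2)" by simp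
      then show False by (subst (asm) ennreal_le_iff) auto
    qed
    \<comment> \<open>Either \<open>\<kappa> c'\<close> gives \<open>A\<close> more than
      \<open>\<epsilon>\<close> and the subtracted term is large, or \<open>\<kappa> c\<close> gives
      the complement more than \<open>\<epsilon>\<close> and the first term is below 1 -
      \<epsilon>.\<close>
    then show "measure (\<kappa> c) A - measure (\<kappa> c') A \<le> 1 - \<epsilon>"
      using comp k.prob_le_1[of A] measure_nonneg[of "\<kappa> c'" A] by argo
  qed
qed

end

section \<open>The noise coefficients\<close>

lemma L2_unit_iff:
  "h \<in> L2_space unit_interval \<longleftrightarrow> h \<in> borel_measurable unit_interval \<and> integrable unit_interval (\<lambda>x. (h x)\<^sup>2)"
  unfolding L2_space_def by auto

lemma integrable_mult_L2:
  assumes "u \<in> L2_space unit_interval" "w \<in> L2_space unit_interval"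
  shows "integrable unit_interval (\<lambda>x. u x * w x)"
proof (rule Bochner_Integration.integrable_bound)
  have [measurable]: "u \<in> borel_measurable unit_interval" "w \<in> borel_measurable unit_interval"
    using assms unfolding L2_unit_iff by auto
  show "integrable unit_interval (\<lambda>x. (u x)\<^sup>2 + (w x)\<^sup>2)" using assms unfolding L2_unit_iff by auto
  show "(\<lambda>x. u x * w x) \<in> borel_measurable unit_interval" by measurable
  show "AE x in unit_interval. norm (u x * w x) \<le> norm ((u x)\<^sup>2 + (w x)\<^sup>2)"
  proof (rule AE_I2)
    fix x
    have "2 * (\<bar>u x\<bar> * \<bar>w x\<bar>) \<le> (u x)\<^sup>2 + (w x)\<^sup>2" using sum_squares_bound[of "\<bar>u x\<bar>" "\<bar>w x\<bar>"] by (simp add: mult.assoc)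
    moreover have "0 \<le> \<bar>u x\<bar> * \<bar>w x\<bar>" by simp
    ultimately have "\<bar>u x\<bar> * \<bar>w x\<bar> \<le> (u x)\<^sup>2 + (w x)\<^sup>2" by linarith
    then show "norm (u x * w x) \<le> norm ((u x)\<^sup>2 + (w x)\<^sup>2)" by (simp add: abs_mult)
  qed
qed

lemma bounded_in_L2:
  assumes "h \<in> borel_measurable unit_interval" "\<And>x. \<bar>h x\<bar> \<le> B"
  shows "h \<in> L2_space unit_interval"
  unfolding L2_unit_iff
proof (intro conjI integrable_unit_bounded)
  show "\<bar>(h x)\<^sup>2\<bar> \<le> B\<^sup>2" for x using power_mono[OF assms(2), of x 2] by simp
qed (use assms in auto)

text \<open>Expand the nonnegative integral of the squared difference between \<open>h\<close> and
  its partial sum; the double sum collapses by orthonormality.\<close>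

lemma bessel_inequality:
  fixes b :: "nat \<Rightarrow> real \<Rightarrow> real" and m :: nat
  assumes b: "\<And>k. b k \<in> L2_space unit_interval" and on: "\<And>i k. ip (b i) (b k) = (if i = k then 1 else 0)"
    and h: "h \<in> L2_space unit_interval"
  shows "(\<Sum>k<m. (ip h (b k))\<^sup>2) \<le> ip h h"
proof -
  let ?a = "\<lambda>k. ip h (b k)"
  let ?S = "\<lambda>x. \<Sum>k<m. ?a k * b k x"
  have hb: "integrable unit_interval (\<lambda>x. h x * b k x)" for k by (rule integrable_mult_L2[OF h b])
  have bb: "integrable unit_interval (\<lambda>x. b k x * b l x)" for k l by (rule integrable_mult_L2[OF b b])
  have hh: "integrable unit_interval (\<lambda>x. h x * h x)" by (rule integrable_mult_L2[OF h h])
  have e1: "(LINT x|unit_interval. (\<Sum>k<m. ?a k * (h x * b k x))) = (\<Sum>k<m. (?a k)\<^sup>2)"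
    using hb by (simp add: Bochner_Integration.integral_sum ip_def power2_eq_square)
  have i1: "integrable unit_interval (\<lambda>x. \<Sum>k<m. ?a k * (h x * b k x))"
    using hb by (intro Bochner_Integration.integrable_sum integrable_mult_right)
  have i2: "integrable unit_interval (\<lambda>x. \<Sum>k<m. \<Sum>l<m. (?a k * ?a l) * (b k x * b l x))"
    using bb by (intro Bochner_Integration.integrable_sum integrable_mult_right)
  have "(LINT x|unit_interval. (\<Sum>k<m. \<Sum>l<m. (?a k * ?a l) * (b k x * b l x))) = (\<Sum>k<m. \<Sum>l<m. (?a k * ?a l) * ip (b k) (b l))"
    unfolding ip_def[of "b _" "b _"] using bb
    by (simp add: Bochner_Integration.integral_sum Bochner_Integration.integrable_sum)
  also have "\<dots> = (\<Sum>k<m. \<Sum>l<m. if l = k then (?a k)\<^sup>2 else 0)"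
    by (intro sum.cong refl) (auto simp: on power2_eq_square)
  also have "\<dots> = (\<Sum>k<m. (?a k)\<^sup>2)" by (intro sum.cong refl) simp
  finally have e2: "(LINT x|unit_interval. (\<Sum>k<m. \<Sum>l<m. (?a k * ?a l) * (b k x * b l x))) = (\<Sum>k<m. (?a k)\<^sup>2)" .
  have pt: "(h x - ?S x)\<^sup>2 = h x * h x - 2 * (\<Sum>k<m. ?a k * (h x * b k x)) + (\<Sum>k<m. \<Sum>l<m. (?a k * ?a l) * (b k x * b l x))" for x
  proof -
    have "(?S x)\<^sup>2 = (\<Sum>k<m. \<Sum>l<m. (?a k * ?a l) * (b k x * b l x))"
      unfolding power2_eq_square sum_product by (intro sum.cong refl) (simp add: mult_ac)
    moreover have "h x * ?S x = (\<Sum>k<m. ?a k * (h x * b k x))"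
      unfolding sum_distrib_left by (intro sum.cong refl) (simp add: mult_ac)
    ultimately show ?thesis by (simp add: power2_diff power2_eq_square[of "h x"])
  qed
  have "0 \<le> (LINT x|unit_interval. (h x - ?S x)\<^sup>2)" by simp
  also have "\<dots> = (LINT x|unit_interval. h x * h x) - 2 * (\<Sum>k<m. (?a k)\<^sup>2) + (\<Sum>k<m. (?a k)\<^sup>2)"
    unfolding pt using hh i1 i2 e1 e2 by simp
  finally show ?thesis unfolding ip_def[of h h] by simp
qed

lemma square_integral_unit_le:
  assumes "u \<in> L2_space unit_interval"
  shows "(LINT x|unit_interval. u x)\<^sup>2 \<le> (LINT x|unit_interval. (u x)\<^sup>2)"
proof -
  interpret U: prob_space unit_interval by (rule prob_space_unit_interval)
  have sq: "integrable unit_interval (\<lambda>x. (u x)\<^sup>2)" and m: "u \<in> borel_measurable unit_interval"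
    using assms unfolding L2_unit_iff by auto
  have i: "integrable unit_interval u" by (rule U.square_integrable_imp_integrable[OF m sq])
  show ?thesis using U.variance_eq[OF i sq] U.variance_positive[of u] by simp
qed

text \<open>The partial sums of \<open>h\<close> converge in L2, and pairing with \<open>w\<close>
  is continuous: for bounded \<open>w\<close> the squared error is at most \<open>C\<^sup>2\<close>
  times the squared L2 distance.\<close>

lemma parseval_bounded:
  assumes b: "orthonormal_basis_H b" and h: "h \<in> L2_space unit_interval"
    and w: "w \<in> borel_measurable unit_interval" "\<And>x. \<bar>w x\<bar> \<le> C"
  shows "(\<lambda>m. \<Sum>k<m. ip w (b k) * ip h (b k)) \<longlonglongrightarrow> ip w h"
proof -
  have bL: "b k \<in> L2_space unit_interval" for k using b unfolding orthonormal_basis_H_def by blast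
  have wL: "w \<in> L2_space unit_interval" by (rule bounded_in_L2[OF w])
  let ?S = "\<lambda>m x. \<Sum>k<m. ip h (b k) * b k x"
  have conv: "L2_tendsto unit_interval ?S h" using b h unfolding orthonormal_basis_H_def by blast
  have SL: "?S m \<in> L2_space unit_interval" for m using conv unfolding L2_tendsto_def by blast
  have lim: "(\<lambda>m. C\<^sup>2 * (LINT x|unit_interval. (?S m x - h x)\<^sup>2)) \<longlonglongrightarrow> 0"
    using conv unfolding L2_tendsto_def by (intro tendsto_mult_right_zero) blast
  have eq: "(\<Sum>k<m. ip w (b k) * ip h (b k)) = ip w (?S m)" for m
  proof -
    have "ip w (?S m) = (LINT x|unit_interval. (\<Sum>k<m. ip h (b k) * (w x * b k x)))"
      unfolding ip_def[of w] by (simp add: sum_distrib_left mult_ac)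
    also have "\<dots> = (\<Sum>k<m. LINT x|unit_interval. ip h (b k) * (w x * b k x))"
      by (intro Bochner_Integration.integral_sum integrable_mult_right integrable_mult_L2 wL bL)
    finally show ?thesis unfolding ip_def[of w "b _"] by (simp add: mult.commute)
  qed
  have sq: "(ip w (?S m) - ip w h)\<^sup>2 \<le> C\<^sup>2 * (LINT x|unit_interval. (?S m x - h x)\<^sup>2)" for m
  proof -
    have wS: "integrable unit_interval (\<lambda>x. w x * ?S m x)" by (rule integrable_mult_L2[OF wL SL])
    have wh: "integrable unit_interval (\<lambda>x. w x * h x)" by (rule integrable_mult_L2[OF wL h])
    have [measurable]: "?S m \<in> borel_measurable unit_interval" "h \<in> borel_measurable unit_interval" "w \<in> borel_measurable unit_interval"
      using SL h w unfolding L2_unit_iff by auto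
    have i: "integrable unit_interval (\<lambda>x. (?S m x - h x)\<^sup>2)"
    proof -
      have "integrable unit_interval (\<lambda>x. (?S m x)\<^sup>2 - 2 * (?S m x * h x) + (h x)\<^sup>2)"
        using SL h integrable_mult_L2[OF SL h] unfolding L2_unit_iff by auto
      then show ?thesis by (simp add: power2_diff algebra_simps)
    qed
    have le: "(w x * (?S m x - h x))\<^sup>2 \<le> C\<^sup>2 * (?S m x - h x)\<^sup>2" for x
      unfolding power_mult_distrib using power_mono[OF w(2), of x 2] by (intro mult_right_mono) auto
    have L: "(\<lambda>x. w x * (?S m x - h x)) \<in> L2_space unit_interval"
      unfolding L2_unit_iff
    proof
      show "integrable unit_interval (\<lambda>x. (w x * (?S m x - h x))\<^sup>2)"
        by (rule Bochner_Integration.integrable_bound[OF integrable_mult_right[OF i, of "C\<^sup>2"]]) (use le in auto)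
    qed measurable
    have "ip w (?S m) - ip w h = (LINT x|unit_interval. w x * (?S m x - h x))"
      unfolding right_diff_distrib Bochner_Integration.integral_diff[OF wS wh] ip_def[of w] ..
    then have "(ip w (?S m) - ip w h)\<^sup>2 \<le> (LINT x|unit_interval. (w x * (?S m x - h x))\<^sup>2)"
      using square_integral_unit_le[OF L] by simp
    also have "\<dots> \<le> (LINT x|unit_interval. C\<^sup>2 * (?S m x - h x)\<^sup>2)"
      using L i le unfolding L2_unit_iff by (intro integral_mono) auto
    finally show ?thesis by simp
  qed
  have "(\<lambda>m. (ip w (?S m) - ip w h)\<^sup>2) \<longlonglongrightarrow> 0"
    by (rule tendsto_sandwich[OF _ _ tendsto_const lim]) (use sq in auto)
  from tendsto_real_sqrt[OF this] have "(\<lambda>m. \<bar>ip w (?S m) - ip w h\<bar>) \<longlonglongrightarrow> 0" by simp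
  then have "(\<lambda>m. ip w (?S m) - ip w h) \<longlonglongrightarrow> 0" by (rule tendsto_rabs_zero_cancel)
  then show ?thesis unfolding eq by (rule LIM_zero_cancel)
qed

locale diffusion_term =
  fixes g :: "real \<Rightarrow> real" and K6 :: real and N :: nat and b :: "nat \<Rightarrow> real \<Rightarrow> real"
  assumes g_cont: "continuous_on UNIV g"
    and g_bound: "\<And>\<xi>. 0 \<noteq> \<bar>g \<xi>\<bar> \<and> \<bar>g \<xi>\<bar> \<le> K6"
    and b: "orthonormal_basis_H b"
begin

lemma bL: "b k \<in> L2_space unit_interval"
  and on: "ip (b i) (b k) = (if i = k then 1 else 0)"
  using b unfolding orthonormal_basis_H_def by auto

lemma b_measurable: "b k \<in> borel_measurable unit_interval"
  using bL unfolding L2_unit_iff by blast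

lemma g_measurable[measurable]: "g \<in> borel_measurable borel"
  by (rule borel_measurable_continuous_onI[OF g_cont])

definition v :: "(nat \<Rightarrow> real) \<Rightarrow> nat \<Rightarrow> nat \<Rightarrow> real" where
  "v c k i = (if i \<in> {1..N} then ip (Gop g (syn N c) (b k)) (e i) else 0)"

text \<open>Multiplication by g(x) is symmetric, so it moves from the basis vector to
  \<open>e i\<close>: for fixed \<open>i\<close> the noise coefficients are the basis coefficients
  of this one bounded function, to which Bessel and Parseval apply.\<close>

definition row :: "(nat \<Rightarrow> real) \<Rightarrow> nat \<Rightarrow> real \<Rightarrow> real" where
  "row c i \<xi> = g (syn N c \<xi>) * e i \<xi>"

lemma row_measurable: "row c i \<in> borel_measurable unit_interval"
proof (rule borel_imp_unit_measurable)
  show "row c i \<in> borel_measurable borel" unfolding row_def by measurable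
qed

lemma row_bound: "\<bar>row c i x\<bar> \<le> K6 * sqrt 2"
  unfolding row_def abs_mult using g_bound[of "syn N c x"] abs_e_le[of i x] by (intro mult_mono) auto

lemma v_row: "i \<in> {1..N} \<Longrightarrow> v c k i = ip (row c i) (b k)"
  unfolding v_def ip_def row_def Gop_def by (simp add: mult_ac)

lemma row_L2: "row c i \<in> L2_space unit_interval"
  by (rule bounded_in_L2[OF row_measurable row_bound])

lemma PN_Gop: "PN N (Gop g (syn N c) (b k)) = syn N (v c k)"
proof -
  have "integrable unit_interval (\<lambda>\<xi>. Gop g (syn N c) (b k) \<xi> * e i \<xi>)" for i
    using integrable_mult_L2[OF row_L2[of c i] bL[of k]] unfolding row_def Gop_def by (simp add: mult_ac)
  note i = this
  show ?thesis unfolding PN_eq[OF i] by (rule syn_cong) (simp add: coef_def v_def)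
qed

lemma v_cong: "syn N c = syn N d \<Longrightarrow> v c = v d"
  by (intro ext) (simp only: v_def)

lemma v_out: "i \<notin> {1..N} \<Longrightarrow> v c k i = 0"
  unfolding v_def by (rule if_not_P)

lemma v_measurable: "(\<lambda>c. v c k i) \<in> borel_measurable borel"
proof (cases "i \<in> {1..N}")
  case True
  interpret U: prob_space unit_interval by (rule prob_space_unit_interval)
  have [measurable]: "(\<lambda>c::nat \<Rightarrow> real. c j) \<in> borel_measurable borel" for j by (rule measurable_coordinate)
  have [measurable]: "e j \<in> borel_measurable unit_interval" for j by (rule borel_imp_unit_measurable) measurable
  have [measurable]: "b k \<in> borel_measurable unit_interval" by (rule b_measurable)
  have "(\<lambda>z. g (\<Sum>j = 1..N. fst z j * e j (snd z)) * e i (snd z) * b k (snd z)) \<in> borel_measurable (borel \<Otimes>\<^sub>M unit_interval)"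
    by measurable
  then have "(\<lambda>c. LINT \<xi>|unit_interval. row c i \<xi> * b k \<xi>) \<in> borel_measurable borel"
    unfolding row_def syn_def by (intro U.borel_measurable_lebesgue_integral) (simp add: split_beta')
  then show ?thesis unfolding v_row[OF True] ip_def .
next
  case False
  show ?thesis unfolding v_out[OF False] by simp
qed

text \<open>Bessel for \<open>row c i\<close>, whose sup norm is at most \<open>K6 * sqrt 2\<close>.
  The bound is uniform in the state and in the truncation, which keeps the second moment of the
  noise bounded.\<close>

lemma sum_v_square_le: "(\<Sum>k<m. (v c k i)\<^sup>2) \<le> 2 * K6\<^sup>2"
proof (cases "i \<in> {1..N}")
  case True
  interpret U: prob_space unit_interval by (rule prob_space_unit_interval)
  have "(\<Sum>k<m. (v c k i)\<^sup>2) \<le> ip (row c i) (row c i)"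
    unfolding v_row[OF True] by (rule bessel_inequality[OF bL on row_L2])
  also have "\<dots> \<le> (LINT x|unit_interval. (K6 * sqrt 2)\<^sup>2)"
    unfolding ip_def
  proof (rule integral_mono)
    show "row c i x * row c i x \<le> (K6 * sqrt 2)\<^sup>2" for x
      using power_mono[OF row_bound[of c i x], of 2] by (simp add: power2_eq_square)
  qed (auto intro: integrable_mult_L2 row_L2)
  also have "\<dots> = 2 * K6\<^sup>2" unfolding lebesgue_integral_const U.prob_space by (simp add: power_mult_distrib)
  finally show ?thesis .
next
  case False
  show ?thesis unfolding v_out[OF False] by simp
qed

text \<open>The radius \<open>sqrt 2 * (\<Sum>i = 1..N. \<bar>c i\<bar>)\<close> bounds the sup norm
  of the state, so the supremum dominates 1 / g^2 along it. As \<open>g\<close> may tend to 0 at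
  infinity, such a bound exists only on compact intervals.\<close>

definition Q :: "(nat \<Rightarrow> real) \<Rightarrow> real" where
  "Q c = (SUP t \<in> cball 0 (sqrt 2 * (\<Sum>i = 1..N. \<bar>c i\<bar>)). 1 / (g t)\<^sup>2)"

lemma bdd_Q: "bdd_above ((\<lambda>t. 1 / (g t)\<^sup>2) ` cball 0 (r :: real))"
proof -
  have "continuous_on (cball 0 r) (\<lambda>t. 1 / (g t)\<^sup>2)"
    using g_bound by (intro continuous_intros continuous_on_subset[OF g_cont]) auto
  then have "compact ((\<lambda>t. 1 / (g t)\<^sup>2) ` cball 0 r)" by (rule compact_continuous_image) simp
  then show ?thesis by (simp add: bounded_imp_bdd_above compact_imp_bounded)
qed

lemma Q_upper: "1 / (g (syn N c x))\<^sup>2 \<le> Q c"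
  unfolding Q_def by (rule cSUP_upper[OF _ bdd_Q]) (use syn_bound[of N c x] in \<open>simp add: dist_real_def\<close>)

lemma Q_bounded: "\<exists>q. \<forall>c. sqn N c \<le> R \<longrightarrow> Q c \<le> q"
proof (intro exI allI impI)
  fix c assume c: "sqn N c \<le> R"
  have "\<bar>c i\<bar> \<le> sqrt R" if i: "i \<in> {1..N}" for i
  proof -
    have "(c i)\<^sup>2 \<le> sqn N c" unfolding sqn_def using i by (intro member_le_sum) auto
    then have "sqrt ((c i)\<^sup>2) \<le> sqrt R" using c by (intro real_sqrt_le_mono) linarith
    then show ?thesis by simp
  qed
  then have "(\<Sum>i = 1..N. \<bar>c i\<bar>) \<le> (\<Sum>i = 1..N. sqrt R)" by (intro sum_mono) auto
  then have "sqrt 2 * (\<Sum>i = 1..N. \<bar>c i\<bar>) \<le> sqrt 2 * (real N * sqrt R)" by (intro mult_left_mono) auto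
  then show "Q c \<le> (SUP t \<in> cball 0 (sqrt 2 * (real N * sqrt R)). 1 / (g t)\<^sup>2)"
    unfolding Q_def
  proof (intro cSUP_subset_mono bdd_Q)
    \<comment> \<open>The radius is nonnegative, so the ball contains 0; monotonicity of the
      conditional supremum is restricted to nonempty sets.\<close>
    have "0 \<le> sqrt 2 * (\<Sum>i = 1..N. \<bar>c i\<bar>)" by (intro mult_nonneg_nonneg sum_nonneg) auto
    then have "0 \<in> cball 0 (sqrt 2 * (\<Sum>i = 1..N. \<bar>c i\<bar>))" by (simp only: mem_cball dist_self)
    then show "cball 0 (sqrt 2 * (\<Sum>i = 1..N. \<bar>c i\<bar>)) \<noteq> {}" by blast
    show "cball 0 (sqrt 2 * (\<Sum>i = 1..N. \<bar>c i\<bar>)) \<subseteq> cball 0 (sqrt 2 * (real N * sqrt R))"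
      by (rule subset_cball) fact
  qed simp
qed

text \<open>The shift consists of the basis coefficients of y / g(x). Parseval against
  \<open>row c i\<close> recovers \<open>y i\<close>, because \<open>g\<close> cancels pointwise,
  and Bessel bounds the energy by the squared L2 norm of the quotient.\<close>

lemma control:
  "\<exists>a. (\<forall>i \<in> {1..N}. (\<lambda>m. \<Sum>k<m. v c k i * a k) \<longlonglongrightarrow> y i) \<and> (\<forall>m. (\<Sum>k<m. (a k)\<^sup>2) \<le> Q c * sqn N y)"
proof -
  define h where "h \<xi> = syn N y \<xi> / g (syn N c \<xi>)" for \<xi>
  have hm: "h \<in> borel_measurable unit_interval"
    by (rule borel_imp_unit_measurable) (unfold h_def, measurable)
  have hsq: "(h x)\<^sup>2 \<le> Q c * (syn N y x * syn N y x)" for x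
  proof -
    have "(h x)\<^sup>2 = 1 / (g (syn N c x))\<^sup>2 * (syn N y x * syn N y x)"
      unfolding h_def by (simp add: power_divide power2_eq_square)
    also have "\<dots> \<le> Q c * (syn N y x * syn N y x)" by (intro mult_right_mono Q_upper) simp
    finally show ?thesis .
  qed
  have iy: "integrable unit_interval (\<lambda>x. Q c * (syn N y x * syn N y x))"
    by (intro integrable_unit_continuous continuous_intros)
  have hL: "h \<in> L2_space unit_interval"
    unfolding L2_unit_iff
  proof
    show "integrable unit_interval (\<lambda>x. (h x)\<^sup>2)"
      by (rule Bochner_Integration.integrable_bound[OF iy])
        (use hm hsq in \<open>auto intro!: AE_I2 order_trans[OF hsq abs_ge_self]\<close>)
  qed (rule hm)
  show ?thesis
  proof (intro exI[of _ "\<lambda>k. ip h (b k)"] conjI ballI allI)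
    fix i assume i: "i \<in> {1..N}"
    have "(\<lambda>m. \<Sum>k<m. ip (row c i) (b k) * ip h (b k)) \<longlonglongrightarrow> ip (row c i) h"
      by (rule parseval_bounded[OF b hL row_measurable row_bound])
    moreover have "ip (row c i) h = y i"
    proof -
      have "row c i x * h x = syn N y x * e i x" for x
        unfolding row_def h_def using g_bound[of "syn N c x"] by simp
      then have "ip (row c i) h = ip (syn N y) (e i)" unfolding ip_def by simp
      then show ?thesis unfolding ip_syn_e[OF i] .
    qed
    ultimately show "(\<lambda>m. \<Sum>k<m. v c k i * ip h (b k)) \<longlonglongrightarrow> y i" unfolding v_row[OF i] by simp
  next
    fix m
    have "(\<Sum>k<m. (ip h (b k))\<^sup>2) \<le> ip h h" by (rule bessel_inequality[OF bL on hL])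
    also have "\<dots> \<le> (LINT x|unit_interval. Q c * (syn N y x * syn N y x))"
      unfolding ip_def using hsq by (intro integral_mono integrable_mult_L2 hL iy) (simp add: power2_eq_square)
    also have "\<dots> = Q c * ip (syn N y) (syn N y)" unfolding ip_def by simp
    also have "\<dots> = Q c * sqn N y" unfolding ip_syn_syn sqn_def by (simp add: power2_eq_square)
    finally show "(\<Sum>k<m. (ip h (b k))\<^sup>2) \<le> Q c * sqn N y" .
  qed
qed

end

section \<open>The noise increments\<close>

locale noise_setup = diffusion_term g K6 N b for g K6 N b +
  fixes \<tau> :: real and M :: "'a measure" and Fil :: "real \<Rightarrow> 'a measure" and \<beta> :: "nat \<Rightarrow> real \<Rightarrow> 'a \<Rightarrow> real"
  assumes \<tau>: "0 < \<tau>"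
    and filtered: "complete_filtered_prob_space M Fil"
    and brownian: "independent_Brownian_motions M Fil \<beta>"
begin

sublocale prob_space M
  using filtered unfolding complete_filtered_prob_space_def by blast

abbreviation grid :: "nat \<Rightarrow> real" where "grid j \<equiv> real j * \<tau>"

lemma grid: "0 \<le> grid j" "grid j < grid (Suc j)" "grid (Suc j) - grid j = \<tau>"
  using \<tau> by (auto simp: algebra_simps)

lemma subalg: "0 \<le> t \<Longrightarrow> subalgebra M (Fil t)"
  using filtered unfolding complete_filtered_prob_space_def by blast

lemma Fil_measurable: "h \<in> Fil (grid j) \<rightarrow>\<^sub>M S' \<Longrightarrow> h \<in> M \<rightarrow>\<^sub>M S'"
  by (rule measurable_from_subalg[OF subalg]) (use grid in auto)

lemma space_Fil: "space (Fil (grid j)) = space M" and sets_Fil: "A \<in> sets (Fil (grid j)) \<Longrightarrow> A \<in> sets M"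
  using subalg[of "grid j"] grid unfolding subalgebra_def by auto

definition inc :: "nat \<Rightarrow> 'a \<Rightarrow> nat \<Rightarrow> real" where
  "inc j \<omega> k = \<beta> k (grid (Suc j)) \<omega> - \<beta> k (grid j) \<omega>"

lemma measurable_inc_coord: "(\<lambda>\<omega>. inc j \<omega> k) \<in> borel_measurable M"
proof -
  have "\<beta> k (grid i) \<in> borel_measurable M" for i
    using brownian grid(1)[of i] Fil_measurable[of "\<beta> k (grid i)" i] unfolding independent_Brownian_motions_def by blast
  then show ?thesis unfolding inc_def by (intro borel_measurable_diff)
qed

lemma measurable_inc[measurable]: "inc j \<in> M \<rightarrow>\<^sub>M borel"
  by (rule measurable_coordinatewise_then_product) (rule measurable_inc_coord)

text \<open>Joint independence identifies the law of the increment sequence with the product of its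
  Gaussian marginals of variance \<open>\<tau>\<close>. The product sigma-algebra on sequences is
  the Borel one, so this product may be read as \<open>white\<close>.\<close>

lemma distr_inc: "distr M borel (inc j) = white (sqrt \<tau>)"
proof -
  have iv: "indep_vars (\<lambda>_. borel) (\<lambda>k \<omega>. inc j \<omega> k) UNIV"
    using brownian grid(1,2)[of j] unfolding independent_Brownian_motions_def inc_def by blast
  have marg: "distr M borel (\<lambda>\<omega>. inc j \<omega> k) = gauss (sqrt \<tau>)" for k
  proof -
    have "distributed M lborel (\<lambda>\<omega>. inc j \<omega> k) (normal_density 0 (sqrt (grid (Suc j) - grid j)))"
      using brownian grid(1,2)[of j] unfolding independent_Brownian_motions_def inc_def by blast
    then have "distributed M lborel (\<lambda>\<omega>. inc j \<omega> k) (normal_density 0 (sqrt \<tau>))"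
      unfolding grid(3) .
    then have "distr M lborel (\<lambda>\<omega>. inc j \<omega> k) = gauss (sqrt \<tau>)"
      unfolding distributed_def gauss_def by blast
    moreover have "distr M lborel (\<lambda>\<omega>. inc j \<omega> k) = distr M borel (\<lambda>\<omega>. inc j \<omega> k)"
      by (rule distr_cong) auto
    ultimately show ?thesis by simp
  qed
  have "distr M (PiM UNIV (\<lambda>_. borel)) (\<lambda>\<omega>. \<lambda>k\<in>UNIV. inc j \<omega> k) = PiM UNIV (\<lambda>k. distr M borel (\<lambda>\<omega>. inc j \<omega> k))"
    using iv measurable_inc_coord by (subst (asm) indep_vars_iff_distr_eq_PiM) auto
  then have eq: "distr M (PiM UNIV (\<lambda>_. borel)) (inc j) = PiM UNIV (\<lambda>_. gauss (sqrt \<tau>))"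
    unfolding marg by (simp add: restrict_def)
  have incP: "inc j \<in> M \<rightarrow>\<^sub>M PiM UNIV (\<lambda>_::nat. borel)"
    using measurable_inc unfolding measurable_cong_sets[OF refl sets_PiM_equal_borel] .
  have id: "(\<lambda>x. x) \<in> PiM UNIV (\<lambda>_::nat. borel) \<rightarrow>\<^sub>M (borel :: (nat \<Rightarrow> real) measure)"
    unfolding measurable_cong_sets[OF sets_PiM_equal_borel refl] by simp
  show ?thesis
    unfolding white_def eq[symmetric] distr_distr[OF id incP] comp_def ..
qed

text \<open>Events of \<open>Fil (grid j)\<close> are independent of the increment sequence as a
  whole, so the two measures agree on rectangles and hence on the product.\<close>

lemma indep_inc:
  assumes Y: "Y \<in> Fil (grid j) \<rightarrow>\<^sub>M S'"
  shows "distr M (S' \<Otimes>\<^sub>M borel) (\<lambda>\<omega>. (Y \<omega>, inc j \<omega>)) = distr M S' Y \<Otimes>\<^sub>M white (sqrt \<tau>)"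
proof -
  have YM[measurable]: "Y \<in> M \<rightarrow>\<^sub>M S'" by (rule Fil_measurable[OF Y])
  let ?G = "sets (vimage_algebra (space M) (inc j) (PiM UNIV (\<lambda>_::nat. borel)))"
  have "indep_set (sets (Fil (grid j))) ?G"
    using brownian grid(1,2)[of j] unfolding independent_Brownian_motions_def inc_def[abs_def] by blast
  then have ind: "prob (A \<inter> B) = prob A * prob B" if "A \<in> sets (Fil (grid j))" "B \<in> ?G" for A B
    using indep_setD that by blast
  interpret D1: prob_space "distr M S' Y" by (rule prob_space_distr[OF YM])
  interpret D2: prob_space "white (sqrt \<tau>)" by (rule prob_space_white) (use \<tau> in simp)
  have "distr M S' Y \<Otimes>\<^sub>M white (sqrt \<tau>) = distr M (S' \<Otimes>\<^sub>M borel) (\<lambda>\<omega>. (Y \<omega>, inc j \<omega>))"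
  proof (rule pair_measure_eqI)
    show "sets (distr M S' Y \<Otimes>\<^sub>M white (sqrt \<tau>)) = sets (distr M (S' \<Otimes>\<^sub>M borel) (\<lambda>\<omega>. (Y \<omega>, inc j \<omega>)))"
      using sets_pair_measure_cong[of "distr M S' Y" S' "white (sqrt \<tau>)" borel] by simp
    fix A B assume "A \<in> sets (distr M S' Y)" "B \<in> sets (white (sqrt \<tau>))"
    then have A: "A \<in> sets S'" and B: "B \<in> sets borel" by auto
    have 1: "Y -` A \<inter> space M \<in> sets (Fil (grid j))" using measurable_sets[OF Y A] unfolding space_Fil .
    have 2: "inc j -` B \<inter> space M \<in> ?G"
      by (rule in_vimage_algebra) (use B sets_PiM_equal_borel in blast)
    have "emeasure (distr M (S' \<Otimes>\<^sub>M borel) (\<lambda>\<omega>. (Y \<omega>, inc j \<omega>))) (A \<times> B)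
      = emeasure M ((\<lambda>\<omega>. (Y \<omega>, inc j \<omega>)) -` (A \<times> B) \<inter> space M)"
      using A B by (intro emeasure_distr) auto
    also have "(\<lambda>\<omega>. (Y \<omega>, inc j \<omega>)) -` (A \<times> B) \<inter> space M = (Y -` A \<inter> space M) \<inter> (inc j -` B \<inter> space M)" by auto
    also have "emeasure M \<dots> = emeasure M (Y -` A \<inter> space M) * emeasure M (inc j -` B \<inter> space M)"
      using ind[OF 1 2] by (simp add: emeasure_eq_measure ennreal_mult')
    also have "\<dots> = emeasure (distr M S' Y) A * emeasure (white (sqrt \<tau>)) B"
      unfolding distr_inc[of j, symmetric] using A B by (simp add: emeasure_distr)
    finally show "emeasure (distr M S' Y) A * emeasure (white (sqrt \<tau>)) B
      = emeasure (distr M (S' \<Otimes>\<^sub>M borel) (\<lambda>\<omega>. (Y \<omega>, inc j \<omega>))) (A \<times> B)" by simp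
  qed unfold_locales
  then show ?thesis by simp
qed

text \<open>Given the past, the increments may be replaced by an independent white noise while
  \<open>Y\<close> is held fixed; this is Fubini for the product law of
  \<open>indep_inc\<close>.\<close>

lemma freezing:
  fixes \<psi> :: "'b \<times> (nat \<Rightarrow> real) \<Rightarrow> real"
  assumes Y: "Y \<in> Fil (grid j) \<rightarrow>\<^sub>M S'" and \<psi>: "\<psi> \<in> borel_measurable (S' \<Otimes>\<^sub>M borel)" and bd: "\<And>z. \<bar>\<psi> z\<bar> \<le> 1"
  shows "(LINT \<omega>|M. \<psi> (Y \<omega>, inc j \<omega>)) = (LINT \<omega>|M. LINT s|white (sqrt \<tau>). \<psi> (Y \<omega>, s))"
proof -
  have YM[measurable]: "Y \<in> M \<rightarrow>\<^sub>M S'" by (rule Fil_measurable[OF Y])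
  interpret D1: prob_space "distr M S' Y" by (rule prob_space_distr[OF YM])
  interpret D2: prob_space "white (sqrt \<tau>)" by (rule prob_space_white) (use \<tau> in simp)
  interpret pp: pair_prob_space "distr M S' Y" "white (sqrt \<tau>)" ..
  have sc: "sets (S' \<Otimes>\<^sub>M white (sqrt \<tau>)) = sets (S' \<Otimes>\<^sub>M borel)" by (rule sets_pair_measure_cong) auto
  have \<psi>1: "\<psi> \<in> borel_measurable (S' \<Otimes>\<^sub>M white (sqrt \<tau>))" using \<psi> unfolding measurable_cong_sets[OF sc refl] .
  have sc2: "sets (distr M S' Y \<Otimes>\<^sub>M white (sqrt \<tau>)) = sets (S' \<Otimes>\<^sub>M borel)" by (rule sets_pair_measure_cong) auto
  have \<psi>2: "\<psi> \<in> borel_measurable (distr M S' Y \<Otimes>\<^sub>M white (sqrt \<tau>))" using \<psi> unfolding measurable_cong_sets[OF sc2 refl] .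
  have i: "integrable (distr M S' Y \<Otimes>\<^sub>M white (sqrt \<tau>)) \<psi>"
    by (rule pp.integrable_const_bound[where B = 1]) (use bd \<psi>2 in auto)
  have m: "(\<lambda>y. LINT s|white (sqrt \<tau>). \<psi> (y, s)) \<in> borel_measurable S'"
    using \<psi>1 by (intro D2.borel_measurable_lebesgue_integral) simp
  have "(LINT \<omega>|M. \<psi> (Y \<omega>, inc j \<omega>)) = (LINT z|distr M (S' \<Otimes>\<^sub>M borel) (\<lambda>\<omega>. (Y \<omega>, inc j \<omega>)). \<psi> z)"
    by (rule integral_distr[symmetric]) (use \<psi> in auto)
  also have "\<dots> = integral\<^sup>L (distr M S' Y \<Otimes>\<^sub>M white (sqrt \<tau>)) \<psi>" unfolding indep_inc[OF Y] ..
  also have "\<dots> = (LINT y|distr M S' Y. LINT s|white (sqrt \<tau>). \<psi> (y, s))"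
    by (rule pp.integral_fst'[OF i, symmetric])
  also have "\<dots> = (LINT \<omega>|M. LINT s|white (sqrt \<tau>). \<psi> (Y \<omega>, s))"
    by (rule integral_distr[OF YM m])
  finally show ?thesis .
qed

text \<open>Coordinates of the explicit part of the scheme, old state plus noise: the data from
  which the implicit equation is solved.\<close>

definition pre :: "('a \<Rightarrow> real \<Rightarrow> real) \<Rightarrow> ('a \<Rightarrow> real \<Rightarrow> real) \<Rightarrow> 'a \<Rightarrow> nat \<Rightarrow> real" where
  "pre Y Z \<omega> i = coef N (Y \<omega>) i + coef N (Z \<omega>) i"

lemma coef_out: "i \<notin> {1..N} \<Longrightarrow> coef N u i = 0"
  unfolding coef_def by (rule if_not_P)

lemma coef_coord_measurable: "Y \<in> A \<rightarrow>\<^sub>M borelVN N \<Longrightarrow> (\<lambda>\<omega>. coef N (Y \<omega>) i) \<in> borel_measurable A"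
  by (rule measurable_compose[OF _ measurable_compose[OF measurable_coef measurable_coordinate]])

lemma measurable_pre:
  assumes "Y \<in> A \<rightarrow>\<^sub>M borelVN N" "Z \<in> A \<rightarrow>\<^sub>M borelVN N"
  shows "pre Y Z \<in> A \<rightarrow>\<^sub>M borel"
proof (rule measurable_coordinatewise_then_product)
  show "(\<lambda>\<omega>. pre Y Z \<omega> i) \<in> borel_measurable A" for i
    unfolding pre_def using coef_coord_measurable[OF assms(1)] coef_coord_measurable[OF assms(2)] by (rule borel_measurable_add)
qed

text \<open>The squared norm of V_N dominates the square of every coordinate, and the partial sums
  of the projected series are sine polynomials with coordinates given by \<open>v\<close>.\<close>

lemma noise_coordinates:
  assumes Y: "Y \<in> M \<rightarrow>\<^sub>M borelVN N" and Z: "noise_increment M b \<beta> g N \<tau> j Y Z" and i: "i \<in> {1..N}"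
  shows "(\<lambda>m. \<integral>\<^sup>+ \<omega>. ennreal (((\<Sum>k<m. v (coef N (Y \<omega>)) k i * inc j \<omega> k) - coef N (Z \<omega>) i)\<^sup>2) \<partial>M) \<longlonglongrightarrow> 0"
proof -
  have ZM: "Z \<in> M \<rightarrow>\<^sub>M borelVN N" using Z unfolding noise_increment_def by blast
  let ?n = "\<lambda>m \<omega>. (nrm (\<lambda>\<xi>. (\<Sum>k<m. PN N (Gop g (Y \<omega>) (b k)) \<xi> * (\<beta> k (real (Suc j) * \<tau>) \<omega> - \<beta> k (real j * \<tau>) \<omega>)) - Z \<omega> \<xi>))\<^sup>2"
  have lim: "(\<lambda>m. \<integral>\<^sup>+ \<omega>. ennreal (?n m \<omega>) \<partial>M) \<longlonglongrightarrow> 0" using Z unfolding noise_increment_def by blast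
  have le: "((\<Sum>k<m. v (coef N (Y \<omega>)) k i * inc j \<omega> k) - coef N (Z \<omega>) i)\<^sup>2 \<le> ?n m \<omega>" if \<omega>: "\<omega> \<in> space M" for m \<omega>
  proof -
    have YV: "Y \<omega> = syn N (coef N (Y \<omega>))" and ZV: "Z \<omega> = syn N (coef N (Z \<omega>))"
      using measurable_space[OF Y \<omega>] measurable_space[OF ZM \<omega>] syn_coef by auto
    have "PN N (Gop g (Y \<omega>) (b k)) = syn N (v (coef N (Y \<omega>)) k)" for k
      by (subst YV) (rule PN_Gop)
    then have "(\<Sum>k<m. PN N (Gop g (Y \<omega>) (b k)) \<xi> * (\<beta> k (real (Suc j) * \<tau>) \<omega> - \<beta> k (real j * \<tau>) \<omega>))
      = syn N (\<lambda>i. \<Sum>k<m. v (coef N (Y \<omega>)) k i * inc j \<omega> k) \<xi>" for \<xi>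
      unfolding syn_def inc_def
      by (simp add: sum_distrib_right sum_distrib_left mult_ac) (rule sum.swap)
    then have "?n m \<omega> = (nrm (\<lambda>\<xi>. syn N (\<lambda>i. \<Sum>k<m. v (coef N (Y \<omega>)) k i * inc j \<omega> k) \<xi> - syn N (coef N (Z \<omega>)) \<xi>))\<^sup>2"
      using ZV by simp
    also have "\<dots> \<ge> \<bar>(\<Sum>k<m. v (coef N (Y \<omega>)) k i * inc j \<omega> k) - coef N (Z \<omega>) i\<bar>\<^sup>2"
      by (intro power_mono abs_coord_le_nrm[OF i, of "\<lambda>i. \<Sum>k<m. v (coef N (Y \<omega>)) k i * inc j \<omega> k" "coef N (Z \<omega>)"]) simp
    finally show ?thesis by simp
  qed
  show ?thesis
    by (rule tendsto_sandwich[OF _ _ tendsto_const lim];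
        intro always_eventually allI nn_integral_mono ennreal_leI le zero_le)
qed

lemma measurable_shift_state:
  assumes Y: "Y \<in> M \<rightarrow>\<^sub>M borelVN N"
  shows "(\<lambda>\<omega>. gauss_shift N v m (coef N (Y \<omega>)) (inc j \<omega>)) \<in> M \<rightarrow>\<^sub>M borel"
proof (rule measurable_coordinatewise_then_product)
  fix i
  have [measurable]: "(\<lambda>\<omega>. v (coef N (Y \<omega>)) k i) \<in> borel_measurable M" for k
    by (rule measurable_compose[OF Y measurable_compose[OF measurable_coef v_measurable]])
  note [measurable] = measurable_inc_coord coef_coord_measurable[OF Y]
  show "(\<lambda>\<omega>. gauss_shift N v m (coef N (Y \<omega>)) (inc j \<omega>) i) \<in> borel_measurable M"
    unfolding gauss_shift_def by measurable
qed

text \<open>Truncations may stand in for the noise under any bounded weight, in particular under the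
  indicator of an event of the past.\<close>

lemma noise_limit:
  assumes Y: "Y \<in> M \<rightarrow>\<^sub>M borelVN N" and Z: "noise_increment M b \<beta> g N \<tau> j Y Z"
    and \<phi>: "test_fun L \<phi>" and w: "w \<in> borel_measurable M" "\<And>\<omega>. \<bar>w \<omega>\<bar> \<le> 1"
  shows "(\<lambda>m. LINT \<omega>|M. w \<omega> * \<phi> (gauss_shift N v m (coef N (Y \<omega>)) (inc j \<omega>))) \<longlonglongrightarrow> (LINT \<omega>|M. w \<omega> * \<phi> (pre Y Z \<omega>))"
proof (rule tendsto_expectation_test_fun[OF prob_space_axioms _ _ _ _ \<phi> w])
  have ZM: "Z \<in> M \<rightarrow>\<^sub>M borelVN N" using Z unfolding noise_increment_def by blast
  show "pre Y Z \<in> M \<rightarrow>\<^sub>M borel" by (rule measurable_pre[OF Y ZM])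
  show "(\<lambda>\<omega>. gauss_shift N v m (coef N (Y \<omega>)) (inc j \<omega>)) \<in> M \<rightarrow>\<^sub>M borel" for m
    by (rule measurable_shift_state[OF Y])
  show "gauss_shift N v m (coef N (Y \<omega>)) (inc j \<omega>) i = pre Y Z \<omega> i" if "i \<notin> {1..N}" for m \<omega> i
    unfolding gauss_shift_def pre_def coef_out[OF that] if_not_P[OF that] by simp
  show "(\<lambda>m. \<integral>\<^sup>+ \<omega>. ennreal ((gauss_shift N v m (coef N (Y \<omega>)) (inc j \<omega>) i - pre Y Z \<omega> i)\<^sup>2) \<partial>M) \<longlonglongrightarrow> 0"
    if i: "i \<in> {1..N}" for i
  proof -
    have "gauss_shift N v m (coef N (Y \<omega>)) (inc j \<omega>) i - pre Y Z \<omega> i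
      = (\<Sum>k<m. v (coef N (Y \<omega>)) k i * inc j \<omega> k) - coef N (Z \<omega>) i" for m \<omega>
      unfolding gauss_shift_def pre_def if_P[OF i] by simp
    then show ?thesis using noise_coordinates[OF Y Z i] by simp
  qed
qed

end

text \<open>\<open>Z0 c\<close> is a version of the noise over the first time step with the state
  held at \<open>c\<close>, and its law defines \<open>\<kappa> c\<close>. As all increments have
  the same law, the kernel built from the first step serves every later one.\<close>

locale noise_family = noise_setup g K6 N b \<tau> M Fil \<beta> for g K6 N b \<tau> M Fil \<beta> +
  fixes Z0 :: "(nat \<Rightarrow> real) \<Rightarrow> 'a \<Rightarrow> real \<Rightarrow> real"
  assumes Z0: "\<And>c. noise_increment M b \<beta> g N \<tau> 0 (\<lambda>_. syn N c) (Z0 c)"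
begin

definition \<kappa> :: "(nat \<Rightarrow> real) \<Rightarrow> (nat \<Rightarrow> real) measure" where
  "\<kappa> c = distr M borel (pre (\<lambda>_. syn N c) (Z0 c))"

lemma Z0_measurable: "Z0 c \<in> M \<rightarrow>\<^sub>M borelVN N"
  using Z0 unfolding noise_increment_def by blast

lemma measurable_pre0: "pre (\<lambda>_. syn N c) (Z0 c) \<in> M \<rightarrow>\<^sub>M borel"
  by (rule measurable_pre[OF _ Z0_measurable]) simp

lemma gauss_shift_coef: "gauss_shift N v m (coef N (syn N c)) = gauss_shift N v m c"
proof -
  have "v (coef N (syn N c)) = v c" by (rule v_cong) (simp add: syn_coef)
  then show ?thesis unfolding gauss_shift_def coef_syn by (auto intro!: ext)
qed

lemma coef_pre0: "i \<in> {1..N} \<Longrightarrow> pre (\<lambda>_. syn N c) (Z0 c) \<omega> i = c i + coef N (Z0 c \<omega>) i"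
  unfolding pre_def coef_syn by simp

sublocale gaussian_kernel N "sqrt \<tau>" v \<kappa>
proof (rule gaussian_kernel.intro)
  show "0 < sqrt \<tau>" using \<tau> by simp
  show "(\<lambda>c. v c k i) \<in> borel_measurable borel" for k i by (rule v_measurable)
  show "prob_space (\<kappa> c)" for c unfolding \<kappa>_def by (rule prob_space_distr[OF measurable_pre0])
  show "sets (\<kappa> c) = sets borel" for c unfolding \<kappa>_def by simp
  show "AE u in \<kappa> c. \<forall>i. i \<notin> {1..N} \<longrightarrow> u i = 0" for c
  proof -
    have "{u :: nat \<Rightarrow> real. \<forall>i. i \<notin> {1..N} \<longrightarrow> u i = 0} = (\<Inter>i \<in> - {1..N}. {u. u i = 0})" by auto
    moreover have "closed {u :: nat \<Rightarrow> real. u i = 0}" for i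
      by (intro closed_Collect_eq continuous_intros continuous_on_product_coordinates)
    ultimately have "closed {u :: nat \<Rightarrow> real. \<forall>i. i \<notin> {1..N} \<longrightarrow> u i = 0}" by (simp add: closed_INT)
    then have "{u \<in> space borel. \<forall>i. i \<notin> {1..N} \<longrightarrow> (u :: nat \<Rightarrow> real) i = 0} \<in> sets borel" by simp
    then show ?thesis
      unfolding \<kappa>_def by (subst AE_distr_iff[OF measurable_pre0]) (auto simp: pre_def coef_out)
  qed
  show "(\<lambda>m. LINT s|white (sqrt \<tau>). \<phi> (gauss_shift N v m c s)) \<longlonglongrightarrow> (LINT u|\<kappa> c. \<phi> u)"
    if \<phi>: "test_fun L \<phi>" for L \<phi> c
  proof -
    have S: "(\<lambda>_. syn N c) \<in> M \<rightarrow>\<^sub>M borelVN N" by simp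
    have 1: "(LINT \<omega>|M. 1 * \<phi> (gauss_shift N v m (coef N (syn N c)) (inc 0 \<omega>)))
      = (LINT s|white (sqrt \<tau>). \<phi> (gauss_shift N v m c s))" for m
    proof -
      have "gauss_shift N v m c \<in> borel \<rightarrow>\<^sub>M borel"
      proof (rule measurable_coordinatewise_then_product)
        fix i
        have [measurable]: "(\<lambda>s::nat \<Rightarrow> real. s k) \<in> borel_measurable borel" for k by (rule measurable_coordinate)
        show "(\<lambda>s. gauss_shift N v m c s i) \<in> borel_measurable borel" unfolding gauss_shift_def by measurable
      qed
      from measurable_compose[OF this test_fun_measurable[OF \<phi>]]
      show ?thesis unfolding distr_inc[of 0, symmetric] gauss_shift_coef
        by (subst integral_distr[OF measurable_inc]) simp_all
    qed
    have 2: "(LINT \<omega>|M. 1 * \<phi> (pre (\<lambda>_. syn N c) (Z0 c) \<omega>)) = (LINT u|\<kappa> c. \<phi> u)"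
      unfolding \<kappa>_def using integral_distr[OF measurable_pre0 test_fun_measurable[OF \<phi>]] by simp
    show ?thesis using noise_limit[OF S Z0 \<phi>, of "\<lambda>_. 1"] unfolding 1 2 by simp
  qed
qed

text \<open>A crude variance bound for \<open>N\<close> coordinates, each of which contributes twice
  the second moment of a truncation, 2 * \<tau> * 2 * K6^2, plus twice a truncation error below
  1.\<close>

definition noise_var :: real where "noise_var = real N * (2 + 4 * \<tau> * K6\<^sup>2)"

lemma noise_var_nonneg: "0 \<le> noise_var" unfolding noise_var_def using \<tau> by simp

lemma noise_second_moment: "(\<integral>\<^sup>+ \<omega>. ennreal (sqn N (coef N (Z0 c \<omega>))) \<partial>M) \<le> ennreal noise_var"
proof -
  have S: "(\<lambda>_. syn N c) \<in> M \<rightarrow>\<^sub>M borelVN N" by simp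
  note [measurable] = coef_coord_measurable[OF Z0_measurable] measurable_inc_coord
  have one: "(\<integral>\<^sup>+ \<omega>. ennreal ((coef N (Z0 c \<omega>) i)\<^sup>2) \<partial>M) \<le> ennreal (2 + 4 * \<tau> * K6\<^sup>2)" if i: "i \<in> {1..N}" for i
  proof -
    let ?S = "\<lambda>m \<omega>. \<Sum>k<m. v (coef N (syn N c)) k i * inc 0 \<omega> k"
    have lim: "(\<lambda>m. \<integral>\<^sup>+ \<omega>. ennreal ((?S m \<omega> - coef N (Z0 c \<omega>) i)\<^sup>2) \<partial>M) \<longlonglongrightarrow> 0"
      by (rule noise_coordinates[OF S Z0 i])
    \<comment> \<open>A single truncation with error below 1 gives a bound uniform in
      \<open>c\<close>: \<open>m\<close> may depend on \<open>c\<close>, but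
      \<open>sum_v_square_le\<close> does not depend on \<open>m\<close>.\<close>
    obtain m where m: "(\<integral>\<^sup>+ \<omega>. ennreal ((?S m \<omega> - coef N (Z0 c \<omega>) i)\<^sup>2) \<partial>M) < 1"
      using order_tendstoD(2)[OF lim, of 1] by (auto simp: eventually_at_top_linorder)
    have S2: "(\<integral>\<^sup>+ \<omega>. ennreal ((?S m \<omega>)\<^sup>2) \<partial>M) \<le> ennreal (\<tau> * (2 * K6\<^sup>2))"
    proof -
      have [measurable]: "(\<lambda>s::nat \<Rightarrow> real. s k) \<in> borel_measurable borel" for k by (rule measurable_coordinate)
      have "(\<integral>\<^sup>+ \<omega>. ennreal ((?S m \<omega>)\<^sup>2) \<partial>M)
        = (\<integral>\<^sup>+ s. ennreal ((0 + (\<Sum>k<m. v (coef N (syn N c)) k i * s k))\<^sup>2) \<partial>white (sqrt \<tau>))"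
        unfolding distr_inc[of 0, symmetric] by (subst nn_integral_distr[OF measurable_inc]) simp_all
      also have "\<dots> = ennreal (0\<^sup>2 + (sqrt \<tau>)\<^sup>2 * (\<Sum>k<m. (v (coef N (syn N c)) k i)\<^sup>2))"
        by (rule nn_integral_linear_square_white) (use \<tau> in simp)
      also have "\<dots> \<le> ennreal (\<tau> * (2 * K6\<^sup>2))"
        using \<tau> sum_v_square_le by (intro ennreal_leI) (simp add: mult_left_mono)
      finally show ?thesis .
    qed
    have "(\<integral>\<^sup>+ \<omega>. ennreal ((coef N (Z0 c \<omega>) i)\<^sup>2) \<partial>M)
      \<le> (\<integral>\<^sup>+ \<omega>. 2 * ennreal ((?S m \<omega> - coef N (Z0 c \<omega>) i)\<^sup>2) + 2 * ennreal ((?S m \<omega>)\<^sup>2) \<partial>M)"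
    proof (rule nn_integral_mono)
      fix \<omega>
      have "z\<^sup>2 \<le> 2 * (s - z)\<^sup>2 + 2 * s\<^sup>2" for z s :: real
      proof -
        have "0 \<le> (z - 2 * s)\<^sup>2" by simp
        then show ?thesis by (simp add: power2_eq_square algebra_simps)
      qed
      then have "ennreal ((coef N (Z0 c \<omega>) i)\<^sup>2) \<le> ennreal (2 * (?S m \<omega> - coef N (Z0 c \<omega>) i)\<^sup>2 + 2 * (?S m \<omega>)\<^sup>2)"
        by (rule ennreal_leI)
      also have "\<dots> = 2 * ennreal ((?S m \<omega> - coef N (Z0 c \<omega>) i)\<^sup>2) + 2 * ennreal ((?S m \<omega>)\<^sup>2)"
        by (simp add: ennreal_plus ennreal_mult')
      finally show "ennreal ((coef N (Z0 c \<omega>) i)\<^sup>2) \<le> 2 * ennreal ((?S m \<omega> - coef N (Z0 c \<omega>) i)\<^sup>2) + 2 * ennreal ((?S m \<omega>)\<^sup>2)" .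
    qed
    also have "\<dots> = 2 * (\<integral>\<^sup>+ \<omega>. ennreal ((?S m \<omega> - coef N (Z0 c \<omega>) i)\<^sup>2) \<partial>M) + 2 * (\<integral>\<^sup>+ \<omega>. ennreal ((?S m \<omega>)\<^sup>2) \<partial>M)"
      by (subst nn_integral_add) (auto simp: nn_integral_cmult)
    also have "\<dots> \<le> 2 * 1 + 2 * ennreal (\<tau> * (2 * K6\<^sup>2))"
      using m S2 by (intro add_mono mult_left_mono) auto
    also have "\<dots> = ennreal (2 + 4 * \<tau> * K6\<^sup>2)"
    proof -
      have "ennreal (2 + 4 * \<tau> * K6\<^sup>2) = ennreal 2 + ennreal (2 * (\<tau> * (2 * K6\<^sup>2)))"
        using \<tau> by (subst ennreal_plus[symmetric]) auto
      also have "ennreal (2 * (\<tau> * (2 * K6\<^sup>2))) = 2 * ennreal (\<tau> * (2 * K6\<^sup>2))"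
        by (subst ennreal_mult') auto
      finally show ?thesis by simp
    qed
    finally show ?thesis .
  qed
  have "(\<integral>\<^sup>+ \<omega>. ennreal (sqn N (coef N (Z0 c \<omega>))) \<partial>M) = (\<integral>\<^sup>+ \<omega>. (\<Sum>i = 1..N. ennreal ((coef N (Z0 c \<omega>) i)\<^sup>2)) \<partial>M)"
    unfolding sqn_def by (intro nn_integral_cong) simp
  also have "\<dots> = (\<Sum>i = 1..N. \<integral>\<^sup>+ \<omega>. ennreal ((coef N (Z0 c \<omega>) i)\<^sup>2) \<partial>M)"
    by (rule nn_integral_sum) measurable
  also have "\<dots> \<le> (\<Sum>i = 1..N. ennreal (2 + 4 * \<tau> * K6\<^sup>2))" by (rule sum_mono) (rule one)
  also have "\<dots> = ennreal noise_var"
    unfolding noise_var_def using \<tau> by (simp add: ennreal_mult' ennreal_of_nat_eq_real_of_nat)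
  finally show ?thesis .
qed

text \<open>Young's inequality absorbs the cross term between state and noise at the price of a
  factor 1 + \<eta> on the state. Two values are used: \<eta> = 1 for the overlap estimate, and one
  small enough to leave part of the dissipation for the Lyapunov drift.\<close>

lemma kernel_second_moment:
  assumes \<eta>: "\<eta> > 0"
  shows "(\<integral>\<^sup>+ u. ennreal (sqn N u) \<partial>\<kappa> c) \<le> ennreal ((1 + \<eta>) * sqn N c + (1 + 1 / \<eta>) * noise_var)"
proof -
  have [measurable]: "(\<lambda>\<omega>. sqn N (coef N (Z0 c \<omega>))) \<in> borel_measurable M"
    by (rule measurable_compose[OF measurable_compose[OF Z0_measurable measurable_coef] sqn_measurable])
  have young: "(p + r)\<^sup>2 \<le> (1 + \<eta>) * p\<^sup>2 + (1 + 1 / \<eta>) * r\<^sup>2" for p r :: real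
  proof -
    have "0 \<le> (sqrt \<eta> * p - r / sqrt \<eta>)\<^sup>2" by simp
    also have "\<dots> = \<eta> * p\<^sup>2 - 2 * p * r + r\<^sup>2 / \<eta>"
      using \<eta> by (simp add: power2_diff power_mult_distrib power_divide)
    finally show ?thesis by (simp add: power2_sum algebra_simps)
  qed
  have pt: "sqn N (pre (\<lambda>_. syn N c) (Z0 c) \<omega>) \<le> (1 + \<eta>) * sqn N c + (1 + 1 / \<eta>) * sqn N (coef N (Z0 c \<omega>))" for \<omega>
    unfolding sqn_def sum_distrib_left sum.distrib[symmetric]
    by (intro sum_mono) (use coef_pre0 young in simp)
  have "(\<integral>\<^sup>+ u. ennreal (sqn N u) \<partial>\<kappa> c) = (\<integral>\<^sup>+ \<omega>. ennreal (sqn N (pre (\<lambda>_. syn N c) (Z0 c) \<omega>)) \<partial>M)"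
    unfolding \<kappa>_def by (subst nn_integral_distr[OF measurable_pre0]) simp_all
  also have "\<dots> \<le> (\<integral>\<^sup>+ \<omega>. ennreal ((1 + \<eta>) * sqn N c) + ennreal (1 + 1 / \<eta>) * ennreal (sqn N (coef N (Z0 c \<omega>))) \<partial>M)"
  proof (rule nn_integral_mono)
    fix \<omega>
    have "ennreal (sqn N (pre (\<lambda>_. syn N c) (Z0 c) \<omega>)) \<le> ennreal ((1 + \<eta>) * sqn N c + (1 + 1 / \<eta>) * sqn N (coef N (Z0 c \<omega>)))"
      by (rule ennreal_leI[OF pt])
    also have "\<dots> = ennreal ((1 + \<eta>) * sqn N c) + ennreal (1 + 1 / \<eta>) * ennreal (sqn N (coef N (Z0 c \<omega>)))"
      using \<eta> by (subst ennreal_plus) (auto simp: ennreal_mult'')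
    finally show "ennreal (sqn N (pre (\<lambda>_. syn N c) (Z0 c) \<omega>)) \<le> ennreal ((1 + \<eta>) * sqn N c) + ennreal (1 + 1 / \<eta>) * ennreal (sqn N (coef N (Z0 c \<omega>)))" .
  qed
  also have "\<dots> = (\<integral>\<^sup>+ \<omega>. ennreal ((1 + \<eta>) * sqn N c) \<partial>M) + (\<integral>\<^sup>+ \<omega>. ennreal (1 + 1 / \<eta>) * ennreal (sqn N (coef N (Z0 c \<omega>))) \<partial>M)"
    by (rule nn_integral_add) measurable
  also have "(\<integral>\<^sup>+ \<omega>. ennreal ((1 + \<eta>) * sqn N c) \<partial>M) = ennreal ((1 + \<eta>) * sqn N c)"
    by (simp only: nn_integral_const emeasure_space_1 mult_1_right)
  also have "(\<integral>\<^sup>+ \<omega>. ennreal (1 + 1 / \<eta>) * ennreal (sqn N (coef N (Z0 c \<omega>))) \<partial>M)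
    = ennreal (1 + 1 / \<eta>) * (\<integral>\<^sup>+ \<omega>. ennreal (sqn N (coef N (Z0 c \<omega>))) \<partial>M)"
    by (rule nn_integral_cmult) measurable
  also have "ennreal ((1 + \<eta>) * sqn N c) + ennreal (1 + 1 / \<eta>) * (\<integral>\<^sup>+ \<omega>. ennreal (sqn N (coef N (Z0 c \<omega>))) \<partial>M)
    \<le> ennreal ((1 + \<eta>) * sqn N c) + ennreal (1 + 1 / \<eta>) * ennreal noise_var"
    by (intro add_left_mono mult_left_mono noise_second_moment) simp
  also have "\<dots> = ennreal ((1 + \<eta>) * sqn N c + (1 + 1 / \<eta>) * noise_var)"
    using \<eta> noise_var_nonneg by (subst ennreal_plus) (auto simp: ennreal_mult'')
  finally show ?thesis .
qed

sublocale nondegenerate_gaussian_kernel N "sqrt \<tau>" v \<kappa> Q "2 * noise_var"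
proof
  show "(\<integral>\<^sup>+ u. ennreal (sqn N u) \<partial>\<kappa> c) \<le> ennreal (2 * sqn N c + 2 * noise_var)" for c
    using kernel_second_moment[of 1 c] by simp
qed (use control Q_bounded noise_var_nonneg in auto)

text \<open>For a truncation and a test function this is \<open>freezing\<close>, with the indicator
  of \<open>D\<close> frozen along with the state. Both sides pass to the limit in \<open>m\<close>,
  and finite measures that agree on test functions coincide, which gives Borel sets.\<close>

lemma noise_markov:
  assumes Y: "Y \<in> Fil (grid j) \<rightarrow>\<^sub>M borelVN N" and Z: "noise_increment M b \<beta> g N \<tau> j Y Z"
    and D: "D \<in> sets (Fil (grid j))" and A: "A \<in> sets borel"
  shows "(LINT \<omega>|M. indicator D \<omega> * indicator A (pre Y Z \<omega>)) = (LINT \<omega>|M. indicator D \<omega> * measure (\<kappa> (coef N (Y \<omega>))) A)"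
proof -
  have YM: "Y \<in> M \<rightarrow>\<^sub>M borelVN N" by (rule Fil_measurable[OF Y])
  have ZM: "Z \<in> M \<rightarrow>\<^sub>M borelVN N" using Z unfolding noise_increment_def by blast
  have DM[measurable]: "D \<in> sets M" by (rule sets_Fil[OF D])
  have cY: "(\<lambda>\<omega>. coef N (Y \<omega>)) \<in> M \<rightarrow>\<^sub>M borel" by (rule measurable_compose[OF YM measurable_coef])
  have preM[measurable]: "pre Y Z \<in> M \<rightarrow>\<^sub>M borel" by (rule measurable_pre[OF YM ZM])
  let ?w = "indicator D :: 'a \<Rightarrow> real"
  have test: "(LINT \<omega>|M. ?w \<omega> * \<phi> (pre Y Z \<omega>)) = (LINT \<omega>|M. ?w \<omega> * (LINT u|\<kappa> (coef N (Y \<omega>)). \<phi> u))"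
    if \<phi>: "test_fun L \<phi>" for L \<phi>
  proof -
    interpret W: prob_space "white (sqrt \<tau>)" by (rule prob_space_white) (use \<tau> in simp)
    have lim1: "(\<lambda>m. LINT \<omega>|M. ?w \<omega> * \<phi> (gauss_shift N v m (coef N (Y \<omega>)) (inc j \<omega>))) \<longlonglongrightarrow> (LINT \<omega>|M. ?w \<omega> * \<phi> (pre Y Z \<omega>))"
      by (rule noise_limit[OF YM Z \<phi>]) (auto simp: indicator_def)
    let ?H = "\<lambda>m c. LINT s|white (sqrt \<tau>). \<phi> (gauss_shift N v m c s)"
    have eq: "(LINT \<omega>|M. ?w \<omega> * \<phi> (gauss_shift N v m (coef N (Y \<omega>)) (inc j \<omega>))) = (LINT \<omega>|M. ?w \<omega> * ?H m (coef N (Y \<omega>)))" for m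
    proof -
      let ?Y' = "\<lambda>\<omega>. (coef N (Y \<omega>), ?w \<omega>)"
      let ?\<psi> = "\<lambda>z. snd (fst z) * \<phi> (gauss_shift N v m (fst (fst z)) (snd z))"
      \<comment> \<open>\<open>freezing\<close> asks for a bound at all arguments, but the component
        in the place of the indicator ranges over all reals. Clamping to [-1,1] provides the bound
        and does not change the values that occur.\<close>
      let ?\<psi>' = "\<lambda>z. max (- 1) (min 1 (?\<psi> z))"
      have Y': "?Y' \<in> Fil (grid j) \<rightarrow>\<^sub>M borel \<Otimes>\<^sub>M borel"
        using measurable_compose[OF Y measurable_coef] D by (intro measurable_Pair) auto
      have "(\<lambda>z. \<phi> (gauss_shift N v m (fst (fst z)) (snd z))) \<in> borel_measurable ((borel \<Otimes>\<^sub>M (borel :: real measure)) \<Otimes>\<^sub>M borel)"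
      proof -
        have "(\<lambda>z. (fst (fst z), snd z)) \<in> (borel \<Otimes>\<^sub>M (borel :: real measure)) \<Otimes>\<^sub>M (borel :: (nat \<Rightarrow> real) measure) \<rightarrow>\<^sub>M (borel :: (nat \<Rightarrow> real) measure) \<Otimes>\<^sub>M borel"
          by measurable
        from measurable_compose[OF this measurable_compose[OF measurable_gauss_shift test_fun_measurable[OF \<phi>]]]
        show ?thesis by simp
      qed
      then have \<psi>: "?\<psi>' \<in> borel_measurable ((borel \<Otimes>\<^sub>M borel) \<Otimes>\<^sub>M borel)" by measurable
      have cut: "?\<psi>' (?Y' \<omega>, s) = ?w \<omega> * \<phi> (gauss_shift N v m (coef N (Y \<omega>)) s)" for \<omega> s
        using test_funD(2,3)[OF \<phi>, of "gauss_shift N v m (coef N (Y \<omega>)) s"] by (cases "\<omega> \<in> D") auto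
      have "(LINT \<omega>|M. ?\<psi>' (?Y' \<omega>, inc j \<omega>)) = (LINT \<omega>|M. LINT s|white (sqrt \<tau>). ?\<psi>' (?Y' \<omega>, s))"
        by (rule freezing[OF Y' \<psi>]) auto
      then show ?thesis unfolding cut by simp
    qed
    have lim2: "(\<lambda>m. LINT \<omega>|M. ?w \<omega> * ?H m (coef N (Y \<omega>))) \<longlonglongrightarrow> (LINT \<omega>|M. ?w \<omega> * (LINT u|\<kappa> (coef N (Y \<omega>)). \<phi> u))"
    proof (rule integral_dominated_convergence[where w = "\<lambda>_. 1"])
      show "AE \<omega> in M. (\<lambda>m. ?w \<omega> * ?H m (coef N (Y \<omega>))) \<longlonglongrightarrow> ?w \<omega> * (LINT u|\<kappa> (coef N (Y \<omega>)). \<phi> u)"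
        by (intro AE_I2 tendsto_mult tendsto_const \<kappa>_lim[OF \<phi>])
      have Hm: "?H m \<in> borel_measurable borel" for m
      proof (intro W.borel_measurable_lebesgue_integral)
        have "(\<lambda>z. \<phi> (gauss_shift N v m (fst z) (snd z))) \<in> borel_measurable (borel \<Otimes>\<^sub>M white (sqrt \<tau>))"
          using measurable_compose[OF measurable_gauss_shift test_fun_measurable[OF \<phi>]]
          by (subst measurable_cong_sets[OF sets_pair_measure_cong[OF refl sets_white] refl])
        then show "(\<lambda>(c, s). \<phi> (gauss_shift N v m c s)) \<in> borel_measurable (borel \<Otimes>\<^sub>M white (sqrt \<tau>))"
          by (simp add: split_beta')
      qed
      show "(\<lambda>\<omega>. ?w \<omega> * ?H m (coef N (Y \<omega>))) \<in> borel_measurable M" for m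
        using measurable_compose[OF cY Hm] by measurable
      show "(\<lambda>\<omega>. ?w \<omega> * (LINT u|\<kappa> (coef N (Y \<omega>)). \<phi> u)) \<in> borel_measurable M"
        using measurable_compose[OF cY measurable_integral_test_fun[OF \<phi>]] by measurable
      show "AE \<omega> in M. norm (?w \<omega> * ?H m (coef N (Y \<omega>))) \<le> 1" for m
      proof (rule AE_I2)
        fix \<omega>
        have "(\<lambda>s. \<phi> (gauss_shift N v m (coef N (Y \<omega>)) s)) \<in> borel_measurable (white (sqrt \<tau>))"
          using measurable_compose[OF measurable_gauss_shift2 test_fun_measurable[OF \<phi>]] by simp
        then have i: "integrable (white (sqrt \<tau>)) (\<lambda>s. \<phi> (gauss_shift N v m (coef N (Y \<omega>)) s))"
          using test_funD(2,3)[OF \<phi>] by (intro W.integrable_const_bound[where B = 1]) auto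
        have "0 \<le> ?H m (coef N (Y \<omega>))" using test_funD(2)[OF \<phi>] by simp
        moreover have "?H m (coef N (Y \<omega>)) \<le> 1"
          using W.integral_le_const[OF i, of 1] test_funD(3)[OF \<phi>] by auto
        ultimately show "norm (?w \<omega> * ?H m (coef N (Y \<omega>))) \<le> 1" by (simp add: indicator_def)
      qed
    qed simp
    show ?thesis using lim1 lim2 unfolding eq by (rule LIMSEQ_unique)
  qed
  \<comment> \<open>\<open>M\<close> restricted to \<open>D\<close>: the claim says that its image
    under \<open>pre Y Z\<close> is the mixture of the laws \<open>\<kappa>\<close> at the current
    state, an identity of finite measures.\<close>
  define P0 where "P0 = density M (\<lambda>\<omega>. ennreal (?w \<omega>))"
  have P0s: "sets P0 = sets M" "space P0 = space M" unfolding P0_def by auto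
  interpret P0: finite_measure P0
    by (rule finite_measureI) (simp add: P0_def emeasure_density nn_integral_indicator ennreal_indicator)
  have preP: "pre Y Z \<in> P0 \<rightarrow>\<^sub>M borel" using preM unfolding measurable_cong_sets[OF P0s(1) refl] .
  have \<kappa>Y: "(\<lambda>\<omega>. \<kappa> (coef N (Y \<omega>))) \<in> P0 \<rightarrow>\<^sub>M subprob_algebra borel"
    using measurable_compose[OF cY measurable_prob_algebraD[OF measurable_\<kappa>]]
    unfolding measurable_cong_sets[OF P0s(1) refl] .
  have \<kappa>Y': "(\<lambda>\<omega>. \<kappa> (coef N (Y \<omega>))) \<in> M \<rightarrow>\<^sub>M subprob_algebra borel"
    using measurable_compose[OF cY measurable_prob_algebraD[OF measurable_\<kappa>]] .
  have ne: "space P0 \<noteq> {}" unfolding P0s by (rule not_empty)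
  have intP: "(LINT \<omega>|P0. h \<omega>) = (LINT \<omega>|M. ?w \<omega> * h \<omega>)" if "h \<in> borel_measurable M" for h :: "'a \<Rightarrow> real"
    unfolding P0_def using that by (subst integral_density) (auto simp: indicator_def)
  have bind_int: "(LINT u|bind P0 (\<lambda>\<omega>. \<kappa> (coef N (Y \<omega>))). h u) = (LINT \<omega>|M. ?w \<omega> * (LINT u|\<kappa> (coef N (Y \<omega>)). h u))"
    if h: "h \<in> borel_measurable borel" "\<And>u. \<bar>h u\<bar> \<le> 1" for h :: "(nat \<Rightarrow> real) \<Rightarrow> real"
  proof -
    have "(LINT u|bind P0 (\<lambda>\<omega>. \<kappa> (coef N (Y \<omega>))). h u) = (LINT \<omega>|P0. LINT u|\<kappa> (coef N (Y \<omega>)). h u)"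
      by (rule integral_bind[OF h(1) h(2) \<kappa>Y P0.finite_measure_axioms, where B' = 1])
        (auto intro!: AE_I2 simp: prob_space.emeasure_space_1[OF prob_\<kappa>])
    also have "\<dots> = (LINT \<omega>|M. ?w \<omega> * (LINT u|\<kappa> (coef N (Y \<omega>)). h u))"
      by (rule intP) (rule measurable_compose[OF \<kappa>Y' integral_measurable_subprob_algebra[OF h(1)]])
    finally show ?thesis .
  qed
  have dist_int: "(LINT u|distr P0 borel (pre Y Z). h u) = (LINT \<omega>|M. ?w \<omega> * h (pre Y Z \<omega>))"
    if h: "h \<in> borel_measurable borel" for h :: "(nat \<Rightarrow> real) \<Rightarrow> real"
    using integral_distr[OF preP h] intP[OF measurable_compose[OF preM h]] by simp
  have "distr P0 borel (pre Y Z) = bind P0 (\<lambda>\<omega>. \<kappa> (coef N (Y \<omega>)))"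
  proof (rule measure_eqI_test_fun)
    show "finite_measure (distr P0 borel (pre Y Z))" by (rule P0.finite_measure_distr[OF preP])
    show "sets (bind P0 (\<lambda>\<omega>. \<kappa> (coef N (Y \<omega>)))) = sets borel" by (rule sets_bind[OF _ ne]) (rule sets_\<kappa>)
    have "emeasure (bind P0 (\<lambda>\<omega>. \<kappa> (coef N (Y \<omega>)))) UNIV = (\<integral>\<^sup>+ \<omega>. emeasure (\<kappa> (coef N (Y \<omega>))) UNIV \<partial>P0)"
      by (rule emeasure_bind[OF ne \<kappa>Y]) simp
    also have "\<dots> = (\<integral>\<^sup>+ \<omega>. 1 \<partial>P0)"
      using prob_space.emeasure_space_1[OF prob_\<kappa>] by (simp add: space_\<kappa>)
    also have "\<dots> < \<infinity>" using P0.emeasure_finite[of "space P0"] by (simp add: less_top[symmetric])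
    finally show "finite_measure (bind P0 (\<lambda>\<omega>. \<kappa> (coef N (Y \<omega>))))"
      using space_bind[OF sets_\<kappa> ne] by (intro finite_measureI) auto
    fix L :: real and \<phi> :: "(nat \<Rightarrow> real) \<Rightarrow> real" assume \<phi>: "test_fun L \<phi>"
    have "\<bar>\<phi> u\<bar> \<le> 1" for u using test_funD(2,3)[OF \<phi>, of u] by simp
    then show "(LINT u|distr P0 borel (pre Y Z). \<phi> u) = (LINT u|bind P0 (\<lambda>\<omega>. \<kappa> (coef N (Y \<omega>))). \<phi> u)"
      unfolding dist_int[OF test_fun_measurable[OF \<phi>]] test[OF \<phi>]
      by (intro bind_int[symmetric] test_fun_measurable[OF \<phi>])
  qed simp
  then have "(LINT u|distr P0 borel (pre Y Z). indicator A u) = (LINT u|bind P0 (\<lambda>\<omega>. \<kappa> (coef N (Y \<omega>))). indicator A u :: real)"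
    by simp
  moreover have "(LINT u|distr P0 borel (pre Y Z). indicator A u) = (LINT \<omega>|M. ?w \<omega> * indicator A (pre Y Z \<omega>))"
    by (rule dist_int) (use A in simp)
  moreover have "(LINT u|bind P0 (\<lambda>\<omega>. \<kappa> (coef N (Y \<omega>))). indicator A u) = (LINT \<omega>|M. ?w \<omega> * (LINT u|\<kappa> (coef N (Y \<omega>)). indicator A u))"
    by (rule bind_int) (use A in \<open>auto simp: indicator_def\<close>)
  moreover have "(LINT u|\<kappa> c. indicator A u) = measure (\<kappa> c) A" for c
    using A by (simp add: space_\<kappa> sets_\<kappa>)
  ultimately show ?thesis by simp
qed

end

section \<open>The chain\<close>

lemma L2_tendsto_cong:
  assumes eq: "\<And>m x. x \<in> space \<mu> \<Longrightarrow> u m x = u' m x" and L: "L2_tendsto \<mu> u w"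
  shows "L2_tendsto \<mu> u' w"
proof -
  have "u' m \<in> L2_space \<mu>" for m
  proof -
    have "u m \<in> L2_space \<mu>" using L unfolding L2_tendsto_def by blast
    moreover have "u m \<in> borel_measurable \<mu> \<longleftrightarrow> u' m \<in> borel_measurable \<mu>"
      by (rule measurable_cong) (rule eq)
    moreover have "integrable \<mu> (\<lambda>x. (u m x)\<^sup>2) \<longleftrightarrow> integrable \<mu> (\<lambda>x. (u' m x)\<^sup>2)"
      by (rule Bochner_Integration.integrable_cong[OF refl]) (simp add: eq)
    ultimately show ?thesis unfolding L2_space_def by simp
  qed
  moreover have "(LINT x|\<mu>. (u m x - w x)\<^sup>2) = (LINT x|\<mu>. (u' m x - w x)\<^sup>2)" for m
    by (rule Bochner_Integration.integral_cong[OF refl]) (simp add: eq)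
  ultimately show ?thesis using L unfolding L2_tendsto_def by simp
qed

text \<open>The scheme reduced to a fixed map \<open>h\<close> applied to noisy data. Dissipativity
  is assumed almost everywhere under each \<open>\<kappa> c\<close>, because the extended solution
  map is uncontrolled off the range of \<open>step\<close>.\<close>

locale driven_chain = noise_family g K6 N b \<tau> M Fil \<beta> Z0 for g K6 N b \<tau> M Fil \<beta> Z0 +
  fixes h :: "(nat \<Rightarrow> real) \<Rightarrow> real \<Rightarrow> real" and \<theta> C0 :: real
    and X :: "(real \<Rightarrow> real) \<Rightarrow> nat \<Rightarrow> 'a \<Rightarrow> real \<Rightarrow> real"
  assumes h: "h \<in> borel \<rightarrow>\<^sub>M borelVN N"
    and \<theta>: "\<theta> > 1" and C0: "0 \<le> C0"
    and dissipative: "\<And>c. AE u in \<kappa> c. \<theta> * sqn N (coef N (h u)) \<le> sqn N u + C0"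
    and X_adapted: "\<And>x j. x \<in> VN N \<Longrightarrow> X x j \<in> Fil (grid j) \<rightarrow>\<^sub>M borelVN N"
    and X_step: "\<And>x j. x \<in> VN N \<Longrightarrow> \<exists>Z. noise_increment M b \<beta> g N \<tau> j (X x j) Z \<and>
        (AE \<omega> in M. X x (Suc j) \<omega> = h (pre (X x j) Z \<omega>))"
    and X_init: "\<And>x. x \<in> VN N \<Longrightarrow> AE \<omega> in M. X x 0 \<omega> = x"
begin

definition kern :: "(real \<Rightarrow> real) \<Rightarrow> (real \<Rightarrow> real) measure" where
  "kern x = distr (\<kappa> (coef N x)) (borelVN N) h"

lemma h_\<kappa>: "h \<in> \<kappa> c \<rightarrow>\<^sub>M borelVN N"
  using h unfolding measurable_cong_sets[OF sets_\<kappa> refl] .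

lemma kern_measurable: "kern \<in> borelVN N \<rightarrow>\<^sub>M prob_algebra (borelVN N)"
  unfolding kern_def
  by (rule measurable_compose[OF measurable_compose[OF measurable_coef measurable_\<kappa>] measurable_distr_prob_space[OF h]])

lemma measure_kern: "A \<in> sets (borelVN N) \<Longrightarrow> measure (kern x) A = measure (\<kappa> (coef N x)) (h -` A)"
  unfolding kern_def by (subst measure_distr[OF h_\<kappa>]) (simp_all add: space_\<kappa>)

sublocale kernel: markov_kernel "borelVN N" kern
proof (rule markov_kernel.intro)
  have "syn N (\<lambda>_. 0) \<in> space (borelVN N)" by simp
  then show "space (borelVN N) \<noteq> {}" by blast
qed (rule kern_measurable)

text \<open>\<open>noise_markov\<close> on the preimage of \<open>A\<close> under \<open>h\<close>,
  after \<open>Y'\<close> is replaced by its almost sure expression.\<close>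

lemma one_step:
  assumes Y: "Y \<in> Fil (grid j) \<rightarrow>\<^sub>M borelVN N" and Z: "noise_increment M b \<beta> g N \<tau> j Y Z"
    and Y': "Y' \<in> M \<rightarrow>\<^sub>M borelVN N" "AE \<omega> in M. Y' \<omega> = h (pre Y Z \<omega>)"
    and D: "D \<in> sets (Fil (grid j))" and A: "A \<in> sets (borelVN N)"
  shows "(LINT \<omega>|M. indicator D \<omega> * indicator A (Y' \<omega>)) = (LINT \<omega>|M. indicator D \<omega> * measure (kern (Y \<omega>)) A)"
proof -
  have YM: "Y \<in> M \<rightarrow>\<^sub>M borelVN N" by (rule Fil_measurable[OF Y])
  have ZM: "Z \<in> M \<rightarrow>\<^sub>M borelVN N" using Z unfolding noise_increment_def by blast
  note [measurable] = sets_Fil[OF D] A Y'(1) measurable_pre[OF YM ZM]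
  have hA: "h -` A \<in> sets borel" using measurable_sets[OF h A] by simp
  have "(LINT \<omega>|M. indicator D \<omega> * indicator A (Y' \<omega>)) = (LINT \<omega>|M. indicator D \<omega> * indicator (h -` A) (pre Y Z \<omega>) :: real)"
  proof (rule integral_cong_AE)
    show "AE \<omega> in M. indicator D \<omega> * indicator A (Y' \<omega>) = (indicator D \<omega> * indicator (h -` A) (pre Y Z \<omega>) :: real)"
      using Y'(2) by eventually_elim (simp add: indicator_def)
    have "(\<lambda>\<omega>. indicator A (Y' \<omega>) :: real) \<in> borel_measurable M"
      by (rule measurable_compose[OF Y'(1) borel_measurable_indicator[OF A]])
    then show "(\<lambda>\<omega>. indicator D \<omega> * indicator A (Y' \<omega>) :: real) \<in> borel_measurable M" by measurable
    have "(\<lambda>\<omega>. indicator (h -` A) (pre Y Z \<omega>) :: real) \<in> borel_measurable M"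
      by (rule measurable_compose[OF measurable_pre[OF YM ZM] borel_measurable_indicator[OF hA]])
    then show "(\<lambda>\<omega>. indicator D \<omega> * indicator (h -` A) (pre Y Z \<omega>) :: real) \<in> borel_measurable M" by measurable
  qed
  then show ?thesis unfolding noise_markov[OF Y Z D hA] measure_kern[OF A] .
qed

lemma X_measurable: "x \<in> VN N \<Longrightarrow> X x j \<in> M \<rightarrow>\<^sub>M borelVN N"
  by (rule Fil_measurable[OF X_adapted])

lemma space_in_Fil: "space M \<in> sets (Fil (grid j))"
  using sets.top[of "Fil (grid j)"] unfolding space_Fil .

lemma law_step:
  assumes x: "x \<in> VN N" and A: "A \<in> sets (borelVN N)"
  shows "measure (distr M (borelVN N) (X x (Suc j))) A = (LINT \<omega>|M. measure (kern (X x j \<omega>)) A)"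
proof -
  obtain Z where Z: "noise_increment M b \<beta> g N \<tau> j (X x j) Z" "AE \<omega> in M. X x (Suc j) \<omega> = h (pre (X x j) Z \<omega>)"
    using X_step[OF x] by blast
  have "(LINT \<omega>|M. indicator (space M) \<omega> * indicator A (X x (Suc j) \<omega>)) = (LINT \<omega>|M. indicator (space M) \<omega> * measure (kern (X x j \<omega>)) A)"
    by (rule one_step[OF X_adapted[OF x] Z(1) X_measurable[OF x] Z(2) space_in_Fil A])
  moreover have "(LINT \<omega>|M. indicator (space M) \<omega> * measure (kern (X x j \<omega>)) A) = (LINT \<omega>|M. measure (kern (X x j \<omega>)) A)"
    by (rule Bochner_Integration.integral_cong) auto
  moreover have "(LINT \<omega>|M. indicator (space M) \<omega> * indicator A (X x (Suc j) \<omega>)) = measure (distr M (borelVN N) (X x (Suc j))) A"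
  proof -
    have "(LINT \<omega>|M. indicator (space M) \<omega> * indicator A (X x (Suc j) \<omega>)) = (LINT \<omega>|M. indicator (X x (Suc j) -` A \<inter> space M) \<omega> :: real)"
      by (rule Bochner_Integration.integral_cong) (auto simp: indicator_def)
    also have "\<dots> = measure M (X x (Suc j) -` A \<inter> space M)"
      using measurable_sets[OF X_measurable[OF x] A, of "Suc j"] by simp
    finally show ?thesis using measure_distr[OF X_measurable[OF x] A] by simp
  qed
  ultimately show ?thesis by simp
qed

text \<open>The initial value is prescribed almost surely, which already fixes the law at time 0;
  each further law is the previous one integrated against \<open>kern\<close>, as in
  \<open>bind\<close>.\<close>

lemma law_Pn:
  assumes x: "x \<in> VN N"
  shows "distr M (borelVN N) (X x n) = kernel.Pn n x"
proof (induction n)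
  case 0
  have "distr M (borelVN N) (X x 0) = distr M (borelVN N) (\<lambda>_. x)"
    using x X_measurable[OF x] X_init[OF x] by (intro distr_cong_AE) auto
  also have "\<dots> = return (borelVN N) x" by (rule distr_const) (use x in simp)
  finally show ?case by simp
next
  case (Suc n)
  let ?\<mu> = "distr M (borelVN N) (X x n)"
  interpret \<mu>: prob_space ?\<mu> by (rule prob_space_distr[OF X_measurable[OF x]])
  interpret \<nu>: prob_space "distr M (borelVN N) (X x (Suc n))" by (rule prob_space_distr[OF X_measurable[OF x]])
  have kM: "kern \<in> ?\<mu> \<rightarrow>\<^sub>M subprob_algebra (borelVN N)"
    using kernel.P_sub by simp
  have P: "kernel.Pn (Suc n) x = bind ?\<mu> kern" using Suc by simp
  interpret \<rho>: prob_space "kernel.Pn (Suc n) x" by (rule kernel.prob_Pn) (use x in simp)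
  show ?case
  proof (rule measure_eqI)
    show "sets (distr M (borelVN N) (X x (Suc n))) = sets (kernel.Pn (Suc n) x)"
      using kernel.sets_Pn[of x "Suc n"] x by (simp del: kernel.Pn.simps)
    fix A assume "A \<in> sets (distr M (borelVN N) (X x (Suc n)))"
    then have A: "A \<in> sets (borelVN N)" by simp
    have "measure (bind ?\<mu> kern) A = (LINT y|?\<mu>. measure (kern y) A)" by (rule \<mu>.measure_bind[OF kM A])
    also have "\<dots> = (LINT \<omega>|M. measure (kern (X x n \<omega>)) A)"
      by (rule integral_distr[OF X_measurable[OF x] measurable_compose[OF kernel.P_sub measurable_measure_subprob_algebra[OF A]]])
    also have "\<dots> = measure (distr M (borelVN N) (X x (Suc n))) A" by (rule law_step[OF x A, symmetric])
    finally have "measure (kernel.Pn (Suc n) x) A = measure (distr M (borelVN N) (X x (Suc n))) A" unfolding P .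
    then show "emeasure (distr M (borelVN N) (X x (Suc n))) A = emeasure (kernel.Pn (Suc n) x) A"
      unfolding \<nu>.emeasure_eq_measure \<rho>.emeasure_eq_measure by simp
  qed
qed

lemma transition_kernel_eq:
  assumes x: "x \<in> VN N" and A: "A \<in> sets (borelVN N)"
  shows "transition_kernel M X x A = measure (kern x) A"
proof -
  have "transition_kernel M X x A = measure (distr M (borelVN N) (X x (Suc 0))) A"
    unfolding transition_kernel_def using measure_distr[OF X_measurable[OF x] A]
    by (simp add: vimage_def Int_def conj_commute)
  also have "\<dots> = measure (bind (return (borelVN N) x) kern) A" unfolding law_Pn[OF x] by simp
  also have "bind (return (borelVN N) x) kern = kern x"
    by (rule bind_return[OF kernel.P_sub]) (use x in simp)
  finally show ?thesis .
qed

lemma semigroup_eq: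
  assumes x: "x \<in> VN N" and \<phi>: "\<phi> \<in> borel_measurable (borelVN N)"
  shows "semigroup_op M X n \<phi> x = (LINT y|kernel.Pn n x. \<phi> y)"
  unfolding semigroup_op_def law_Pn[OF x, symmetric] by (rule integral_distr[OF X_measurable[OF x] \<phi>, symmetric])

text \<open>The rate is (1 + \<eta>) / \<theta> with \<eta> = (\<theta> - 1) / 2: dissipation
  divides the second moment by \<theta>, Young's inequality multiplies it by 1 + \<eta>, and half of
  the excess of \<theta> over 1 is kept. The overlap condition passes from \<open>\<kappa>\<close>
  to \<open>kern\<close> because \<open>h\<close> is the same map at every state, so a set has one
  and the same preimage for both laws.\<close>

sublocale harris: harris_kernel "borelVN N" kern "\<lambda>x. sqn N (coef N x)" "(1 + \<theta>) / (2 * \<theta>)"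
  "((1 + 2 / (\<theta> - 1)) * noise_var + C0) / \<theta>"
proof (rule harris_kernel.intro[OF kernel.markov_kernel_axioms], rule harris_kernel_axioms.intro)
  show "(\<lambda>x. sqn N (coef N x)) \<in> borel_measurable (borelVN N)"
    by (rule measurable_compose[OF measurable_coef sqn_measurable])
  show "0 \<le> (1 + \<theta>) / (2 * \<theta>)" "(1 + \<theta>) / (2 * \<theta>) < 1" using \<theta> by auto
  show K: "0 \<le> ((1 + 2 / (\<theta> - 1)) * noise_var + C0) / \<theta>"
    using \<theta> C0 noise_var_nonneg by (intro divide_nonneg_pos add_nonneg_nonneg mult_nonneg_nonneg) auto
  show "0 \<le> sqn N (coef N x)" for x by simp
  show "(\<integral>\<^sup>+ y. ennreal (sqn N (coef N y)) \<partial>kern x)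
    \<le> ennreal ((1 + \<theta>) / (2 * \<theta>) * sqn N (coef N x) + ((1 + 2 / (\<theta> - 1)) * noise_var + C0) / \<theta>)" for x
  proof -
    let ?c = "coef N x"
    interpret k: prob_space "\<kappa> ?c" by (rule prob_\<kappa>)
    have sm[measurable]: "sqn N \<in> borel_measurable (\<kappa> ?c)"
      using sqn_measurable unfolding measurable_cong_sets[OF sets_\<kappa> refl] .
    define \<eta> where "\<eta> = (\<theta> - 1) / 2"
    have \<eta>: "\<eta> > 0" unfolding \<eta>_def using \<theta> by simp
    have "(\<integral>\<^sup>+ y. ennreal (sqn N (coef N y)) \<partial>kern x) = (\<integral>\<^sup>+ u. ennreal (sqn N (coef N (h u))) \<partial>\<kappa> ?c)"
      unfolding kern_def
      by (rule nn_integral_distr[OF h_\<kappa>]) (use measurable_compose[OF measurable_coef sqn_measurable] in simp)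
    also have "\<dots> \<le> (\<integral>\<^sup>+ u. ennreal (1 / \<theta>) * (ennreal (sqn N u) + ennreal C0) \<partial>\<kappa> ?c)"
    proof (rule nn_integral_mono_AE)
      show "AE u in \<kappa> ?c. ennreal (sqn N (coef N (h u))) \<le> ennreal (1 / \<theta>) * (ennreal (sqn N u) + ennreal C0)"
        using dissipative[of ?c]
      proof eventually_elim
        case (elim u)
        then have "sqn N (coef N (h u)) \<le> 1 / \<theta> * (sqn N u + C0)" using \<theta> by (simp add: field_simps)
        then have "ennreal (sqn N (coef N (h u))) \<le> ennreal (1 / \<theta> * (sqn N u + C0))" by (rule ennreal_leI)
        also have "\<dots> = ennreal (1 / \<theta>) * (ennreal (sqn N u) + ennreal C0)"
          using \<theta> C0 by (subst ennreal_mult') auto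
        finally show ?case .
      qed
    qed
    also have "\<dots> = ennreal (1 / \<theta>) * ((\<integral>\<^sup>+ u. ennreal (sqn N u) \<partial>\<kappa> ?c) + (\<integral>\<^sup>+ u. ennreal C0 \<partial>\<kappa> ?c))"
      by (subst nn_integral_cmult, measurable, subst nn_integral_add) auto
    also have "(\<integral>\<^sup>+ u. ennreal C0 \<partial>\<kappa> ?c) = ennreal C0"
      by (simp only: nn_integral_const k.emeasure_space_1 mult_1_right)
    also have "ennreal (1 / \<theta>) * ((\<integral>\<^sup>+ u. ennreal (sqn N u) \<partial>\<kappa> ?c) + ennreal C0)
      \<le> ennreal (1 / \<theta>) * (ennreal ((1 + \<eta>) * sqn N ?c + (1 + 1 / \<eta>) * noise_var) + ennreal C0)"
      by (intro mult_left_mono add_right_mono kernel_second_moment[OF \<eta>]) simp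
    also have "\<dots> = ennreal (1 / \<theta> * ((1 + \<eta>) * sqn N ?c + (1 + 1 / \<eta>) * noise_var + C0))"
    proof -
      have nn: "0 \<le> (1 + \<eta>) * sqn N ?c + (1 + 1 / \<eta>) * noise_var"
        using \<eta> noise_var_nonneg by (intro add_nonneg_nonneg mult_nonneg_nonneg) auto
      show ?thesis unfolding ennreal_plus[OF nn C0, symmetric] using \<theta> by (subst ennreal_mult'[symmetric]) auto
    qed
    also have "1 / \<theta> * ((1 + \<eta>) * sqn N ?c + (1 + 1 / \<eta>) * noise_var + C0)
      = (1 + \<theta>) / (2 * \<theta>) * sqn N ?c + ((1 + 2 / (\<theta> - 1)) * noise_var + C0) / \<theta>"
    proof -
      have e: "1 / \<eta> = 2 / (\<theta> - 1)" "1 + \<eta> = (1 + \<theta>) / 2" unfolding \<eta>_def by (auto simp: field_simps)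
      have "1 / \<theta> * (p / 2 * s + w) = p / (2 * \<theta>) * s + w / \<theta>" for p s w
        using \<theta> by (simp add: field_simps)
      then show ?thesis unfolding e add.assoc .
    qed
    finally show ?thesis .
  qed
  show "\<exists>\<alpha>>0. \<forall>x \<in> space (borelVN N). \<forall>y \<in> space (borelVN N). sqn N (coef N x) + sqn N (coef N y) \<le> R \<longrightarrow>
      (\<forall>A \<in> sets (borelVN N). measure (kern x) A - measure (kern y) A \<le> 1 - \<alpha>)" for R
  proof (rule small_set_condition[of R])
    fix \<epsilon> :: real assume \<epsilon>: "\<epsilon> > 0"
      "\<And>c c' A. sqn N c + sqn N c' \<le> R \<Longrightarrow> A \<in> sets borel \<Longrightarrow> measure (\<kappa> c) A - measure (\<kappa> c') A \<le> 1 - \<epsilon>"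
    show ?thesis
    proof (intro exI[of _ \<epsilon>] conjI ballI impI \<epsilon>(1))
      fix x y A assume "sqn N (coef N x) + sqn N (coef N y) \<le> R" and A: "A \<in> sets (borelVN N)"
      then show "measure (kern x) A - measure (kern y) A \<le> 1 - \<epsilon>"
        unfolding measure_kern[OF A] using measurable_sets[OF h A] by (intro \<epsilon>(2)) auto
    qed
  qed
qed

text \<open>The two kernels agree at points of \<open>VN N\<close> and measurable sets, and a
  measure with the sets of \<open>borelVN N\<close> lives on exactly these points.\<close>

lemma invariant_iff: "invariant_prob N (transition_kernel M X) \<mu> \<longleftrightarrow> kernel.invariant \<mu>"
proof -
  have "(\<integral>\<^sup>+ x. ennreal (transition_kernel M X x A) \<partial>\<mu>) = (\<integral>\<^sup>+ x. emeasure (kern x) A \<partial>\<mu>)"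
    if s: "sets \<mu> = sets (borelVN N)" and A: "A \<in> sets (borelVN N)" for A
  proof (rule nn_integral_cong)
    fix x assume "x \<in> space \<mu>"
    then have x: "x \<in> VN N" using sets_eq_imp_space_eq[OF s] by simp
    interpret p: prob_space "kern x" by (rule kernel.prob_P) (use x in simp)
    show "ennreal (transition_kernel M X x A) = emeasure (kern x) A"
      unfolding transition_kernel_eq[OF x A] p.emeasure_eq_measure ..
  qed
  then show ?thesis unfolding invariant_prob_def kernel.invariant_def by auto
qed

theorem uniquely_ergodic: "uniquely_ergodic N (transition_kernel M X) (semigroup_op M X)"
  unfolding uniquely_ergodic_def invariant_iff
proof (intro conjI allI impI)
  show "\<exists>!\<mu>. kernel.invariant \<mu>" by (rule harris.harris(1))
  fix \<mu> assume \<mu>: "kernel.invariant \<mu>"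
  show "ergodic_prob (semigroup_op M X) \<mu>"
    unfolding ergodic_prob_def
  proof
    fix \<phi> assume \<phi>: "\<phi> \<in> L2_space \<mu>"
    have \<phi>m: "\<phi> \<in> borel_measurable (borelVN N)"
      using \<phi> kernel.borel_measurable_invariant[OF \<mu>] unfolding L2_space_def by auto
    show "L2_tendsto \<mu> (\<lambda>m x. (1 / real m) * (\<Sum>n = 0..m. semigroup_op M X n \<phi> x)) (\<lambda>_. LINT y|\<mu>. \<phi> y)"
    proof (rule L2_tendsto_cong[OF _ harris.harris(2)[OF \<mu> \<phi>]])
      fix m x assume "x \<in> space \<mu>"
      then have x: "x \<in> VN N" using kernel.invariantD(3)[OF \<mu>] by simp
      show "(1 / real m) * (\<Sum>n = 0..m. LINT y|kernel.Pn n x. \<phi> y) = (1 / real m) * (\<Sum>n = 0..m. semigroup_op M X n \<phi> x)"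
        using semigroup_eq[OF x \<phi>m] by simp
    qed
  qed
qed

text \<open>\<open>Y\<close> has its own initial law, while the kernel is read off the family
  \<open>X\<close> of deterministic starts; the common map \<open>h\<close> and the law
  \<open>\<kappa>\<close> connect them. A conditional expectation is characterised by its integrals
  over events of the past, and these integrals are supplied by \<open>one_step\<close>.\<close>

theorem markov_chain:
  assumes Y: "\<And>j. Y j \<in> Fil (grid j) \<rightarrow>\<^sub>M borelVN N"
    and Y_step: "\<And>j. \<exists>Z. noise_increment M b \<beta> g N \<tau> j (Y j) Z \<and> (AE \<omega> in M. Y (Suc j) \<omega> = h (pre (Y j) Z \<omega>))"
  shows "markov_chain_with_kernel M Fil N \<tau> Y (transition_kernel M X)"
  unfolding markov_chain_with_kernel_def
proof (intro conjI ballI allI)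
  fix A assume A: "A \<in> sets (borelVN N)"
  have km: "(\<lambda>x. measure (kern x) A) \<in> borel_measurable (borelVN N)"
    by (rule measurable_compose[OF kernel.P_sub measurable_measure_subprob_algebra[OF A]])
  show "(\<lambda>x. transition_kernel M X x A) \<in> borel_measurable (borelVN N)"
    using km by (subst measurable_cong[OF transition_kernel_eq[OF _ A]]) auto
  fix n
  interpret sub: finite_measure_subalgebra M "Fil (grid n)"
    by unfold_locales (rule subalg[OF grid(1)])
  obtain Z where Z: "noise_increment M b \<beta> g N \<tau> n (Y n) Z" "AE \<omega> in M. Y (Suc n) \<omega> = h (pre (Y n) Z \<omega>)"
    using Y_step by blast
  have YSM: "Y (Suc n) \<in> M \<rightarrow>\<^sub>M borelVN N" by (rule Fil_measurable[OF Y])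
  have YM: "Y n \<in> M \<rightarrow>\<^sub>M borelVN N" by (rule Fil_measurable[OF Y])
  let ?I = "{\<omega> \<in> space M. Y (Suc n) \<omega> \<in> A}"
  have I: "?I \<in> sets M" using measurable_sets[OF YSM A] by (simp add: vimage_def Int_def conj_commute)
  have kF: "(\<lambda>\<omega>. measure (kern (Y n \<omega>)) A) \<in> borel_measurable (Fil (grid n))"
    by (rule measurable_compose[OF Y km])
  have kM: "(\<lambda>\<omega>. measure (kern (Y n \<omega>)) A) \<in> borel_measurable M"
    by (rule measurable_compose[OF YM km])
  have k1: "measure (kern (Y n \<omega>)) A \<le> 1" if "\<omega> \<in> space M" for \<omega>
    by (rule prob_space.prob_le_1[OF kernel.prob_P[OF measurable_space[OF YM that]]])
  have "AE \<omega> in M. real_cond_exp M (Fil (grid n)) (indicator ?I) \<omega> = measure (kern (Y n \<omega>)) A"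
  proof (rule sub.real_cond_exp_charact)
    fix D assume D: "D \<in> sets (Fil (grid n))"
    have "(LINT \<omega>|M. indicator D \<omega> * indicator ?I \<omega>) = (LINT \<omega>|M. indicator D \<omega> * indicator A (Y (Suc n) \<omega>) :: real)"
      by (rule Bochner_Integration.integral_cong) (auto simp: indicator_def)
    also have "\<dots> = (LINT \<omega>|M. indicator D \<omega> * measure (kern (Y n \<omega>)) A)"
      by (rule one_step[OF Y Z(1) YSM Z(2) D A])
    finally show "(LINT \<omega>:D|M. indicator ?I \<omega>) = (LINT \<omega>:D|M. measure (kern (Y n \<omega>)) A)"
      unfolding set_lebesgue_integral_def by simp
  next
    show "integrable M (indicator ?I :: 'a \<Rightarrow> real)" using I by (simp add: less_top[symmetric])
    show "integrable M (\<lambda>\<omega>. measure (kern (Y n \<omega>)) A)"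
      by (rule integrable_const_bound[where B = 1]) (use kM k1 in \<open>auto intro!: AE_I2\<close>)
  qed (rule kF)
  moreover have "transition_kernel M X (Y n \<omega>) A = measure (kern (Y n \<omega>)) A" if "\<omega> \<in> space M" for \<omega>
    by (rule transition_kernel_eq[OF _ A]) (use measurable_space[OF YM that] in simp)
  ultimately show "AE \<omega> in M. real_cond_exp M (Fil (real n * \<tau>)) (indicator ?I) \<omega> = transition_kernel M X (Y n \<omega>) A"
    by (auto elim!: AE_mp intro!: AE_I2)
qed

end

section \<open>The Euler scheme as a driven chain\<close>

theorem theorem3p1:
  fixes f g :: "real \<Rightarrow> real"
    and K1 K2 K3 K4 K5 K6 q \<tau> :: real
    and N :: nat
    and M :: "'a measure" and Fil :: "real \<Rightarrow> 'a measure"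
    and b :: "nat \<Rightarrow> real \<Rightarrow> real" and \<beta> :: "nat \<Rightarrow> real \<Rightarrow> 'a \<Rightarrow> real"
    and X :: "(real \<Rightarrow> real) \<Rightarrow> nat \<Rightarrow> 'a \<Rightarrow> (real \<Rightarrow> real)"
  assumes f_one_sided: "\<And>\<xi> \<eta>. (f \<xi> - f \<eta>) * (\<xi> - \<eta>) \<le> K1 * (\<xi> - \<eta>)\<^sup>2"
    and f_coercive: "\<And>\<xi>. f \<xi> * \<xi> \<le> K2 * \<bar>\<xi>\<bar>\<^sup>2 + K3"
    and q: "q \<ge> 1"
    and f_growth: "\<And>\<xi>. \<bar>f \<xi>\<bar> \<le> K4 * \<bar>\<xi>\<bar> powr q + K5"
    and g_cont: "continuous_on UNIV g"
    and K6: "K6 \<ge> 0"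
    and g_bound: "\<And>\<xi>. 0 \<noteq> \<bar>g \<xi>\<bar> \<and> \<bar>g \<xi>\<bar> \<le> K6"
    and K2: "K2 < pi\<^sup>2"
    and N: "N \<ge> 1"
    and \<tau>: "0 < \<tau>" "\<tau> < 1" "(K1 - pi\<^sup>2) * \<tau> < 1"
    and M: "complete_filtered_prob_space M Fil"
    and b: "orthonormal_basis_H b"
    and \<beta>: "independent_Brownian_motions M Fil \<beta>"
    and X: "\<And>x. x \<in> VN N \<Longrightarrow> euler_chain M Fil b \<beta> f g N \<tau> (X x)"
    and X_init: "\<And>x. x \<in> VN N \<Longrightarrow> AE \<omega> in M. X x 0 \<omega> = x"
  shows "(\<forall>Y. euler_chain M Fil b \<beta> f g N \<tau> Y
            \<longrightarrow> markov_chain_with_kernel M Fil N \<tau> Y (transition_kernel M X))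
         \<and> uniquely_ergodic N (transition_kernel M X) (semigroup_op M X)"
proof -
  interpret D: drift_term f K1 K2 K3 K4 K5 q \<tau> N
    by (rule drift_term.intro; fact)
  interpret S: noise_setup g K6 N b \<tau> M Fil \<beta>
    by (intro noise_setup.intro diffusion_term.intro noise_setup_axioms.intro; fact)
  obtain r :: "(nat \<Rightarrow> real) \<Rightarrow> nat \<Rightarrow> real" where r: "r \<in> borel_measurable borel"
    "\<And>y c i. (\<And>k. k \<in> {1..N} \<Longrightarrow> y k = D.step c k) \<Longrightarrow> i \<in> {1..N} \<Longrightarrow> r y i = c i"
    by (rule D.measurable_step_inverse) blast
  define h where "h u = syn N (r u)" for u
  have hm: "h \<in> borel \<rightarrow>\<^sub>M borelVN N"
    unfolding h_def by (rule measurable_compose[OF r(1) measurable_syn])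
  \<comment> \<open>Where the scheme holds, \<open>step_of_scheme\<close> places the data in the
    range of \<open>step\<close>, and there \<open>r\<close> inverts it. Uniqueness of the implicit
    solution thus makes the new state a function of the data alone.\<close>
  have solve: "w = h (S.pre Y Z \<omega>) \<and> (\<forall>k \<in> {1..N}. S.pre Y Z \<omega> k = D.step (coef N w) k)"
    if "Y \<omega> \<in> VN N" "w \<in> VN N" "Z \<omega> \<in> VN N"
      and "w = (\<lambda>\<xi>. Y \<omega> \<xi> + \<tau> * DeltaN N w \<xi> + \<tau> * PN N (Fop f w) \<xi> + Z \<omega> \<xi>)" for Y Z w \<omega>
  proof -
    have k: "S.pre Y Z \<omega> k = D.step (coef N w) k" if "k \<in> {1..N}" for k
      unfolding S.pre_def by (rule D.step_of_scheme[symmetric]) fact+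
    have "h (S.pre Y Z \<omega>) = syn N (coef N w)" unfolding h_def by (rule syn_cong) (rule r(2)[OF k])
    also have "\<dots> = w" by (rule syn_coef) fact
    finally show ?thesis using k by simp
  qed
  have chain: "Y j \<in> Fil (real j * \<tau>) \<rightarrow>\<^sub>M borelVN N"
    "\<exists>Z. noise_increment M b \<beta> g N \<tau> j (Y j) Z \<and> (AE \<omega> in M. Y (Suc j) \<omega> = h (S.pre (Y j) Z \<omega>) \<and>
       (\<forall>k \<in> {1..N}. S.pre (Y j) Z \<omega> k = D.step (coef N (Y (Suc j) \<omega>)) k))"
    if Y: "euler_chain M Fil b \<beta> f g N \<tau> Y" for Y j
  proof -
    have Ym: "Y i \<in> Fil (real i * \<tau>) \<rightarrow>\<^sub>M borelVN N" for i using Y unfolding euler_chain_def by blast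
    then show "Y j \<in> Fil (real j * \<tau>) \<rightarrow>\<^sub>M borelVN N" .
    obtain Z where Z: "noise_increment M b \<beta> g N \<tau> j (Y j) Z"
      "AE \<omega> in M. Y (Suc j) \<omega> = (\<lambda>\<xi>. Y j \<omega> \<xi> + \<tau> * DeltaN N (Y (Suc j) \<omega>) \<xi>
                + \<tau> * PN N (Fop f (Y (Suc j) \<omega>)) \<xi> + Z \<omega> \<xi>)"
      using Y unfolding euler_chain_def by blast
    have ZM: "Z \<in> M \<rightarrow>\<^sub>M borelVN N" using Z unfolding noise_increment_def by blast
    have "AE \<omega> in M. \<omega> \<in> space M" by (rule AE_I2)
    with Z(2) have "AE \<omega> in M. Y (Suc j) \<omega> = h (S.pre (Y j) Z \<omega>) \<and>
       (\<forall>k \<in> {1..N}. S.pre (Y j) Z \<omega> k = D.step (coef N (Y (Suc j) \<omega>)) k)"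
    proof eventually_elim
      case (elim \<omega>)
      show ?case
      proof (rule solve)
        show "Y j \<omega> \<in> VN N" using measurable_space[OF S.Fil_measurable[OF Ym] elim(2)] by simp
        show "Y (Suc j) \<omega> \<in> VN N" using measurable_space[OF S.Fil_measurable[OF Ym] elim(2)] by simp
        show "Z \<omega> \<in> VN N" using measurable_space[OF ZM elim(2)] by simp
      qed (rule elim(1))
    qed
    with Z(1) show "\<exists>Z. noise_increment M b \<beta> g N \<tau> j (Y j) Z \<and> (AE \<omega> in M. Y (Suc j) \<omega> = h (S.pre (Y j) Z \<omega>) \<and>
       (\<forall>k \<in> {1..N}. S.pre (Y j) Z \<omega> k = D.step (coef N (Y (Suc j) \<omega>)) k))" by blast
  qed
  have chain': "\<exists>Z. noise_increment M b \<beta> g N \<tau> j (Y j) Z \<and> (AE \<omega> in M. Y (Suc j) \<omega> = h (S.pre (Y j) Z \<omega>))"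
    if Y: "euler_chain M Fil b \<beta> f g N \<tau> Y" for Y j
    using chain(2)[OF Y, of j] by (auto elim!: AE_mp intro: AE_I2)
  \<comment> \<open>Existence of the noise for every fixed state, and almost sure solvability there,
    are read off the first step of the given chains.\<close>
  have "\<forall>c. \<exists>Z. noise_increment M b \<beta> g N \<tau> 0 (\<lambda>_. syn N c) Z \<and>
      (AE \<omega> in M. \<exists>w. h (S.pre (\<lambda>_. syn N c) Z \<omega>) = w \<and>
        (\<forall>k \<in> {1..N}. S.pre (\<lambda>_. syn N c) Z \<omega> k = D.step (coef N w) k))"
  proof
    fix c
    let ?x = "syn N c"
    obtain Z where Z: "noise_increment M b \<beta> g N \<tau> 0 (X ?x 0) Z"
      "AE \<omega> in M. X ?x (Suc 0) \<omega> = h (S.pre (X ?x 0) Z \<omega>) \<and>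
       (\<forall>k \<in> {1..N}. S.pre (X ?x 0) Z \<omega> k = D.step (coef N (X ?x (Suc 0) \<omega>)) k)"
      using chain(2)[OF X[OF syn_in_VN[of N c]], of 0] by blast
    \<comment> \<open>The start is deterministic only almost surely; the integrals that define the
      noise increment do not see the exceptional set.\<close>
    have x0: "AE \<omega> in M. X ?x 0 \<omega> = ?x" by (rule X_init[OF syn_in_VN])
    have "noise_increment M b \<beta> g N \<tau> 0 (\<lambda>_. ?x) Z"
      unfolding noise_increment_def
    proof
      show "Z \<in> M \<rightarrow>\<^sub>M borelVN N" using Z(1) unfolding noise_increment_def by blast
      let ?n = "\<lambda>m Y \<omega>. ennreal ((nrm (\<lambda>\<xi>. (\<Sum>k<m. PN N (Gop g Y (b k)) \<xi> * (\<beta> k (real (Suc 0) * \<tau>) \<omega> - \<beta> k (real 0 * \<tau>) \<omega>)) - Z \<omega> \<xi>))\<^sup>2)"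
      have "(\<integral>\<^sup>+ \<omega>. ?n m (X ?x 0 \<omega>) \<omega> \<partial>M) = (\<integral>\<^sup>+ \<omega>. ?n m ?x \<omega> \<partial>M)" for m
        by (rule nn_integral_cong_AE) (use x0 in eventually_elim, simp)
      then show "(\<lambda>m. \<integral>\<^sup>+ \<omega>. ?n m ?x \<omega> \<partial>M) \<longlonglongrightarrow> 0"
        using Z(1) unfolding noise_increment_def by simp
    qed
    moreover have "AE \<omega> in M. \<exists>w. h (S.pre (\<lambda>_. ?x) Z \<omega>) = w \<and>
        (\<forall>k \<in> {1..N}. S.pre (\<lambda>_. ?x) Z \<omega> k = D.step (coef N w) k)"
      using Z(2) x0
    proof eventually_elim
      case (elim \<omega>)
      have "S.pre (X ?x 0) Z \<omega> = S.pre (\<lambda>_. ?x) Z \<omega>" unfolding S.pre_def elim(2) ..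
      then show ?case using elim(1) by metis
    qed
    ultimately show "\<exists>Z. noise_increment M b \<beta> g N \<tau> 0 (\<lambda>_. ?x) Z \<and>
      (AE \<omega> in M. \<exists>w. h (S.pre (\<lambda>_. ?x) Z \<omega>) = w \<and>
        (\<forall>k \<in> {1..N}. S.pre (\<lambda>_. ?x) Z \<omega> k = D.step (coef N w) k))" by blast
  qed
  from choice[OF this] obtain Z0 where Z0: "\<And>c. noise_increment M b \<beta> g N \<tau> 0 (\<lambda>_. syn N c) (Z0 c)"
    "\<And>c. AE \<omega> in M. \<exists>w. h (S.pre (\<lambda>_. syn N c) (Z0 c) \<omega>) = w \<and>
        (\<forall>k \<in> {1..N}. S.pre (\<lambda>_. syn N c) (Z0 c) \<omega> k = D.step (coef N w) k)"
    by blast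
  interpret F: noise_family g K6 N b \<tau> M Fil \<beta> Z0
    by (intro noise_family.intro noise_family_axioms.intro S.noise_setup_axioms Z0(1))
  \<comment> \<open>The factor is the one in \<open>step_coercive\<close>. The absolute value makes
    the additive constant nonnegative, as \<open>driven_chain\<close> demands, for K3 of either
    sign.\<close>
  let ?\<theta> = "2 * (1 + \<tau> * (pi\<^sup>2 - K2)) - 1" and ?C = "2 * \<tau> * \<bar>K3\<bar>"
  have diss: "AE u in F.\<kappa> c. ?\<theta> * sqn N (coef N (h u)) \<le> sqn N u + ?C" for c
    unfolding F.\<kappa>_def
  proof (subst AE_distr_iff[OF F.measurable_pre0])
    have "(\<lambda>u. sqn N (coef N (h u))) \<in> borel_measurable borel"
      by (rule measurable_compose[OF hm measurable_compose[OF measurable_coef sqn_measurable]])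
    then show "{u \<in> space borel. ?\<theta> * sqn N (coef N (h u)) \<le> sqn N u + ?C} \<in> sets borel" by measurable
    show "AE \<omega> in M. ?\<theta> * sqn N (coef N (h (S.pre (\<lambda>_. syn N c) (Z0 c) \<omega>))) \<le> sqn N (S.pre (\<lambda>_. syn N c) (Z0 c) \<omega>) + ?C"
      using Z0(2)[of c]
    proof eventually_elim
      case (elim \<omega>)
      let ?w = "coef N (h (S.pre (\<lambda>_. syn N c) (Z0 c) \<omega>))"
      have "sqn N (S.pre (\<lambda>_. syn N c) (Z0 c) \<omega>) = (\<Sum>k = 1..N. (D.step ?w k)\<^sup>2)"
        unfolding sqn_def using elim by (intro sum.cong) auto
      moreover have "2 * \<tau> * K3 \<le> ?C" using \<tau> by (intro mult_left_mono) auto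
      ultimately show ?case using D.step_coercive[of ?w] unfolding sqn_def by linarith
    qed
  qed
  have \<theta>: "?\<theta> > 1" using \<tau> K2 by simp
  interpret C: driven_chain g K6 N b \<tau> M Fil \<beta> Z0 h ?\<theta> ?C X
  proof (intro driven_chain.intro driven_chain_axioms.intro F.noise_family_axioms)
    show "h \<in> borel \<rightarrow>\<^sub>M borelVN N" by (rule hm)
    show "?\<theta> > 1" by (rule \<theta>)
    show "0 \<le> ?C" using \<tau> by simp
    show "AE u in F.\<kappa> c. ?\<theta> * sqn N (coef N (h u)) \<le> sqn N u + ?C" for c by (rule diss)
    show "X x j \<in> Fil (real j * \<tau>) \<rightarrow>\<^sub>M borelVN N" if "x \<in> VN N" for x j by (rule chain(1)[OF X[OF that]])
    show "\<exists>Z. noise_increment M b \<beta> g N \<tau> j (X x j) Z \<and> (AE \<omega> in M. X x (Suc j) \<omega> = h (S.pre (X x j) Z \<omega>))"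
      if "x \<in> VN N" for x j by (rule chain'[OF X[OF that]])
    show "AE \<omega> in M. X x 0 \<omega> = x" if "x \<in> VN N" for x by (rule X_init[OF that])
  qed
  show ?thesis
  proof (intro conjI allI impI)
    fix Y assume Y: "euler_chain M Fil b \<beta> f g N \<tau> Y"
    show "markov_chain_with_kernel M Fil N \<tau> Y (transition_kernel M X)"
      by (rule C.markov_chain[OF chain(1)[OF Y] chain'[OF Y]])
  qed (rule C.uniquely_ergodic)
qed

end
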